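(* Let $\nu$ be a probability measure on $\mathbb{R}^d$ that is absolutely continuous with respect to the Lebesgue measure and has a finite second moment. Suppose that $\nu$ satisfies at least one of the following: (i) $\nu$ is $\beta$-semi-log-convex for some $\beta>0$ and $\kappa$-semi-log-concave for some $\kappa>0$, with $\mathrm{supp}(\nu)=\mathbb{R}^d$; (iii) $\nu=N(0,\sigma^2\mathbf{I}_d)*\rho$ with $\sigma>0$, where $\rho$ is a probability measure supported on a Euclidean ball of radius $R$ in $\mathbb{R}^d$; (iv) $\nu$ is $\beta$-semi-log-convex for some $\beta>0$, $\kappa$-semi-log-concave for some $\kappa\le0$, and $\frac{d\nu}{d\gamma_d}(x)$ is $L$-log-Lipschitz in $x$ for some $L\ge0$, with $\mathrm{supp}(\nu)=\mathbb{R}^d$. Then there exists a unique solution $(X_t)_{t\in[0,1]}$ to the initial value problem $$\frac{dX_t}{dt}(x)=v(t,X_t(x)),\quad X_0(x)=x\sim\mu,\quad t\in[0,1].$$ Moreover, the push-forward measure satisfies ${X_t}_{\#}\mu=\mathrm{Law}(a_t\mathsf{Z}+b_t\mathsf{X}_1)$ with $\mathsf{Z}\sim\gamma_d$ and $\mathsf{X}_1\sim\nu$ independent.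
   Context: Fix functions $a_t,b_t$ of $t\in[0,1]$ (a dot denotes the time derivative) satisfying: $\dot a_t\le 0$, $\dot b_t\ge 0$, $a_0>0$, $b_0\ge 0$, $a_1=0$, $b_1=1$; $a_t>0$ and $b_t>0$ for all $t\in(0,1)$; $a_t,b_t\in C^2([0,1))$, $a_t^2\in C^1([0,1])$, $b_t\in C^1([0,1])$. Let $\gamma_d:=N(0,\mathbf{I}_d)$, let $\mathsf{Z}\sim\gamma_d$ and $\mathsf{X}_1\sim\nu$ be independent, $\mathsf{X}_t=a_t\mathsf{Z}+b_t\mathsf{X}_1$, and $\mu=\mathrm{Law}(\mathsf{X}_0)=\mathrm{Law}(a_0\mathsf{Z}+b_0\mathsf{X}_1)$. The velocity field is $v(t,x)=\mathbb{E}[\dot a_t\mathsf{Z}+\dot b_t\mathsf{X}_1\mid\mathsf{X}_t=x]$ for $t\in(0,1)$, $v(0,x)=\lim_{t\downarrow0}v(t,x)$, $v(1,x)=\lim_{t\uparrow1}v(t,x)$. A probability measure $\exp(-U)\,dx$ is $\kappa$-semi-log-concave ($\kappa\in\mathbb{R}$) if its support $\Omega\subseteq\mathbb{R}^d$ is convex and $U\in C^2(\Omega)$ satisfies $\nabla^2U(x)\succeq\kappa\mathbf{I}_d$ on $\Omega$; it is $\beta$-semi-log-convex ($\beta>0$) if its support $\Omega$ is convex and $U\in C^2(\Omega)$ satisfies $\nabla^2U(x)\preceq\beta\mathbf{I}_d$ on $\Omega$. A function $f:\mathbb{R}^d\to\mathbb{R}_+$ is $L$-log-Lipschitz if $\log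 f$ is $L$-Lipschitz. *)

theory Defs
  imports "HOL-Probability.Probability"
begin

definition C1_on :: "real set \<Rightarrow> (real \<Rightarrow> real) \<Rightarrow> bool" where
  "C1_on S f \<longleftrightarrow>
     (\<exists>f'. (\<forall>t\<in>S. (f has_real_derivative f' t) (at t within S)) \<and> continuous_on S f')"

definition C2_on :: "real set \<Rightarrow> (real \<Rightarrow> real) \<Rightarrow> bool" where
  "C2_on S f \<longleftrightarrow>
     (\<exists>f'. (\<forall>t\<in>S. (f has_real_derivative f' t) (at t within S)) \<and> C1_on S f')"

text \<open>Time derivative of a function on the unit interval: two-sided in the interior,
  one-sided at the end points.\<close>

definition time_deriv :: "(real \<Rightarrow> real) \<Rightarrow> real \<Rightarrow> real" where
  "time_deriv f t = vector_derivative f (at t within {0..1})"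

text \<open>Only the square of \<open>a\<close> has to be differentiable at time 1 (an example is
  \<open>a t = sqrt (1 - t\<^sup>2)\<close>), so the monotonicity condition on \<open>a\<close> leaves out \<open>t = 1\<close>.\<close>

definition interpolation_schedule :: "(real \<Rightarrow> real) \<Rightarrow> (real \<Rightarrow> real) \<Rightarrow> bool" where
  "interpolation_schedule a b \<longleftrightarrow>
     (\<forall>t\<in>{0..<1}. time_deriv a t \<le> 0) \<and> (\<forall>t\<in>{0..1}. time_deriv b t \<ge> 0) \<and>
     a 0 > 0 \<and> b 0 \<ge> 0 \<and> a 1 = 0 \<and> b 1 = 1 \<and>
     (\<forall>t\<in>{0<..<1}. a t > 0 \<and> b t > 0) \<and>
     C2_on {0..<1} a \<and> C2_on {0..<1} b \<and>
     C1_on {0..1} (\<lambda>t. (a t)\<^sup>2) \<and> C1_on {0..1} b"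

text \<open>The centred Gaussian measure with covariance matrix \<open>\<sigma>\<^sup>2 I\<close>
  (\<open>\<sigma>\<close> is the standard deviation).\<close>

definition gaussian :: "real \<Rightarrow> (real ^ 'n) measure" where
  "gaussian \<sigma> = density lborel (\<lambda>x. ennreal (\<Prod>i\<in>UNIV. normal_density 0 \<sigma> (x $ i)))"

definition measure_support :: "'a::topological_space measure \<Rightarrow> 'a set" where
  "measure_support \<mu> = {x. \<forall>S. open S \<longrightarrow> x \<in> S \<longrightarrow> emeasure \<mu> S > 0}"

definition loewner_le :: "real ^ 'n ^ 'n \<Rightarrow> real ^ 'n ^ 'n \<Rightarrow> bool" where
  "loewner_le A B \<longleftrightarrow> (\<forall>h. h \<bullet> (A *v h) \<le> h \<bullet> (B *v h))"

text \<open>\<open>C2_with_hessian \<Omega> U H\<close>: \<open>U\<close> is twice continuously differentiable on \<open>\<Omega>\<close> with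
  gradient \<open>G\<close> and Hessian matrix \<open>H\<close>. Derivatives are taken within \<open>\<Omega>\<close>; it is only used for
  convex sets \<open>\<Omega>\<close> of positive Lebesgue measure, which have nonempty interior, so that these
  derivatives are unique.\<close>

definition C2_with_hessian ::
    "(real ^ 'n) set \<Rightarrow> (real ^ 'n \<Rightarrow> real) \<Rightarrow> (real ^ 'n \<Rightarrow> real ^ 'n ^ 'n) \<Rightarrow> bool" where
  "C2_with_hessian \<Omega> U H \<longleftrightarrow>
     (\<exists>G. (\<forall>x\<in>\<Omega>. (U has_derivative (\<lambda>h. G x \<bullet> h)) (at x within \<Omega>)) \<and>
          (\<forall>x\<in>\<Omega>. (G has_derivative (\<lambda>h. H x *v h)) (at x within \<Omega>)) \<and>
          continuous_on \<Omega> H)"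

text \<open>\<open>\<mu>\<close> is the measure \<open>exp (- U) dx\<close>, where \<open>U\<close> is infinite off the support of \<open>\<mu>\<close>.\<close>

definition has_potential :: "(real ^ 'n) measure \<Rightarrow> (real ^ 'n \<Rightarrow> real) \<Rightarrow> bool" where
  "has_potential \<mu> U \<longleftrightarrow>
     \<mu> = density lborel (\<lambda>x. ennreal (exp (- U x)) * indicator (measure_support \<mu>) x)"

definition semi_log_concave :: "real \<Rightarrow> (real ^ 'n) measure \<Rightarrow> bool" where
  "semi_log_concave \<kappa> \<mu> \<longleftrightarrow>
     convex (measure_support \<mu>) \<and>
     (\<exists>U H. has_potential \<mu> U \<and> C2_with_hessian (measure_support \<mu>) U H \<and>
            (\<forall>x\<in>measure_support \<mu>. loewner_le (\<kappa> *\<^sub>R mat 1) (H x)))"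

definition semi_log_convex :: "real \<Rightarrow> (real ^ 'n) measure \<Rightarrow> bool" where
  "semi_log_convex \<beta> \<mu> \<longleftrightarrow>
     convex (measure_support \<mu>) \<and>
     (\<exists>U H. has_potential \<mu> U \<and> C2_with_hessian (measure_support \<mu>) U H \<and>
            (\<forall>x\<in>measure_support \<mu>. loewner_le (H x) (\<beta> *\<^sub>R mat 1)))"

text \<open>Positivity is explicit because \<open>ln 0 = 0\<close>.\<close>

definition log_lipschitz :: "real \<Rightarrow> (real ^ 'n \<Rightarrow> real) \<Rightarrow> bool" where
  "log_lipschitz L f \<longleftrightarrow> (\<forall>x. f x > 0) \<and> L-lipschitz_on UNIV (\<lambda>x. ln (f x))"

text \<open>The function \<open>x \<mapsto> E[Y | X = x]\<close>. Conditional expectation determines it only up to null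
  sets of the law of \<open>X\<close>; we take the continuous version, which is unique when the law of \<open>X\<close>
  has full support.\<close>

definition cond_exp_given ::
    "'w measure \<Rightarrow> ('w \<Rightarrow> real ^ 'n) \<Rightarrow> ('w \<Rightarrow> real ^ 'n) \<Rightarrow> real ^ 'n \<Rightarrow> real ^ 'n" where
  "cond_exp_given M Y X =
     (THE m. continuous_on UNIV m \<and>
        (\<forall>i. AE \<omega> in M. m (X \<omega>) $ i =
               real_cond_exp M (vimage_algebra (space M) X borel) (\<lambda>\<omega>. Y \<omega> $ i) \<omega>))"

definition interpolant ::
    "(real \<Rightarrow> real) \<Rightarrow> (real \<Rightarrow> real) \<Rightarrow> ('w \<Rightarrow> real ^ 'n) \<Rightarrow> ('w \<Rightarrow> real ^ 'n) \<Rightarrow> real \<Rightarrow> 'w \<Rightarrow> real ^ 'n"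
  where "interpolant a b Z X1 t \<omega> = a t *\<^sub>R Z \<omega> + b t *\<^sub>R X1 \<omega>"

definition interior_velocity ::
    "'w measure \<Rightarrow> (real \<Rightarrow> real) \<Rightarrow> (real \<Rightarrow> real) \<Rightarrow> ('w \<Rightarrow> real ^ 'n) \<Rightarrow> ('w \<Rightarrow> real ^ 'n) \<Rightarrow>
     real \<Rightarrow> real ^ 'n \<Rightarrow> real ^ 'n" where
  "interior_velocity M a b Z X1 t =
     cond_exp_given M (\<lambda>\<omega>. time_deriv a t *\<^sub>R Z \<omega> + time_deriv b t *\<^sub>R X1 \<omega>)
       (interpolant a b Z X1 t)"

definition velocity ::
    "'w measure \<Rightarrow> (real \<Rightarrow> real) \<Rightarrow> (real \<Rightarrow> real) \<Rightarrow> ('w \<Rightarrow> real ^ 'n) \<Rightarrow> ('w \<Rightarrow> real ^ 'n) \<Rightarrow>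
     real \<Rightarrow> real ^ 'n \<Rightarrow> real ^ 'n" where
  "velocity M a b Z X1 t x =
     (if t = 0 then Lim (at_right 0) (\<lambda>s. interior_velocity M a b Z X1 s x)
      else if t = 1 then Lim (at_left 1) (\<lambda>s. interior_velocity M a b Z X1 s x)
      else interior_velocity M a b Z X1 t x)"

definition ivp_solution ::
    "(real \<Rightarrow> real ^ 'n \<Rightarrow> real ^ 'n) \<Rightarrow> real ^ 'n \<Rightarrow> (real \<Rightarrow> real ^ 'n) \<Rightarrow> bool" where
  "ivp_solution v x y \<longleftrightarrow>
     y 0 = x \<and> (\<forall>t\<in>{0..1}. (y has_vector_derivative v t (y t)) (at t within {0..1}))"

end

theory Submission
  imports Defs
begin

text \<open>For \<open>t < 1\<close> the velocity is \<open>v(t,x) = (a'/a) (x - b m(t,x)) + b' m(t,x)\<close>, where \<open>m(t,x)\<close> is the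
  mean of the law proportional to \<open>exp (- |x - b y|\<^sup>2 / (2 a\<^sup>2)) \<nu>(dy)\<close>. If \<open>v\<close> is Lipschitz in \<open>x\<close> uniformly
  in time and converges as \<open>t \<rightarrow> 1\<close>, Picard iteration gives a unique flow. The law of the interpolant is
  transported by it because both can be compared with the Euler scheme of a mollified field: replacing
  the random increment by its conditional mean costs only second order, since the test functions
  propagated backwards have Lipschitz gradients.

  Moving \<open>x\<close> tilts the conditional law exponentially, so Lipschitz bounds follow once that law, seen at
  scale \<open>a\<close> around a suitable centre, lies between two Gaussian-type envelopes. In case (i) the centre is the
  mode, in case (iv) the mean of its Gaussian factor. Near \<open>t = 1\<close> the singular
  factor \<open>a'/a\<close> is removed by Stein's identity \<open>x - b m = (a\<^sup>2 / b) E(\<nabla>U(X1) | X\<^sub>t = x)\<close>. In case (iii) the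
  Gaussian part of \<open>X1\<close> is integrated out first, which leaves a nondegenerate kernel.\<close>

section \<open>Flows of Lipschitz velocity fields\<close>

locale lipschitz_field =
  fixes v :: "real \<Rightarrow> real ^ 'n \<Rightarrow> real ^ 'n" and K :: real
  assumes K_pos: "K > 0"
    and v_lipschitz: "\<And>t x y. t \<in> {0..1} \<Longrightarrow> norm (v t x - v t y) \<le> K * norm (x - y)"
    and v_continuous: "\<And>x. continuous_on {0..1} (\<lambda>t. v t x)"
begin

lemma continuous_on_along:
  assumes y: "continuous_on {0..1} y"
  shows "continuous_on {0..1} (\<lambda>t. v t (y t))"
  unfolding continuous_on
proof
  fix t :: real assume t: "t \<in> {0..1}"
  let ?F = "at t within {0..1}"
  have 1: "((\<lambda>s. K * norm (y s - y t) + norm (v s (y t) - v t (y t))) \<longlongrightarrow> K * norm (y t - y t) + norm (v t (y t) - v t (y t))) ?F"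
    using y v_continuous[of "y t"] t unfolding continuous_on by (intro tendsto_intros) auto
  have 2: "\<forall>\<^sub>F s in ?F. norm (v s (y s) - v t (y t)) \<le> K * norm (y s - y t) + norm (v s (y t) - v t (y t))"
    unfolding eventually_at_filter
  proof (rule always_eventually, intro allI impI)
    fix s :: real assume "s \<in> {0..1}"
    then show "norm (v s (y s) - v t (y t)) \<le> K * norm (y s - y t) + norm (v s (y t) - v t (y t))"
      using v_lipschitz[of s "y s" "y t"] norm_triangle_ineq[of "v s (y s) - v s (y t)" "v s (y t) - v t (y t)"]
      by simp
  qed
  have "((\<lambda>s. v s (y s) - v t (y t)) \<longlongrightarrow> 0) ?F"
    by (rule Lim_null_comparison[OF 2]) (use 1 in simp)
  then show "((\<lambda>s. v s (y s)) \<longlongrightarrow> v t (y t)) ?F"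
    by (simp add: LIM_zero_iff)
qed

lemma ivp_solution_continuous: "ivp_solution v x y \<Longrightarrow> continuous_on {0..1} y"
  unfolding ivp_solution_def continuous_on_eq_continuous_within
  by (meson has_vector_derivative_continuous)

lemma ivp_solution_stability:
  assumes y: "ivp_solution v x y" and z: "ivp_solution v x' z" and t: "t \<in> {0..1}"
  shows "norm (y t - z t) \<le> exp K * norm (x - x')"
proof -
  define w where "w s = exp (- 2 * K * s) * ((y s - z s) \<bullet> (y s - z s))" for s
  define w' where "w' s = exp (- 2 * K * s) * (2 * ((y s - z s) \<bullet> (v s (y s) - v s (z s))))
       - 2 * K * exp (- 2 * K * s) * ((y s - z s) \<bullet> (y s - z s))" for s
  have der: "(w has_real_derivative w' s) (at s within {0..1})" if s: "s \<in> {0..1}" for s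
  proof -
    have d: "((\<lambda>s. y s - z s) has_derivative (\<lambda>h. h *\<^sub>R (v s (y s) - v s (z s)))) (at s within {0..1})"
      using y z s unfolding ivp_solution_def has_vector_derivative_def scaleR_diff_right
      by (intro has_derivative_diff) blast+
    have e: "((\<lambda>s. exp (- 2 * K * s)) has_derivative (\<lambda>h. h * (- 2 * K * exp (- 2 * K * s)))) (at s within {0..1})"
      by (auto intro!: derivative_eq_intros)
    have "(w has_derivative (\<lambda>h. h * w' s)) (at s within {0..1})"
      unfolding w_def[abs_def]
    proof (rule has_derivative_eq_rhs[OF has_derivative_mult[OF e has_derivative_inner[OF d d]]], rule ext)
      fix h
      have *: "E * (A \<bullet> h *\<^sub>R D + h *\<^sub>R D \<bullet> A) + h * (- 2 * K * E) * (A \<bullet> A) =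
          h * (E * (2 * (A \<bullet> D)) - 2 * K * E * (A \<bullet> A))" for E and A D :: "real ^ 'n"
        by (simp add: inner_commute[of D A] algebra_simps)
      show "exp (- 2 * K * s) * ((y s - z s) \<bullet> h *\<^sub>R (v s (y s) - v s (z s)) + h *\<^sub>R (v s (y s) - v s (z s)) \<bullet> (y s - z s)) +
          h * (- 2 * K * exp (- 2 * K * s)) * ((y s - z s) \<bullet> (y s - z s)) = h * w' s"
        unfolding w'_def by (rule *)
    qed
    then show ?thesis
      unfolding has_field_derivative_def by (rule has_derivative_eq_rhs) (simp add: fun_eq_iff)
  qed
  have nonpos: "w' s \<le> 0" if s: "s \<in> {0..1}" for s
  proof -
    have "(y s - z s) \<bullet> (v s (y s) - v s (z s)) \<le> norm (y s - z s) * norm (v s (y s) - v s (z s))"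
      by (rule norm_cauchy_schwarz)
    also have "\<dots> \<le> norm (y s - z s) * (K * norm (y s - z s))"
      by (intro mult_left_mono v_lipschitz s) auto
    finally have "(y s - z s) \<bullet> (v s (y s) - v s (z s)) \<le> K * ((y s - z s) \<bullet> (y s - z s))"
      by (simp add: power2_norm_eq_inner[symmetric] power2_eq_square algebra_simps)
    then have "exp (- 2 * K * s) * (2 * ((y s - z s) \<bullet> (v s (y s) - v s (z s)))) \<le> exp (- 2 * K * s) * (2 * (K * ((y s - z s) \<bullet> (y s - z s))))"
      by (intro mult_left_mono) auto
    then show ?thesis by (simp add: w'_def algebra_simps)
  qed
  have "w t \<le> w 0"
  proof -
    have "\<exists>s\<in>{0..t}. w t - w 0 = w' s * (t - 0)"
      using t by (intro mvt_very_simple)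
        (auto intro: DERIV_subset[OF der, unfolded has_field_derivative_def])
    then obtain s where s: "s \<in> {0..t}" "w t - w 0 = w' s * (t - 0)" by blast
    moreover have "w' s * (t - 0) \<le> 0"
      using s t by (intro mult_nonpos_nonneg nonpos) auto
    ultimately show ?thesis by simp
  qed
  then have "exp (- 2 * K * t) * (norm (y t - z t))\<^sup>2 \<le> (norm (x - x'))\<^sup>2"
    using y z by (simp add: w_def power2_norm_eq_inner ivp_solution_def)
  then have "exp (2 * K * t) * (exp (- 2 * K * t) * (norm (y t - z t))\<^sup>2) \<le> exp (2 * K * t) * (norm (x - x'))\<^sup>2"
    by (intro mult_left_mono) auto
  then have "(norm (y t - z t))\<^sup>2 \<le> exp (2 * K * t) * (norm (x - x'))\<^sup>2"
    by (simp add: mult.assoc[symmetric] exp_add[symmetric])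
  also have "\<dots> \<le> exp (2 * K) * (norm (x - x'))\<^sup>2"
    using t K_pos by (intro mult_right_mono) (auto simp: mult_left_le)
  also have "\<dots> = (exp K * norm (x - x'))\<^sup>2"
    by (simp add: power_mult_distrib exp_double)
  finally show ?thesis
    by (rule power2_le_imp_le) simp
qed

lemma ivp_solution_unique:
  assumes "ivp_solution v x y" "ivp_solution v x z" "t \<in> {0..1}"
  shows "y t = z t"
  using ivp_solution_stability[OF assms] by simp

text \<open>Picard iteration in the variable \<open>exp (- 2 K t) y t\<close>, which makes the integral operator
  a contraction on the whole time interval.\<close>

lemma ivp_solution_exists: "\<exists>y. ivp_solution v x y"
proof -
  define w where "w z s = v s (exp (2 * K * s) *\<^sub>R apply_bcontfun z s)" for z :: "real \<Rightarrow>\<^sub>C (real ^ 'n)" and s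
  define F where "F z t = exp (- 2 * K * t) *\<^sub>R (x + integral {0..t} (w z))" for z t
  have cw: "continuous_on {0..1} (w z)" for z
    unfolding w_def by (intro continuous_on_along continuous_intros continuous_on_apply_bcontfun)
  have dw: "((\<lambda>u. integral {0..u} (w z)) has_vector_derivative w z t) (at t within {0..1})" if "t \<in> {0..1}" for z t
    by (rule integral_has_vector_derivative[OF cw that])
  have cF: "continuous_on (cbox 0 1) (F z)" for z
    unfolding F_def
    by (intro continuous_intros) (simp add: continuous_on_eq_continuous_within, blast intro: has_vector_derivative_continuous dw)
  have "\<exists>G. \<forall>z. (\<forall>t\<in>cbox 0 1. apply_bcontfun (G z) t = F z t) \<and> (\<forall>t. apply_bcontfun (G z) t = F z (clamp 0 1 t))"
    by (rule choice) (metis continuous_on_cbox_bcontfunE[OF cF])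
  then obtain G where G: "\<And>z t. t \<in> cbox 0 1 \<Longrightarrow> apply_bcontfun (G z) t = F z t"
    "\<And>z t. apply_bcontfun (G z) t = F z (clamp 0 1 t)" by metis
  have lip: "norm (F z t - F z' t) \<le> 1/2 * dist z z'" if t: "t \<in> {0..1}" for z z' t
  proof -
    have i: "w z integrable_on {0..t}" for z
      using t by (intro integrable_continuous_real continuous_on_subset[OF cw]) auto
    have fi: "((\<lambda>s. K * exp (2 * K * s) * dist z z') has_integral (exp (2 * K * t) / 2 * dist z z' - exp (2 * K * 0) / 2 * dist z z')) {0..t}"
      using t by (intro fundamental_theorem_of_calculus)
        (auto intro!: derivative_eq_intros simp: has_real_derivative_iff_has_vector_derivative[symmetric])
    have "norm (integral {0..t} (w z) - integral {0..t} (w z')) = norm (integral {0..t} (\<lambda>s. w z s - w z' s))"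
      by (simp add: integral_diff i)
    also have "\<dots> \<le> integral {0..t} (\<lambda>s. K * exp (2 * K * s) * dist z z')"
    proof (rule integral_norm_bound_integral)
      show "(\<lambda>s. w z s - w z' s) integrable_on {0..t}" by (intro integrable_diff i)
      show "(\<lambda>s. K * exp (2 * K * s) * dist z z') integrable_on {0..t}" using fi by blast
      fix s assume s: "s \<in> {0..t}"
      have "norm (w z s - w z' s) \<le> K * norm (exp (2 * K * s) *\<^sub>R z s - exp (2 * K * s) *\<^sub>R z' s)"
        unfolding w_def using s t by (intro v_lipschitz) auto
      also have "\<dots> = K * exp (2 * K * s) * dist (z s) (z' s)"
        by (simp add: dist_norm scaleR_diff_right[symmetric])
      also have "\<dots> \<le> K * exp (2 * K * s) * dist z z'"
        using K_pos by (intro mult_left_mono dist_bounded) auto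
      finally show "norm (w z s - w z' s) \<le> K * exp (2 * K * s) * dist z z'" .
    qed
    also have "\<dots> \<le> exp (2 * K * t) / 2 * dist z z'"
      unfolding integral_unique[OF fi] by simp
    finally have *: "norm (integral {0..t} (w z) - integral {0..t} (w z')) \<le> exp (2 * K * t) / 2 * dist z z'" .
    have "norm (F z t - F z' t) = exp (- 2 * K * t) * norm (integral {0..t} (w z) - integral {0..t} (w z'))"
      by (simp add: F_def scaleR_diff_right[symmetric])
    also have "\<dots> \<le> exp (- 2 * K * t) * (exp (2 * K * t) / 2 * dist z z')"
      by (intro mult_left_mono *) auto
    also have "\<dots> = 1/2 * dist z z'" by (simp add: mult.assoc[symmetric] exp_add[symmetric])
    finally show ?thesis .
  qed
  have "\<exists>!z. G z = z"
  proof (rule banach_fix_type[of "1/2"])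
    show "\<forall>z z'. dist (G z) (G z') \<le> 1/2 * dist z z'"
    proof (intro allI dist_bound)
      fix z z' t
      have "clamp 0 1 t \<in> cbox 0 (1::real)" by (rule clamp_in_interval) auto
      then have "clamp 0 1 t \<in> {0..1::real}" by auto
      then show "dist (G z t) (G z' t) \<le> 1/2 * dist z z'"
        unfolding G(2)[of _ t] dist_norm[of "F z _"] by (rule lip)
    qed
  qed auto
  then obtain z where z: "G z = z" by blast
  define y where "y t = x + integral {0..t} (w z)" for t
  have zy: "exp (2 * K * t) *\<^sub>R apply_bcontfun z t = y t" if "t \<in> {0..1}" for t
    using G(1)[of t z] that by (simp add: z F_def y_def exp_add[symmetric])
  have "ivp_solution v x y"
    unfolding ivp_solution_def
  proof (intro conjI ballI)
    show "y 0 = x" by (simp add: y_def)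
    fix t :: real assume t: "t \<in> {0..1}"
    have "w z t = v t (y t)" using zy[OF t] by (simp add: w_def)
    moreover have "(y has_vector_derivative w z t) (at t within {0..1})"
      unfolding y_def[abs_def] using has_vector_derivative_add[OF has_vector_derivative_const dw[OF t], of x] by simp
    ultimately show "(y has_vector_derivative v t (y t)) (at t within {0..1})" by simp
  qed
  then show ?thesis by blast
qed

definition flow :: "real \<Rightarrow> real ^ 'n \<Rightarrow> real ^ 'n" where
  "flow t x = (SOME y. ivp_solution v x y) t"

lemma flow_solution: "ivp_solution v x (\<lambda>t. flow t x)"
  unfolding flow_def using someI_ex[OF ivp_solution_exists[of x]] by simp

lemma flow_lipschitz: "t \<in> {0..1} \<Longrightarrow> norm (flow t x - flow t y) \<le> exp K * norm (x - y)"
  by (rule ivp_solution_stability[OF flow_solution flow_solution])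

lemma flow_borel_measurable: "t \<in> {0..1} \<Longrightarrow> flow t \<in> borel_measurable borel"
proof (rule borel_measurable_continuous_onI)
  assume t: "t \<in> {0..1}"
  have "(exp K)-lipschitz_on UNIV (flow t)"
    by (rule lipschitz_onI) (use flow_lipschitz[OF t] in \<open>auto simp: dist_norm\<close>)
  then show "continuous_on UNIV (flow t)" by (rule lipschitz_on_continuous_on)
qed

end

section \<open>Mollification\<close>

definition C11 :: "real \<Rightarrow> real \<Rightarrow> ('a::euclidean_space \<Rightarrow> 'b::real_normed_vector) \<Rightarrow> bool" where
  "C11 L B f \<longleftrightarrow> (\<forall>x y. norm (f x - f y) \<le> L * norm (x - y)) \<and>
     (\<forall>x. \<exists>D. linear D \<and> (\<forall>h. norm (D h) \<le> L * norm h) \<and>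
        (\<forall>y. norm (f y - f x - D (y - x)) \<le> B * (norm (y - x))\<^sup>2))"

lemma C11_lipschitz: "C11 L B f \<Longrightarrow> norm (f x - f y) \<le> L * norm (x - y)"
  by (simp add: C11_def)

lemma C11_derivative:
  assumes "C11 L B f"
  obtains D where "linear D" "\<And>h. norm (D h) \<le> L * norm h"
    "\<And>y. norm (f y - f x - D (y - x)) \<le> B * (norm (y - x))\<^sup>2"
  using assms unfolding C11_def by metis

lemma C11_compose:
  fixes f :: "'a::euclidean_space \<Rightarrow> 'b::euclidean_space"
  assumes g: "C11 L B g" and f: "C11 L' B' f" and nn: "0 \<le> L" "0 \<le> L'" "0 \<le> B"
  shows "C11 (L * L') (B * L'\<^sup>2 + L * B') (\<lambda>x. g (f x))"
  unfolding C11_def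
proof (intro conjI allI)
  fix x y
  have "norm (g (f x) - g (f y)) \<le> L * norm (f x - f y)" by (rule C11_lipschitz[OF g])
  also have "\<dots> \<le> L * (L' * norm (x - y))" by (intro mult_left_mono C11_lipschitz[OF f] nn)
  finally show "norm (g (f x) - g (f y)) \<le> L * L' * norm (x - y)" by (simp add: mult.assoc)
next
  fix x
  obtain E where E: "linear E" "\<And>h. norm (E h) \<le> L * norm h"
    "\<And>y. norm (g y - g (f x) - E (y - f x)) \<le> B * (norm (y - f x))\<^sup>2"
    using C11_derivative[OF g] by blast
  obtain D where D: "linear D" "\<And>h. norm (D h) \<le> L' * norm h"
    "\<And>y. norm (f y - f x - D (y - x)) \<le> B' * (norm (y - x))\<^sup>2"
    using C11_derivative[OF f] by blast
  show "\<exists>D. linear D \<and> (\<forall>h. norm (D h) \<le> L * L' * norm h) \<and>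
     (\<forall>y. norm (g (f y) - g (f x) - D (y - x)) \<le> (B * L'\<^sup>2 + L * B') * (norm (y - x))\<^sup>2)"
  proof (intro exI[of _ "\<lambda>h. E (D h)"] conjI allI)
    show "linear (\<lambda>h. E (D h))" using linear_compose[OF D(1) E(1)] by (simp add: o_def)
    fix h
    have "norm (E (D h)) \<le> L * norm (D h)" by (rule E)
    also have "\<dots> \<le> L * (L' * norm h)" by (intro mult_left_mono D nn)
    finally show "norm (E (D h)) \<le> L * L' * norm h" by (simp add: mult.assoc)
  next
    fix y
    have "norm (g (f y) - g (f x) - E (D (y - x)))
        = norm ((g (f y) - g (f x) - E (f y - f x)) + E (f y - f x - D (y - x)))"
      by (simp add: linear_diff[OF E(1)])
    also have "\<dots> \<le> B * (norm (f y - f x))\<^sup>2 + L * norm (f y - f x - D (y - x))"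
      by (intro norm_triangle_mono E)
    also have "\<dots> \<le> B * (L' * norm (y - x))\<^sup>2 + L * (B' * (norm (y - x))\<^sup>2)"
      by (intro add_mono mult_left_mono power_mono C11_lipschitz[OF f] D nn) auto
    finally show "norm (g (f y) - g (f x) - E (D (y - x))) \<le> (B * L'\<^sup>2 + L * B') * (norm (y - x))\<^sup>2"
      by (simp add: power_mult_distrib algebra_simps)
  qed
qed

lemma integral_bounded_support:
  fixes h :: "'a::euclidean_space \<Rightarrow> 'b::euclidean_space"
  assumes [measurable]: "h \<in> borel_measurable lborel"
    and b: "\<And>z. norm (h z) \<le> c * indicator (cball 0 r) z"
  shows "integrable lborel h" "norm (\<integral>z. h z \<partial>lborel) \<le> c * measure lborel (cball 0 r :: 'a set)"
proof -
  have i: "integrable lborel (\<lambda>z::'a. c * indicator (cball 0 r) z)"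
    by (intro integrable_mult_right integrable_real_indicator) (auto simp: emeasure_lborel_cball_finite[unfolded infinity_ennreal_def])
  show "integrable lborel h"
    by (rule Bochner_Integration.integrable_bound[OF i]) (use b in \<open>auto intro: order_trans[OF _ abs_ge_self]\<close>)
  have "norm (\<integral>z. h z \<partial>lborel) \<le> (\<integral>z. c * indicator (cball 0 r) z \<partial>(lborel::'a measure))"
    by (rule Bochner_Integration.integral_norm_bound_integral[OF \<open>integrable lborel h\<close> i b])
  then show "norm (\<integral>z. h z \<partial>lborel) \<le> c * measure lborel (cball 0 r :: 'a set)" by simp
qed

definition bump :: "'a::euclidean_space \<Rightarrow> real" where
  "bump z = (max 0 (1 - (norm z)\<^sup>2))\<^sup>2"

definition bump_deriv :: "'a::euclidean_space \<Rightarrow> 'a \<Rightarrow> real" where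
  "bump_deriv z k = 4 * max 0 (1 - (norm z)\<^sup>2) * (z \<bullet> k)"

lemma bump_measurable [measurable]: "bump \<in> borel_measurable borel"
  unfolding bump_def[abs_def] by measurable

lemma bump_deriv_measurable [measurable]: "(\<lambda>z. bump_deriv z k) \<in> borel_measurable borel"
  unfolding bump_deriv_def[abs_def] by measurable

lemma bump_bounds: "0 \<le> bump z" "bump z \<le> indicator (cball 0 1) z"
proof -
  show "0 \<le> bump z" by (simp add: bump_def)
  show "bump z \<le> indicator (cball 0 1) z"
  proof (cases "norm z \<le> 1")
    case True
    then show ?thesis by (auto simp: bump_def power_le_one_iff intro!: power_le_one)
  next
    case False
    then have "1 < (norm z)\<^sup>2" by (simp add: one_less_power)
    then show ?thesis using False by (simp add: bump_def)
  qed
qed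

lemma bump_deriv_bound: "\<bar>bump_deriv z k\<bar> \<le> 4 * norm k * indicator (cball 0 1) z"
proof (cases "norm z \<le> 1")
  case True
  have "\<bar>bump_deriv z k\<bar> = 4 * (max 0 (1 - (norm z)\<^sup>2) * \<bar>z \<bullet> k\<bar>)" by (simp add: bump_deriv_def abs_mult)
  also have "\<dots> \<le> 4 * (1 * (norm z * norm k))"
    by (intro mult_left_mono mult_mono Cauchy_Schwarz_ineq2) auto
  also have "\<dots> \<le> 4 * (1 * (1 * norm k))"
    using True by (intro mult_left_mono mult_right_mono) auto
  finally show ?thesis using True by simp
next
  case False
  then have "1 < (norm z)\<^sup>2" by (simp add: one_less_power)
  then show ?thesis using False by (simp add: bump_deriv_def)
qed

lemma bump_taylor:
  fixes z k :: "'a::euclidean_space"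
  assumes k: "norm k \<le> 1"
  shows "\<bar>bump (z - k) - bump z - bump_deriv z k\<bar> \<le> 27 * (norm k)\<^sup>2 * indicator (cball 0 2) z"
proof (cases "norm z \<le> 2")
  case True
  define p where "p = 1 - (norm z)\<^sup>2"
  define q where "q = 1 - (norm (z - k))\<^sup>2"
  have qp: "q - p = 2 * (z \<bullet> k) - (norm k)\<^sup>2"
    by (simp add: p_def q_def power2_norm_eq_inner inner_diff inner_commute)
  have ab: "\<bar>z \<bullet> k\<bar> \<le> 2 * norm k"
    using Cauchy_Schwarz_ineq2[of z k] mult_right_mono[OF True, of "norm k"] by simp
  have "\<bar>q - p\<bar> \<le> 2 * \<bar>z \<bullet> k\<bar> + (norm k)\<^sup>2" unfolding qp using abs_triangle_ineq4[of "2 * (z \<bullet> k)" "(norm k)\<^sup>2"] by (simp add: abs_mult)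
  also have "\<dots> \<le> 5 * norm k"
    using ab k mult_right_mono[of "norm k" 1 "norm k"] by (simp add: power2_eq_square)
  finally have "(q - p)\<^sup>2 \<le> (5 * norm k)\<^sup>2" by (metis abs_ge_zero power2_abs power_mono)
  then have 1: "(q - p)\<^sup>2 \<le> 25 * (norm k)\<^sup>2" by (simp add: power_mult_distrib)
  have 2: "\<bar>(max 0 q)\<^sup>2 - (max 0 p)\<^sup>2 - 2 * max 0 p * (q - p)\<bar> \<le> (q - p)\<^sup>2"
  proof -
    consider "q \<ge> 0" "p \<ge> 0" | "q \<ge> 0" "p < 0" | "q < 0" "p \<ge> 0" | "q < 0" "p < 0" by linarith
    then show ?thesis
    proof cases
      case 1
      then have "(max 0 q)\<^sup>2 - (max 0 p)\<^sup>2 - 2 * max 0 p * (q - p) = (q - p)\<^sup>2"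
        by (simp add: power2_eq_square algebra_simps)
      then show ?thesis by simp
    next
      case 2
      then have "q\<^sup>2 \<le> (q - p)\<^sup>2" by (intro power_mono) auto
      with 2 show ?thesis by simp
    next
      case 3
      have "p\<^sup>2 - 2 * p * q \<le> (q - p)\<^sup>2" by (simp add: power2_eq_square algebra_simps)
      moreover have "p * q \<le> 0" using 3 by (simp add: mult_nonneg_nonpos)
      moreover have "\<bar>- (p\<^sup>2) - 2 * p * (q - p)\<bar> = p\<^sup>2 - 2 * p * q"
        using \<open>p * q \<le> 0\<close> by (subst abs_of_nonneg) (simp_all add: power2_eq_square algebra_simps order_trans[OF _ zero_le_square])
      ultimately show ?thesis using 3 by simp
    next
      case 4 then show ?thesis by simp
    qed
  qed
  have "0 \<le> max 0 p" "max 0 p \<le> 1" by (auto simp: p_def)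
  then have 3: "\<bar>2 * max 0 p * (norm k)\<^sup>2\<bar> \<le> 2 * (norm k)\<^sup>2"
    by (simp add: abs_mult mult_left_le_one_le)
  have "bump (z - k) - bump z - bump_deriv z k =
      ((max 0 q)\<^sup>2 - (max 0 p)\<^sup>2 - 2 * max 0 p * (q - p)) - 2 * max 0 p * (norm k)\<^sup>2"
    unfolding qp by (simp add: bump_def bump_deriv_def p_def q_def algebra_simps)
  then have "\<bar>bump (z - k) - bump z - bump_deriv z k\<bar>
      \<le> \<bar>(max 0 q)\<^sup>2 - (max 0 p)\<^sup>2 - 2 * max 0 p * (q - p)\<bar> + \<bar>2 * max 0 p * (norm k)\<^sup>2\<bar>"
    by (simp only: abs_triangle_ineq4)
  also have "\<dots> \<le> 27 * (norm k)\<^sup>2" using 1 2 3 by linarith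
  finally show ?thesis using True by simp
next
  case False
  then have "norm (z - k) > 1" using k norm_triangle_ineq2[of z k] by linarith
  then have "1 < (norm (z - k))\<^sup>2" "1 < (norm z)\<^sup>2"
    using False by (simp_all add: one_less_power)
  then show ?thesis using False by (simp add: bump_def bump_deriv_def)
qed

lemma integral_bump_pos: "0 < (\<integral>z. bump (z::'a::euclidean_space) \<partial>lborel)"
proof -
  have i: "integrable lborel (bump :: 'a \<Rightarrow> real)"
    by (rule integral_bounded_support(1)[where c=1 and r=1]) (auto simp: bump_bounds)
  have "9/16 * indicator (cball 0 (1/2)) z \<le> bump z" for z :: 'a
  proof (cases "norm z \<le> 1/2")
    case True
    then have "(norm z)\<^sup>2 \<le> (1/2)\<^sup>2" by (intro power_mono) auto
    then have "(norm z)\<^sup>2 \<le> 1/4" by (simp add: power2_eq_square)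
    then have "3/4 \<le> 1 - (norm z)\<^sup>2" by linarith
    then have "3/4 \<le> max 0 (1 - (norm z)\<^sup>2)" by (rule order_trans) simp
    then have "(3/4)\<^sup>2 \<le> bump z" unfolding bump_def by (rule power_mono) simp
    moreover have "(3/4)\<^sup>2 = (9/16::real)" by (simp add: power2_eq_square)
    ultimately show ?thesis using True by simp
  qed (simp add: bump_bounds)
  then have "(\<integral>z. 9/16 * indicator (cball 0 (1/2)) (z::'a) \<partial>lborel) \<le> (\<integral>z. bump (z::'a) \<partial>lborel)"
    by (intro integral_mono i integrable_mult_right integrable_real_indicator) (auto simp: emeasure_lborel_cball_finite[unfolded infinity_ennreal_def])
  moreover have "0 < measure lborel (cball 0 (1/2) :: 'a set)" by (intro content_cball_pos) auto
  moreover have "(\<integral>z. 9/16 * indicator (cball 0 (1/2)) (z::'a) \<partial>lborel) = 9/16 * measure lborel (cball 0 (1/2) :: 'a set)"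
    by simp
  ultimately show ?thesis by linarith
qed

lemma integral_translation:
  fixes f :: "'a::euclidean_space \<Rightarrow> 'b::euclidean_space"
  assumes [measurable]: "f \<in> borel_measurable borel"
  shows "(\<integral>z. f (c + z) \<partial>lborel) = (\<integral>z. f z \<partial>lborel)"
proof -
  have "(\<integral>z. f z \<partial>lborel) = (\<integral>z. f z \<partial>(distr lborel borel ((+) c)))"
    by (simp add: lborel_distr_plus)
  also have "\<dots> = (\<integral>z. f (c + z) \<partial>lborel)" by (subst integral_distr) auto
  finally show ?thesis by simp
qed

lemma mollification:
  obtains C where "C \<ge> 1"
    "\<And>(v :: 'a::euclidean_space \<Rightarrow> 'b::euclidean_space) K \<epsilon>. \<lbrakk>0 < \<epsilon>; 0 \<le> K; \<And>x y. norm (v x - v y) \<le> K * norm (x - y)\<rbrakk> \<Longrightarrow>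
      \<exists>w. (\<forall>x. norm (w x - v x) \<le> K * \<epsilon>) \<and> C11 (C * K) (C * K / \<epsilon>) w"
proof -
  define N where "N = (\<integral>z. bump (z::'a) \<partial>lborel)"
  define V where "V = measure lborel (cball 0 2 :: 'a set)"
  have N: "N > 0" unfolding N_def by (rule integral_bump_pos)
  have V: "V \<ge> 0" by (simp add: V_def)
  define C where "C = 1 + 54 * V / N"
  have C: "C \<ge> 1" using N V by (simp add: C_def)
  have C': "4 * V / N \<le> C" "54 * V / N \<le> C" "1 + 4 * V / N \<le> C"
    using N V by (simp_all add: C_def divide_simps)
  show thesis
  proof (rule that[OF C])
    fix v :: "'a \<Rightarrow> 'b" and K \<epsilon> :: real
    assume e: "0 < \<epsilon>" and K: "0 \<le> K" and lip: "\<And>x y. norm (v x - v y) \<le> K * norm (x - y)"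
    have "K-lipschitz_on UNIV v" by (rule lipschitz_onI) (use lip K in \<open>auto simp: dist_norm\<close>)
    then have [measurable]: "v \<in> borel_measurable borel"
      by (intro borel_measurable_continuous_onI lipschitz_on_continuous_on)
    define u where "u x z = v (x + \<epsilon> *\<^sub>R z) - v x" for x z
    have [measurable]: "u x \<in> borel_measurable borel" for x
      unfolding u_def[abs_def] by measurable
    have ub: "norm (u x z) \<le> K * \<epsilon> * norm z" for x z
      using lip[of "x + \<epsilon> *\<^sub>R z" x] e by (simp add: u_def mult.assoc)
    have prod_bound: "norm (p z *\<^sub>R u x z) \<le> (c * (K * \<epsilon> * r)) * indicator (cball 0 r) z"
      if "\<bar>p z\<bar> \<le> c * indicator (cball 0 r) z" for p :: "'a \<Rightarrow> real" and c r x z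
    proof (cases "z \<in> cball 0 r")
      case True
      then have "norm (u x z) \<le> K * \<epsilon> * r"
        using ub[of x z] mult_left_mono[of "norm z" r "K * \<epsilon>"] K e by (simp add: order_trans)
      then show ?thesis using that True by (auto intro!: mult_mono)
    next
      case False then show ?thesis using that by simp
    qed
    have supp: "integrable lborel (\<lambda>z. p z *\<^sub>R u x z)"
      "norm (\<integral>z. p z *\<^sub>R u x z \<partial>lborel) \<le> c * (K * \<epsilon> * r) * measure lborel (cball 0 r :: 'a set)"
      if m: "p \<in> borel_measurable borel" and b: "\<And>z. \<bar>p z\<bar> \<le> c * indicator (cball 0 r) z" for p :: "'a \<Rightarrow> real" and c r x
    proof -
      have "(\<lambda>z. p z *\<^sub>R u x z) \<in> borel_measurable lborel" using m by measurable
      moreover have "norm (p z *\<^sub>R u x z) \<le> (c * (K * \<epsilon> * r)) * indicator (cball 0 r) z" for z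
        by (rule prod_bound[OF b])
      ultimately have *: "integrable lborel (\<lambda>z. p z *\<^sub>R u x z) \<and>
          norm (\<integral>z. p z *\<^sub>R u x z \<partial>lborel) \<le> c * (K * \<epsilon> * r) * measure lborel (cball 0 r :: 'a set)"
        using integral_bounded_support[of "\<lambda>z. p z *\<^sub>R u x z"] by blast
      show "integrable lborel (\<lambda>z. p z *\<^sub>R u x z)"
        "norm (\<integral>z. p z *\<^sub>R u x z \<partial>lborel) \<le> c * (K * \<epsilon> * r) * measure lborel (cball 0 r :: 'a set)"
        using * by blast+
    qed
    define w where "w x = v x + (1 / N) *\<^sub>R (\<integral>z. bump z *\<^sub>R u x z \<partial>lborel)" for x
    define D where "D x k = (1 / (N * \<epsilon>)) *\<^sub>R (\<integral>z. bump_deriv z k *\<^sub>R u x z \<partial>lborel)" for x k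
    have bump_le: "\<bar>bump z\<bar> \<le> 1 * indicator (cball 0 1) z" for z :: 'a
      using bump_bounds[of z] by simp
    have ib: "integrable lborel (bump :: 'a \<Rightarrow> real)"
      by (rule integral_bounded_support(1)[where c=1 and r=1]) (auto simp: bump_bounds)
    have ibu: "integrable lborel (\<lambda>z. bump z *\<^sub>R u x z)" for x
      by (rule supp(1)[OF bump_measurable bump_le])
    have idu: "integrable lborel (\<lambda>z. bump_deriv z k *\<^sub>R u x z)" for x k
      by (rule supp(1)[OF bump_deriv_measurable bump_deriv_bound])
    have wv: "norm (w x - v x) \<le> K * \<epsilon>" for x
    proof -
      have "norm (\<integral>z. bump z *\<^sub>R u x z \<partial>lborel) \<le> (\<integral>z. K * \<epsilon> * bump z \<partial>(lborel::'a measure))"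
      proof (rule Bochner_Integration.integral_norm_bound_integral)
        show "integrable lborel (\<lambda>z. bump z *\<^sub>R u x z)" by (rule ibu)
        show "integrable lborel (\<lambda>z::'a. K * \<epsilon> * bump z)" using ib by simp
        fix z :: 'a
        show "norm (bump z *\<^sub>R u x z) \<le> K * \<epsilon> * bump z"
        proof (cases "norm z \<le> 1")
          case True
          have "bump z * norm (u x z) \<le> bump z * (K * \<epsilon> * 1)"
            using ub[of x z] mult_left_mono[OF True, of "K * \<epsilon>"] K e
            by (intro mult_left_mono bump_bounds) auto
          then show ?thesis by (simp add: bump_bounds mult.commute)
        next
          case False
          then have "bump z = 0" using bump_bounds[of z] by simp
          then show ?thesis by simp
        qed
      qed
      then have "norm (\<integral>z. bump z *\<^sub>R u x z \<partial>lborel) \<le> K * \<epsilon> * N" by (simp add: N_def)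
      then show ?thesis using N by (simp add: w_def divide_simps)
    qed
    have ivt: "integrable lborel (\<lambda>z. bump z *\<^sub>R (v (y + \<epsilon> *\<^sub>R z) - c))" for y c
    proof -
      have "(\<lambda>z. bump z *\<^sub>R (v (y + \<epsilon> *\<^sub>R z) - c)) = (\<lambda>z. bump z *\<^sub>R u y z + bump z *\<^sub>R (v y - c))"
        by (simp add: u_def scaleR_add_right[symmetric])
      then show ?thesis using ibu ib by simp
    qed
    have w_eq: "w y = c + (1 / N) *\<^sub>R (\<integral>z. bump z *\<^sub>R (v (y + \<epsilon> *\<^sub>R z) - c) \<partial>lborel)" for y c
    proof -
      have "(\<integral>z. bump z *\<^sub>R (v (y + \<epsilon> *\<^sub>R z) - c) \<partial>lborel)
         = (\<integral>z. bump z *\<^sub>R u y z + bump z *\<^sub>R (v y - c) \<partial>lborel)"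
        by (simp add: u_def scaleR_add_right[symmetric])
      also have "\<dots> = (\<integral>z. bump z *\<^sub>R u y z \<partial>lborel) + N *\<^sub>R (v y - c)"
        using ibu ib by (simp add: N_def)
      finally have e: "(\<integral>z. bump z *\<^sub>R (v (y + \<epsilon> *\<^sub>R z) - c) \<partial>lborel) = (\<integral>z. bump z *\<^sub>R u y z \<partial>lborel) + N *\<^sub>R (v y - c)" .
      show ?thesis unfolding e w_def using N by (simp add: scaleR_add_right)
    qed
    have w_lip: "norm (w x - w y) \<le> K * norm (x - y)" for x y
    proof -
      have "w x - w y = (1 / N) *\<^sub>R ((\<integral>z. bump z *\<^sub>R (v (x + \<epsilon> *\<^sub>R z) - 0) \<partial>lborel) - (\<integral>z. bump z *\<^sub>R (v (y + \<epsilon> *\<^sub>R z) - 0) \<partial>lborel))"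
        by (simp only: w_eq[of x 0] w_eq[of y 0] scaleR_diff_right add_0)
      also have "\<dots> = (1 / N) *\<^sub>R (\<integral>z. bump z *\<^sub>R (v (x + \<epsilon> *\<^sub>R z) - v (y + \<epsilon> *\<^sub>R z)) \<partial>lborel)"
        by (subst Bochner_Integration.integral_diff[symmetric, OF ivt ivt]) (simp add: scaleR_diff_right)
      finally have *: "w x - w y = (1 / N) *\<^sub>R (\<integral>z. bump z *\<^sub>R (v (x + \<epsilon> *\<^sub>R z) - v (y + \<epsilon> *\<^sub>R z)) \<partial>lborel)" .
      have "norm (\<integral>z. bump z *\<^sub>R (v (x + \<epsilon> *\<^sub>R z) - v (y + \<epsilon> *\<^sub>R z)) \<partial>lborel) \<le> (\<integral>z. (K * norm (x - y)) * bump z \<partial>(lborel::'a measure))"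
      proof (rule Bochner_Integration.integral_norm_bound_integral)
        have "integrable lborel (\<lambda>z. bump z *\<^sub>R (v (x + \<epsilon> *\<^sub>R z) - 0) - bump z *\<^sub>R (v (y + \<epsilon> *\<^sub>R z) - 0))"
          by (intro Bochner_Integration.integrable_diff ivt)
        then show "integrable lborel (\<lambda>z. bump z *\<^sub>R (v (x + \<epsilon> *\<^sub>R z) - v (y + \<epsilon> *\<^sub>R z)))"
          by (simp add: scaleR_diff_right)
        show "integrable lborel (\<lambda>z::'a. (K * norm (x - y)) * bump z)" using ib by simp
        fix z :: 'a
        show "norm (bump z *\<^sub>R (v (x + \<epsilon> *\<^sub>R z) - v (y + \<epsilon> *\<^sub>R z))) \<le> (K * norm (x - y)) * bump z"
          using mult_left_mono[OF lip[of "x + \<epsilon> *\<^sub>R z" "y + \<epsilon> *\<^sub>R z"] bump_bounds(1)[of z]]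
          by (simp add: bump_bounds mult.commute)
      qed
      also have "\<dots> = K * norm (x - y) * N" by (simp add: N_def)
      finally show ?thesis unfolding * using N by (simp add: divide_simps)
    qed
    have D_bound: "norm (D x k) \<le> (4 * V / N) * K * norm k" for x k
    proof -
      have "norm (\<integral>z. bump_deriv z k *\<^sub>R u x z \<partial>lborel) \<le> (4 * norm k * (K * \<epsilon> * 1)) * measure lborel (cball 0 1 :: 'a set)"
        by (rule supp(2)[OF bump_deriv_measurable bump_deriv_bound])
      also have "\<dots> \<le> (4 * norm k * (K * \<epsilon> * 1)) * V"
        unfolding V_def using K e
        by (intro mult_left_mono measure_mono_fmeasurable) (auto simp: fmeasurable_def emeasure_lborel_cball_finite[unfolded infinity_ennreal_def])
      finally show ?thesis using N e by (simp add: D_def divide_simps algebra_simps)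
    qed
    have D_lin: "linear (D x)" for x
    proof (rule linearI)
      fix k k' :: 'a and c :: real
      have "(\<integral>z. bump_deriv z (k + k') *\<^sub>R u x z \<partial>lborel) = (\<integral>z. bump_deriv z k *\<^sub>R u x z + bump_deriv z k' *\<^sub>R u x z \<partial>lborel)"
        by (intro Bochner_Integration.integral_cong) (auto simp: bump_deriv_def inner_add_right algebra_simps)
      then show "D x (k + k') = D x k + D x k'"
        using idu[of k x] idu[of k' x] by (simp add: D_def scaleR_add_right)
      have "(\<integral>z. bump_deriv z (c *\<^sub>R k) *\<^sub>R u x z \<partial>lborel) = (\<integral>z. c *\<^sub>R (bump_deriv z k *\<^sub>R u x z) \<partial>lborel)"
        by (intro Bochner_Integration.integral_cong) (auto simp: bump_deriv_def)
      then have "(\<integral>z. bump_deriv z (c *\<^sub>R k) *\<^sub>R u x z \<partial>lborel) = c *\<^sub>R (\<integral>z. bump_deriv z k *\<^sub>R u x z \<partial>lborel)"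
        by (simp only: integral_scaleR_right)
      then show "D x (c *\<^sub>R k) = c *\<^sub>R D x k" by (simp add: D_def)
    qed
    have taylor: "norm (w y - w x - D x (y - x)) \<le> C * K / \<epsilon> * (norm (y - x))\<^sup>2" for x y
    proof -
      define k where "k = y - x"
      define \<kappa> where "\<kappa> = k /\<^sub>R \<epsilon>"
      have nk: "norm \<kappa> = norm k / \<epsilon>" using e by (simp add: \<kappa>_def divide_inverse mult.commute)
      show ?thesis
      proof (cases "norm \<kappa> \<le> 1")
        case True
        have tr: "(\<integral>z. bump z *\<^sub>R (v (y + \<epsilon> *\<^sub>R z) - v x) \<partial>lborel) = (\<integral>z. bump (z - \<kappa>) *\<^sub>R u x z \<partial>lborel)"
        proof -
          have *: "(\<lambda>z. bump (z - \<kappa>) *\<^sub>R u x z) \<in> borel_measurable borel" by measurable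
          have "y + \<epsilon> *\<^sub>R z = x + \<epsilon> *\<^sub>R (\<kappa> + z)" for z
            using e by (simp add: \<kappa>_def k_def algebra_simps)
          then show ?thesis
            by (subst integral_translation[OF *, of \<kappa>, symmetric]) (simp add: u_def)
        qed
        have it: "integrable lborel (\<lambda>z. bump (z - \<kappa>) *\<^sub>R u x z)"
        proof (rule supp(1)[where c=1 and r=2])
          fix z :: 'a
          have "norm z \<le> 2" if "norm (z - \<kappa>) \<le> 1" using that True norm_triangle_sub[of z \<kappa>] by linarith
          then show "\<bar>bump (z - \<kappa>)\<bar> \<le> 1 * indicator (cball 0 2) z"
            using bump_bounds[of "z - \<kappa>"] by (cases "norm (z - \<kappa>) \<le> 1") auto
        qed measurable
        have bk: "bump_deriv z \<kappa> = bump_deriv z k / \<epsilon>" for z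
          by (simp add: bump_deriv_def \<kappa>_def divide_inverse mult.commute)
        have "w y - w x - D x k = (1 / N) *\<^sub>R ((\<integral>z. bump (z - \<kappa>) *\<^sub>R u x z \<partial>lborel) - (\<integral>z. bump z *\<^sub>R u x z \<partial>lborel)
            - (\<integral>z. bump_deriv z \<kappa> *\<^sub>R u x z \<partial>lborel))"
        proof -
          have "(\<integral>z. bump_deriv z \<kappa> *\<^sub>R u x z \<partial>lborel) = (\<integral>z. (1/\<epsilon>) *\<^sub>R (bump_deriv z k *\<^sub>R u x z) \<partial>lborel)"
            by (simp add: bk)
          then have "(\<integral>z. bump_deriv z \<kappa> *\<^sub>R u x z \<partial>lborel) = (1/\<epsilon>) *\<^sub>R (\<integral>z. bump_deriv z k *\<^sub>R u x z \<partial>lborel)"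
            by (simp only: integral_scaleR_right)
          note e = this
          show ?thesis
            unfolding w_eq[of y "v x"] tr w_def[of x] D_def e by (simp add: scaleR_diff_right)
        qed
        also have "\<dots> = (1 / N) *\<^sub>R (\<integral>z. (bump (z - \<kappa>) - bump z - bump_deriv z \<kappa>) *\<^sub>R u x z \<partial>lborel)"
          using it ibu[of x] idu[of \<kappa> x] by (simp add: scaleR_diff_left)
        finally have *: "w y - w x - D x k = (1 / N) *\<^sub>R (\<integral>z. (bump (z - \<kappa>) - bump z - bump_deriv z \<kappa>) *\<^sub>R u x z \<partial>lborel)" .
        have "norm (\<integral>z. (bump (z - \<kappa>) - bump z - bump_deriv z \<kappa>) *\<^sub>R u x z \<partial>lborel) \<le> (27 * (norm \<kappa>)\<^sup>2 * (K * \<epsilon> * 2)) * V"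
          unfolding V_def by (rule supp(2)[OF _ bump_taylor[OF True]]) measurable
        then have "norm (w y - w x - D x k) \<le> (1 / N) * ((27 * (norm \<kappa>)\<^sup>2 * (K * \<epsilon> * 2)) * V)"
          unfolding * using N by (simp add: divide_simps)
        also have "\<dots> = (54 * V / N) * (K / \<epsilon> * (norm k)\<^sup>2)"
          using e by (simp add: nk power2_eq_square divide_simps)
        also have "\<dots> \<le> C * (K / \<epsilon> * (norm k)\<^sup>2)"
          using K e by (intro mult_right_mono C') auto
        finally show ?thesis by (simp add: k_def)
      next
        case False
        then have ge: "\<epsilon> \<le> norm k" using e by (simp add: nk)
        have "norm (w y - w x - D x k) \<le> norm (w y - w x) + norm (D x k)" by (rule norm_triangle_ineq4)
        also have "\<dots> \<le> K * norm k + (4 * V / N) * K * norm k"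
          by (intro add_mono D_bound) (use w_lip[of y x] in \<open>simp add: k_def\<close>)
        also have "\<dots> = (1 + 4 * V / N) * (K * norm k)" by (simp add: algebra_simps)
        also have "\<dots> \<le> C * (K * norm k)" using K by (intro mult_right_mono C') auto
        also have "\<dots> \<le> C * (K / \<epsilon> * (norm k)\<^sup>2)"
        proof (intro mult_left_mono)
          have "K * norm k * 1 \<le> K * norm k * (norm k / \<epsilon>)"
            using ge e K by (intro mult_left_mono) auto
          then show "K * norm k \<le> K / \<epsilon> * (norm k)\<^sup>2" by (simp add: power2_eq_square)
        qed (use C in auto)
        finally show ?thesis by (simp add: k_def)
      qed
    qed
    have CK: "K * norm h \<le> C * K * norm h" for h :: 'a
      using C K mult_right_mono[of 1 C "K * norm h"] by (simp add: mult.assoc)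
    have "C11 (C * K) (C * K / \<epsilon>) w"
      unfolding C11_def
    proof (intro conjI allI)
      show "norm (w x - w y) \<le> C * K * norm (x - y)" for x y
        using w_lip CK by (rule order_trans)
      fix x
      have "norm (D x h) \<le> C * K * norm h" for h
        using D_bound[of x h] mult_right_mono[OF C'(1), of "K * norm h"] K by (simp add: mult.assoc)
      then show "\<exists>D. linear D \<and> (\<forall>h. norm (D h) \<le> C * K * norm h) \<and> (\<forall>y. norm (w y - w x - D (y - x)) \<le> C * K / \<epsilon> * (norm (y - x))\<^sup>2)"
        using D_lin taylor by blast
    qed
    then show "\<exists>w. (\<forall>x. norm (w x - v x) \<le> K * \<epsilon>) \<and> C11 (C * K) (C * K / \<epsilon>) w"
      using wv by blast
  qed
qed

lemma C11_borel_measurable: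
  fixes f :: "'a::euclidean_space \<Rightarrow> 'b::euclidean_space"
  assumes "C11 L B f"
  shows "f \<in> borel_measurable borel"
proof -
  have "\<bar>L\<bar>-lipschitz_on UNIV f"
    by (rule lipschitz_onI)
      (auto simp: dist_norm intro!: order_trans[OF C11_lipschitz[OF assms]] mult_right_mono)
  then show ?thesis by (intro borel_measurable_continuous_onI lipschitz_on_continuous_on)
qed

lemma C11_gradient:
  fixes g :: "'a::euclidean_space \<Rightarrow> real"
  assumes g: "C11 L B g" and L: "0 \<le> L"
  obtains p where "p \<in> borel_measurable borel" "\<And>x. norm (p x) \<le> L"
    "\<And>x y. \<bar>g y - g x - p x \<bullet> (y - x)\<bar> \<le> B * (norm (y - x))\<^sup>2"
proof -
  have "\<exists>p. norm p \<le> L \<and> (\<forall>y. \<bar>g y - g x - p \<bullet> (y - x)\<bar> \<le> B * (norm (y - x))\<^sup>2)" for x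
  proof -
    obtain D where D: "linear D" "\<And>h. norm (D h) \<le> L * norm h"
      "\<And>y. norm (g y - g x - D (y - x)) \<le> B * (norm (y - x))\<^sup>2"
      using C11_derivative[OF g] by blast
    define p where "p = (\<Sum>b\<in>Basis. D b *\<^sub>R b)"
    have Dp: "D h = p \<bullet> h" for h
    proof -
      have "D h = D (\<Sum>b\<in>Basis. (h \<bullet> b) *\<^sub>R b)" by (simp add: euclidean_representation)
      also have "\<dots> = (\<Sum>b\<in>Basis. (h \<bullet> b) * D b)"
        by (simp add: linear_sum[OF D(1)] linear_cmul[OF D(1)])
      also have "\<dots> = p \<bullet> h"
        unfolding p_def inner_sum_left by (intro sum.cong) (simp_all add: inner_commute[of h])
      finally show ?thesis .
    qed
    have "norm p * norm p \<le> L * norm p"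
      using D(2)[of p] by (simp add: Dp power2_norm_eq_inner[symmetric] power2_eq_square)
    then have "norm p \<le> L" using L by (cases "norm p = 0") (auto simp: mult_le_cancel_right)
    then show ?thesis using D(3) by (auto simp: Dp)
  qed
  then obtain p where p: "\<And>x. norm (p x) \<le> L"
    "\<And>x y. \<bar>g y - g x - p x \<bullet> (y - x)\<bar> \<le> B * (norm (y - x))\<^sup>2" by metis
  have [measurable]: "g \<in> borel_measurable borel" by (rule C11_borel_measurable[OF g])
  have "(\<lambda>x. p x \<bullet> b) \<in> borel_measurable borel" if b: "b \<in> Basis" for b
  proof (rule borel_measurable_LIMSEQ_real)
    fix x
    have bound: "\<bar>(g (x + (1 / Suc n) *\<^sub>R b) - g x) * Suc n - p x \<bullet> b\<bar> \<le> B * (1 / Suc n)" for n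
    proof -
      have "\<bar>g (x + (1 / Suc n) *\<^sub>R b) - g x - p x \<bullet> ((1 / Suc n) *\<^sub>R b)\<bar> \<le> B * (1 / Suc n)\<^sup>2"
        using p(2)[of "x + (1 / Suc n) *\<^sub>R b" x] b by simp
      then have "\<bar>g (x + (1 / Suc n) *\<^sub>R b) - g x - p x \<bullet> ((1 / Suc n) *\<^sub>R b)\<bar> * Suc n \<le> B * (1 / Suc n)\<^sup>2 * Suc n"
        by (rule mult_right_mono) simp
      also have "B * (1 / Suc n)\<^sup>2 * Suc n = B * (1 / Suc n)" by (simp add: power2_eq_square)
      finally have le: "\<bar>g (x + (1 / Suc n) *\<^sub>R b) - g x - p x \<bullet> ((1 / Suc n) *\<^sub>R b)\<bar> * Suc n \<le> B * (1 / Suc n)" .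
      have "(g (x + (1 / Suc n) *\<^sub>R b) - g x) * Suc n - p x \<bullet> b
          = (g (x + (1 / Suc n) *\<^sub>R b) - g x - p x \<bullet> ((1 / Suc n) *\<^sub>R b)) * Suc n"
        by (simp add: left_diff_distrib)
      then show ?thesis using le by (simp only: abs_mult abs_of_nat)
    qed
    have "(\<lambda>n. (g (x + (1 / Suc n) *\<^sub>R b) - g x) * Suc n - p x \<bullet> b) \<longlonglongrightarrow> 0"
    proof (rule Lim_null_comparison)
      show "\<forall>\<^sub>F n in sequentially. norm ((g (x + (1 / Suc n) *\<^sub>R b) - g x) * Suc n - p x \<bullet> b) \<le> B * (1 / Suc n)"
        using bound by simp
      show "(\<lambda>n. B * (1 / Suc n)) \<longlonglongrightarrow> 0"
        using tendsto_mult_right[OF LIMSEQ_inverse_real_of_nat, of B] by (simp add: inverse_eq_divide)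
    qed
    then show "(\<lambda>n. (g (x + (1 / Suc n) *\<^sub>R b) - g x) * Suc n) \<longlonglongrightarrow> p x \<bullet> b"
      by (simp add: LIM_zero_iff)
  qed measurable
  then have "p \<in> borel_measurable borel" by (subst borel_measurable_euclidean_space) blast
  then show thesis using p by (rule that)
qed

lemma C1_uniform_taylor:
  fixes y y' :: "real \<Rightarrow> 'a::real_normed_vector"
  assumes der: "\<And>t. t \<in> {0..T} \<Longrightarrow> (y has_vector_derivative y' t) (at t within {0..T})"
    and cont: "continuous_on {0..T} y'" and e: "0 < e"
  obtains d where "0 < d"
    "\<And>s t. \<lbrakk>s \<in> {0..T}; t \<in> {0..T}; \<bar>s - t\<bar> < d\<rbrakk> \<Longrightarrow> norm (y s - y t - (s - t) *\<^sub>R y' t) \<le> e * \<bar>s - t\<bar>"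
proof -
  have "uniformly_continuous_on {0..T} y'"
    by (intro compact_uniformly_continuous cont) simp
  then obtain d where d: "0 < d" "\<And>s t. s \<in> {0..T} \<Longrightarrow> t \<in> {0..T} \<Longrightarrow> dist s t < d \<Longrightarrow> dist (y' s) (y' t) < e"
    using e unfolding uniformly_continuous_on_def by metis
  show thesis
  proof (rule that[OF d(1)])
    fix s t assume st: "s \<in> {0..T}" "t \<in> {0..T}" "\<bar>s - t\<bar> < d"
    have seg: "closed_segment t s \<subseteq> {0..T}" using st by (auto simp: closed_segment_eq_real_ivl split: if_splits)
    have "norm (y s - y t - (s - t) *\<^sub>R y' t) \<le> norm (s - t) * e"
    proof (rule vector_differentiable_bound_linearization[where S="closed_segment t s" and f'=y'])
      show "(y has_vector_derivative y' u) (at u within closed_segment t s)" if "u \<in> closed_segment t s" for u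
        using that seg by (intro has_vector_derivative_within_subset[OF der]) auto
      show "norm (y' u - y' t) \<le> e" if "u \<in> closed_segment t s" for u
      proof -
        have "dist u t < d"
          using that st(3) by (auto simp: closed_segment_eq_real_ivl dist_real_def split: if_splits)
        then have "dist (y' u) (y' t) < e" using that seg st(2) by (intro d(2)) auto
        then show ?thesis by (simp add: dist_norm)
      qed
    qed auto
    then show "norm (y s - y t - (s - t) *\<^sub>R y' t) \<le> e * \<bar>s - t\<bar>" by (simp add: mult.commute)
  qed
qed

lemma measure_eqI_bounded_lipschitz:
  fixes P Q :: "'a::metric_space measure"
  assumes "prob_space P" "prob_space Q" and sets: "sets P = sets borel" "sets Q = sets borel"
    and eq: "\<And>f L. \<lbrakk>\<And>x. \<bar>f x\<bar> \<le> 1; \<And>x y. \<bar>f x - f y\<bar> \<le> L * dist x y; 0 \<le> L; f \<in> borel_measurable borel\<rbrakk>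
       \<Longrightarrow> (\<integral>x. f x \<partial>P) = (\<integral>x. f x \<partial>Q)"
  shows "P = Q"
proof -
  interpret P: prob_space P by fact
  interpret Q: prob_space Q by fact
  have spaces: "space P = UNIV" "space Q = UNIV" using sets by (metis sets_eq_imp_space_eq space_borel)+
  show ?thesis
  proof (rule measure_eqI_generator_eq[where E="{U. open U}" and \<Omega>=UNIV and A="\<lambda>_. UNIV"])
    show "Int_stable {U :: 'a set. open U}" by (auto simp: Int_stable_def)
    show "sets P = sigma_sets UNIV {U. open U}" "sets Q = sigma_sets UNIV {U. open U}"
      using sets by (simp_all add: sets_borel)
    fix U :: "'a set" assume "U \<in> {U. open U}"
    then have U: "open U" by simp
    have [measurable]: "U \<in> sets P" "U \<in> sets Q" using U sets by auto
    show "emeasure P U = emeasure Q U"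
    proof (cases "U = UNIV")
      case True
      then show ?thesis using P.emeasure_space_1 Q.emeasure_space_1 spaces by simp
    next
      case False
      then have ne: "- U \<noteq> {}" by auto
      have cl: "closed (- U)" using U by auto
      define f where "f n x = min 1 (real n * infdist x (- U))" for n x
      have f01: "0 \<le> f n x" "f n x \<le> 1" for n x by (auto simp: f_def infdist_nonneg)
      have fl: "\<bar>f n x - f n y\<bar> \<le> real n * dist x y" for n x y
      proof -
        have "\<bar>f n x - f n y\<bar> \<le> \<bar>real n * infdist x (- U) - real n * infdist y (- U)\<bar>"
          unfolding f_def by linarith
        also have "\<dots> = real n * \<bar>infdist x (- U) - infdist y (- U)\<bar>"
          by (simp add: right_diff_distrib[symmetric] abs_mult)
        also have "\<dots> \<le> real n * dist x y"
          by (intro mult_left_mono infdist_triangle_abs) auto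
        finally show ?thesis .
      qed
      have fm: "f n \<in> borel_measurable borel" for n
        unfolding f_def[abs_def] by (intro borel_measurable_continuous_onI continuous_intros)
      have fmP: "f n \<in> borel_measurable P" for n by (subst measurable_cong_sets[OF sets(1) refl]) (rule fm)
      have fmQ: "f n \<in> borel_measurable Q" for n by (subst measurable_cong_sets[OF sets(2) refl]) (rule fm)
      have lim: "(\<lambda>n. f n x) \<longlonglongrightarrow> indicator U x" for x
      proof (cases "x \<in> U")
        case True
        then have "0 < infdist x (- U)"
          using infdist_nonneg[of x "- U"] in_closed_iff_infdist_zero[OF cl ne, of x] by (auto simp: order_less_le)
        then obtain m :: nat where m: "1 < real m * infdist x (- U)" using reals_Archimedean3 by blast
        have "f n x = indicator U x" if "n \<ge> m" for n
        proof -
          have "real m * infdist x (- U) \<le> real n * infdist x (- U)"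
            using that by (intro mult_right_mono infdist_nonneg) auto
          then show ?thesis using m True by (simp add: f_def)
        qed
        then have "\<forall>\<^sub>F n in sequentially. f n x = indicator U x" using eventually_sequentially by blast
        then show ?thesis by (rule tendsto_eventually)
      next
        case False
        then have "f n x = 0" for n by (simp add: f_def)
        then show ?thesis using False by simp
      qed
      have limP: "(\<lambda>n. \<integral>x. f n x \<partial>P) \<longlonglongrightarrow> (\<integral>x. indicator U x \<partial>P)"
        using fmP lim f01
        by (intro integral_dominated_convergence[where w="\<lambda>_. 1"]) auto
      have limQ: "(\<lambda>n. \<integral>x. f n x \<partial>Q) \<longlonglongrightarrow> (\<integral>x. indicator U x \<partial>Q)"
        using fmQ lim f01
        by (intro integral_dominated_convergence[where w="\<lambda>_. 1"]) auto
      have "(\<integral>x. f n x \<partial>P) = (\<integral>x. f n x \<partial>Q)" for n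
        by (rule eq[of _ "real n"]) (simp_all add: f01 fl fm)
      then have "(\<lambda>n. \<integral>x. f n x \<partial>P) = (\<lambda>n. \<integral>x. f n x \<partial>Q)" by blast
      then have "(\<integral>x. indicator U x \<partial>P) = (\<integral>x. indicator U x \<partial>Q :: real)"
        using LIMSEQ_unique[OF limP] limQ by metis
      then show ?thesis by (simp add: P.emeasure_eq_measure Q.emeasure_eq_measure)
    qed
  qed (auto simp: P.emeasure_eq_measure)
qed

section \<open>Transport of laws by the flow\<close>

lemma (in prob_space) euler_weak_step:
  fixes X0 X1 V :: "'a \<Rightarrow> 'b::euclidean_space" and \<Xi> :: "'a \<Rightarrow> real" and u w :: "'b \<Rightarrow> 'b" and G :: "'b \<Rightarrow> real"
  assumes G: "C11 L B G" and L: "0 \<le> L" and B: "0 \<le> B"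
    and [measurable]: "X0 \<in> borel_measurable M" "X1 \<in> borel_measurable M" "V \<in> borel_measurable M"
      "u \<in> borel_measurable borel" "w \<in> borel_measurable borel" "\<Xi> \<in> borel_measurable M"
    and Xi1: "\<And>\<omega>. 1 \<le> \<Xi> \<omega>" and Xi2: "integrable M (\<lambda>\<omega>. (\<Xi> \<omega>)\<^sup>2)"
    and h: "0 \<le> h" and A: "0 \<le> A"
    and X0: "\<And>\<omega>. norm (X0 \<omega>) \<le> A * \<Xi> \<omega>" and V: "\<And>\<omega>. norm (V \<omega>) \<le> A * \<Xi> \<omega>"
    and u: "\<And>\<omega>. norm (u (X0 \<omega>)) \<le> A * \<Xi> \<omega>"
    and w: "\<And>x. norm (w x - u x) \<le> e" and e: "0 \<le> e" "e \<le> 1" and \<eta>: "0 \<le> \<eta>" "\<eta> \<le> 1"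
    and X1: "\<And>\<omega>. norm (X1 \<omega> - X0 \<omega> - h *\<^sub>R V \<omega>) \<le> \<eta> * h * \<Xi> \<omega>"
    and cond: "\<And>p C. \<lbrakk>p \<in> borel_measurable borel; \<And>x. norm (p x) \<le> C\<rbrakk> \<Longrightarrow>
       expectation (\<lambda>\<omega>. p (X0 \<omega>) \<bullet> V \<omega>) = expectation (\<lambda>\<omega>. p (X0 \<omega>) \<bullet> u (X0 \<omega>))"
  shows "\<bar>expectation (\<lambda>\<omega>. G (X1 \<omega>)) - expectation (\<lambda>\<omega>. G (X0 \<omega> + h *\<^sub>R w (X0 \<omega>)))\<bar>
     \<le> h * expectation (\<lambda>\<omega>. (\<Xi> \<omega>)\<^sup>2) * (L * (\<eta> + e) + 2 * (A + 1)\<^sup>2 * h * B)"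
proof -
  obtain p where p[measurable]: "p \<in> borel_measurable borel" and pL: "\<And>x. norm (p x) \<le> L"
    and pT: "\<And>x y. \<bar>G y - G x - p x \<bullet> (y - x)\<bar> \<le> B * (norm (y - x))\<^sup>2"
    using C11_gradient[OF G L] by blast
  have [measurable]: "G \<in> borel_measurable borel" by (rule C11_borel_measurable[OF G])
  have Xi_le: "\<Xi> \<omega> \<le> (\<Xi> \<omega>)\<^sup>2" for \<omega>
    using Xi1[of \<omega>] mult_left_mono[of 1 "\<Xi> \<omega>" "\<Xi> \<omega>"] by (simp add: power2_eq_square)
  have Xi_int: "integrable M \<Xi>"
    by (rule Bochner_Integration.integrable_bound[OF Xi2]) (use Xi_le Xi1 in \<open>auto simp: abs_if intro!: AE_I2, smt (verit)\<close>)
  have lin: "integrable M f" if "f \<in> borel_measurable M" "\<And>\<omega>. \<bar>f \<omega>\<bar> \<le> c * \<Xi> \<omega>" for f :: "'a \<Rightarrow> real" and c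
    by (rule Bochner_Integration.integrable_bound[OF integrable_mult_right[OF Xi_int, of c] that(1)])
      (use that(2) in \<open>auto intro!: AE_I2 order_trans[OF _ abs_ge_self]\<close>)
  have Glin: "\<bar>G x\<bar> \<le> \<bar>G 0\<bar> + L * norm x" for x
    using C11_lipschitz[OF G, of x 0] by (simp add: abs_if split: if_splits)
  have AX: "0 \<le> A * \<Xi> \<omega>" for \<omega> using A Xi1[of \<omega>] by auto
  have wn: "norm (w (X0 \<omega>)) \<le> (A + 1) * \<Xi> \<omega>" for \<omega>
  proof -
    have "norm (w (X0 \<omega>)) \<le> norm (w (X0 \<omega>) - u (X0 \<omega>)) + norm (u (X0 \<omega>))"
      by (metis diff_add_cancel norm_triangle_ineq)
    also have "\<dots> \<le> 1 * \<Xi> \<omega> + A * \<Xi> \<omega>" using w[of "X0 \<omega>"] u[of \<omega>] e Xi1[of \<omega>] by auto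
    finally show ?thesis by (simp add: algebra_simps)
  qed
  have dn: "norm (X1 \<omega> - X0 \<omega>) \<le> h * ((A + 1) * \<Xi> \<omega>)" for \<omega>
  proof -
    have "norm (X1 \<omega> - X0 \<omega>) \<le> norm (X1 \<omega> - X0 \<omega> - h *\<^sub>R V \<omega>) + norm (h *\<^sub>R V \<omega>)"
      by (metis diff_add_cancel norm_triangle_ineq)
    also have "\<dots> \<le> 1 * h * \<Xi> \<omega> + h * (A * \<Xi> \<omega>)"
    proof (intro add_mono)
      show "norm (X1 \<omega> - X0 \<omega> - h *\<^sub>R V \<omega>) \<le> 1 * h * \<Xi> \<omega>"
        by (rule order_trans[OF X1]) (use \<eta> h Xi1[of \<omega>] in \<open>intro mult_right_mono, auto\<close>)
      show "norm (h *\<^sub>R V \<omega>) \<le> h * (A * \<Xi> \<omega>)" using V[of \<omega>] h by (simp add: mult_left_mono)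
    qed
    finally show ?thesis by (simp add: algebra_simps)
  qed
  have i1: "integrable M (\<lambda>\<omega>. G (X1 \<omega>))"
  proof (rule lin[of _ "\<bar>G 0\<bar> + L * (A + h * (A + 1))"])
    fix \<omega>
    have "norm (X1 \<omega>) \<le> norm (X0 \<omega>) + norm (X1 \<omega> - X0 \<omega>)" by (metis add.commute diff_add_cancel norm_triangle_ineq)
    also have "\<dots> \<le> A * \<Xi> \<omega> + h * ((A + 1) * \<Xi> \<omega>)" by (intro add_mono X0 dn)
    finally have "L * norm (X1 \<omega>) \<le> L * (A * \<Xi> \<omega> + h * ((A + 1) * \<Xi> \<omega>))" using L by (rule mult_left_mono)
    moreover have "\<bar>G 0\<bar> * 1 \<le> \<bar>G 0\<bar> * \<Xi> \<omega>" using Xi1 by (intro mult_left_mono) auto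
    ultimately show "\<bar>G (X1 \<omega>)\<bar> \<le> (\<bar>G 0\<bar> + L * (A + h * (A + 1))) * \<Xi> \<omega>"
      using Glin[of "X1 \<omega>"] by (simp add: algebra_simps)
  qed measurable
  have i2: "integrable M (\<lambda>\<omega>. G (X0 \<omega> + h *\<^sub>R w (X0 \<omega>)))"
  proof (rule lin[of _ "\<bar>G 0\<bar> + L * (A + h * (A + 1))"])
    fix \<omega>
    have "norm (X0 \<omega> + h *\<^sub>R w (X0 \<omega>)) \<le> norm (X0 \<omega>) + norm (h *\<^sub>R w (X0 \<omega>))" by (rule norm_triangle_ineq)
    also have "\<dots> \<le> A * \<Xi> \<omega> + h * ((A + 1) * \<Xi> \<omega>)"
      using h wn[of \<omega>] by (intro add_mono X0) (simp add: mult_left_mono)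
    finally have "L * norm (X0 \<omega> + h *\<^sub>R w (X0 \<omega>)) \<le> L * (A * \<Xi> \<omega> + h * ((A + 1) * \<Xi> \<omega>))" using L by (rule mult_left_mono)
    moreover have "\<bar>G 0\<bar> * 1 \<le> \<bar>G 0\<bar> * \<Xi> \<omega>" using Xi1 by (intro mult_left_mono) auto
    ultimately show "\<bar>G (X0 \<omega> + h *\<^sub>R w (X0 \<omega>))\<bar> \<le> (\<bar>G 0\<bar> + L * (A + h * (A + 1))) * \<Xi> \<omega>"
      using Glin[of "X0 \<omega> + h *\<^sub>R w (X0 \<omega>)"] by (simp add: algebra_simps)
  qed measurable
  have pb: "\<bar>p x \<bullet> y\<bar> \<le> L * norm y" for x y
    using Cauchy_Schwarz_ineq2[of "p x" y] mult_right_mono[OF pL[of x] norm_ge_zero[of y]] by linarith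
  have i3: "integrable M (\<lambda>\<omega>. p (X0 \<omega>) \<bullet> V \<omega>)"
    by (rule lin[of _ "L * A"])
      (measurable, use pb V L in \<open>auto intro!: order_trans[OF pb] mult_left_mono simp: mult.assoc\<close>)
  have i4: "integrable M (\<lambda>\<omega>. p (X0 \<omega>) \<bullet> u (X0 \<omega>))"
    by (rule lin[of _ "L * A"])
      (measurable, use pb u L in \<open>auto intro!: order_trans[OF pb] mult_left_mono simp: mult.assoc\<close>)
  define R where "R \<omega> = G (X1 \<omega>) - G (X0 \<omega> + h *\<^sub>R w (X0 \<omega>)) - h * (p (X0 \<omega>) \<bullet> V \<omega> - p (X0 \<omega>) \<bullet> u (X0 \<omega>))" for \<omega>
  have R: "\<bar>R \<omega>\<bar> \<le> h * (L * (\<eta> + e) + 2 * (A + 1)\<^sup>2 * h * B) * (\<Xi> \<omega>)\<^sup>2" for \<omega>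
  proof -
    have "\<bar>G (X1 \<omega>) - G (X0 \<omega>) - p (X0 \<omega>) \<bullet> (X1 \<omega> - X0 \<omega>)\<bar> \<le> B * (norm (X1 \<omega> - X0 \<omega>))\<^sup>2" by (rule pT)
    also have "\<dots> \<le> B * (h * ((A + 1) * \<Xi> \<omega>))\<^sup>2" by (intro mult_left_mono power_mono dn B norm_ge_zero)
    finally have 1: "\<bar>G (X1 \<omega>) - G (X0 \<omega>) - p (X0 \<omega>) \<bullet> (X1 \<omega> - X0 \<omega>)\<bar> \<le> h\<^sup>2 * (A + 1)\<^sup>2 * B * (\<Xi> \<omega>)\<^sup>2"
      by (simp only: power_mult_distrib mult_ac)
    have "\<bar>G (X0 \<omega> + h *\<^sub>R w (X0 \<omega>)) - G (X0 \<omega>) - p (X0 \<omega>) \<bullet> (h *\<^sub>R w (X0 \<omega>))\<bar> \<le> B * (norm (h *\<^sub>R w (X0 \<omega>)))\<^sup>2"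
      using pT[of "X0 \<omega> + h *\<^sub>R w (X0 \<omega>)" "X0 \<omega>"] by simp
    also have "\<dots> \<le> B * (h * ((A + 1) * \<Xi> \<omega>))\<^sup>2"
      using h wn[of \<omega>] by (intro mult_left_mono power_mono B norm_ge_zero) (simp add: mult_left_mono)
    finally have 2: "\<bar>G (X0 \<omega> + h *\<^sub>R w (X0 \<omega>)) - G (X0 \<omega>) - p (X0 \<omega>) \<bullet> (h *\<^sub>R w (X0 \<omega>))\<bar> \<le> h\<^sup>2 * (A + 1)\<^sup>2 * B * (\<Xi> \<omega>)\<^sup>2"
      by (simp only: power_mult_distrib mult_ac)
    have "\<bar>p (X0 \<omega>) \<bullet> (X1 \<omega> - X0 \<omega> - h *\<^sub>R V \<omega>)\<bar> \<le> L * (\<eta> * h * \<Xi> \<omega>)"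
      by (rule order_trans[OF pb]) (intro mult_left_mono X1 L)
    also have "\<dots> \<le> L * (\<eta> * h * (\<Xi> \<omega>)\<^sup>2)" using Xi_le L \<eta> h by (intro mult_left_mono) auto
    finally have 3: "\<bar>p (X0 \<omega>) \<bullet> (X1 \<omega> - X0 \<omega> - h *\<^sub>R V \<omega>)\<bar> \<le> h * L * \<eta> * (\<Xi> \<omega>)\<^sup>2" by (simp add: algebra_simps)
    have "\<bar>p (X0 \<omega>) \<bullet> (u (X0 \<omega>) - w (X0 \<omega>))\<bar> \<le> L * e"
      by (rule order_trans[OF pb]) (use w[of "X0 \<omega>"] L in \<open>auto intro!: mult_left_mono simp: norm_minus_commute\<close>)
    also have "\<dots> \<le> L * (e * (\<Xi> \<omega>)\<^sup>2)"
    proof (intro mult_left_mono L)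
      have "1 \<le> (\<Xi> \<omega>)\<^sup>2" using Xi1[of \<omega>] Xi_le[of \<omega>] by linarith
      then show "e \<le> e * (\<Xi> \<omega>)\<^sup>2" using e mult_left_mono[of 1 "(\<Xi> \<omega>)\<^sup>2" e] by simp
    qed
    finally have "h * \<bar>p (X0 \<omega>) \<bullet> (u (X0 \<omega>) - w (X0 \<omega>))\<bar> \<le> h * (L * (e * (\<Xi> \<omega>)\<^sup>2))" using h by (rule mult_left_mono)
    then have 4: "\<bar>h * (p (X0 \<omega>) \<bullet> (u (X0 \<omega>) - w (X0 \<omega>)))\<bar> \<le> h * L * e * (\<Xi> \<omega>)\<^sup>2" using h by (simp add: abs_mult)
    have "R \<omega> = (G (X1 \<omega>) - G (X0 \<omega>) - p (X0 \<omega>) \<bullet> (X1 \<omega> - X0 \<omega>))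
        - (G (X0 \<omega> + h *\<^sub>R w (X0 \<omega>)) - G (X0 \<omega>) - p (X0 \<omega>) \<bullet> (h *\<^sub>R w (X0 \<omega>)))
        + p (X0 \<omega>) \<bullet> (X1 \<omega> - X0 \<omega> - h *\<^sub>R V \<omega>) + h * (p (X0 \<omega>) \<bullet> (u (X0 \<omega>) - w (X0 \<omega>)))"
      unfolding R_def inner_diff_right inner_scaleR_right by algebra
    then have "\<bar>R \<omega>\<bar> \<le> h\<^sup>2 * (A + 1)\<^sup>2 * B * (\<Xi> \<omega>)\<^sup>2 + h\<^sup>2 * (A + 1)\<^sup>2 * B * (\<Xi> \<omega>)\<^sup>2 + h * L * \<eta> * (\<Xi> \<omega>)\<^sup>2 + h * L * e * (\<Xi> \<omega>)\<^sup>2"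
      using 1 2 3 4 by linarith
    also have "\<dots> = h * (L * (\<eta> + e) + 2 * (A + 1)\<^sup>2 * h * B) * (\<Xi> \<omega>)\<^sup>2"
      by (simp add: power2_eq_square[of h] algebra_simps)
    finally show ?thesis .
  qed
  have "expectation (\<lambda>\<omega>. p (X0 \<omega>) \<bullet> V \<omega>) = expectation (\<lambda>\<omega>. p (X0 \<omega>) \<bullet> u (X0 \<omega>))"
    by (rule cond[OF p pL])
  then have ER: "expectation R = expectation (\<lambda>\<omega>. G (X1 \<omega>)) - expectation (\<lambda>\<omega>. G (X0 \<omega> + h *\<^sub>R w (X0 \<omega>)))"
    unfolding R_def[abs_def] using i1 i2 i3 i4 by simp
  have iR: "integrable M R" unfolding R_def[abs_def] using i1 i2 i3 i4 by simp
  have "\<bar>expectation R\<bar> \<le> expectation (\<lambda>\<omega>. \<bar>R \<omega>\<bar>)" by (rule integral_abs_bound)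
  also have "\<dots> \<le> expectation (\<lambda>\<omega>. h * (L * (\<eta> + e) + 2 * (A + 1)\<^sup>2 * h * B) * (\<Xi> \<omega>)\<^sup>2)"
    using iR Xi2 R by (intro integral_mono) auto
  also have "\<dots> = h * expectation (\<lambda>\<omega>. (\<Xi> \<omega>)\<^sup>2) * (L * (\<eta> + e) + 2 * (A + 1)\<^sup>2 * h * B)" by simp
  finally show ?thesis unfolding ER .
qed

lemma C11_euler_step:
  fixes w :: "'a::euclidean_space \<Rightarrow> 'a"
  assumes w: "C11 L B w" and h: "0 \<le> h"
  shows "C11 (1 + h * L) (h * B) (\<lambda>x. x + h *\<^sub>R w x)"
  unfolding C11_def
proof (intro conjI allI)
  have *: "norm (a + h *\<^sub>R b) \<le> (1 + h * L) * norm c" if "norm a = norm c" "norm b \<le> L * norm c" for a b c :: 'a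
  proof -
    have "norm (a + h *\<^sub>R b) \<le> norm a + norm (h *\<^sub>R b)" by (rule norm_triangle_ineq)
    also have "\<dots> \<le> norm c + h * (L * norm c)"
      using that h by (auto intro!: add_mono mult_left_mono)
    finally show ?thesis by (simp add: algebra_simps)
  qed
  fix x
  show "norm ((x + h *\<^sub>R w x) - (y + h *\<^sub>R w y)) \<le> (1 + h * L) * norm (x - y)" for y
    using *[of "x - y" "x - y" "w x - w y"] C11_lipschitz[OF w, of x y] by (simp add: algebra_simps)
  obtain D where D: "linear D" "\<And>h. norm (D h) \<le> L * norm h"
    "\<And>y. norm (w y - w x - D (y - x)) \<le> B * (norm (y - x))\<^sup>2"
    using C11_derivative[OF w] by blast
  show "\<exists>D. linear D \<and> (\<forall>k. norm (D k) \<le> (1 + h * L) * norm k) \<and>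
     (\<forall>y. norm ((y + h *\<^sub>R w y) - (x + h *\<^sub>R w x) - D (y - x)) \<le> h * B * (norm (y - x))\<^sup>2)"
  proof (intro exI[of _ "\<lambda>k. k + h *\<^sub>R D k"] conjI allI)
    show "linear (\<lambda>k. k + h *\<^sub>R D k)"
      by (rule linearI) (simp_all add: linear_add[OF D(1)] linear_cmul[OF D(1)] algebra_simps)
    show "norm (k + h *\<^sub>R D k) \<le> (1 + h * L) * norm k" for k by (rule *) (use D in auto)
    fix y
    have "(y + h *\<^sub>R w y) - (x + h *\<^sub>R w x) - ((y - x) + h *\<^sub>R D (y - x)) = h *\<^sub>R (w y - w x - D (y - x))"
      by (simp add: algebra_simps)
    then show "norm ((y + h *\<^sub>R w y) - (x + h *\<^sub>R w x) - ((y - x) + h *\<^sub>R D (y - x))) \<le> h * B * (norm (y - x))\<^sup>2"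
      using mult_left_mono[OF D(3)[of y] h] h by (simp add: mult.assoc)
  qed
qed

primrec euler :: "real \<Rightarrow> (nat \<Rightarrow> 'a \<Rightarrow> 'a) \<Rightarrow> nat \<Rightarrow> 'a::real_normed_vector \<Rightarrow> 'a" where
  "euler h w 0 x = x"
| "euler h w (Suc k) x = euler h w k x + h *\<^sub>R w k (euler h w k x)"

lemma euler_borel_measurable:
  fixes w :: "nat \<Rightarrow> 'a::euclidean_space \<Rightarrow> 'a"
  assumes [measurable]: "\<And>k. w k \<in> borel_measurable borel"
  shows "euler h w k \<in> borel_measurable borel"
proof (induction k)
  case (Suc k)
  note [measurable] = Suc.IH
  show ?case by simp
qed simp

text \<open>Errors are propagated backwards through the test function: composing it with an Euler step
  keeps it in the class \<open>C11\<close>.\<close>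

lemma euler_weak_error:
  fixes w :: "nat \<Rightarrow> 'a::euclidean_space \<Rightarrow> 'a" and P :: "nat \<Rightarrow> ('a \<Rightarrow> real) \<Rightarrow> real"
  assumes w: "\<And>k. k < N \<Longrightarrow> C11 K \<beta> (w k)" and nn: "0 \<le> K" "0 \<le> \<beta>" "0 \<le> h" "0 \<le> \<epsilon>" "0 \<le> A" "0 \<le> S"
    and step: "\<And>k L B G. \<lbrakk>k < N; 0 \<le> L; 0 \<le> B; C11 L B G\<rbrakk> \<Longrightarrow>
       \<bar>P (Suc k) G - P k (\<lambda>x. G (x + h *\<^sub>R w k x))\<bar> \<le> h * S * (L * \<epsilon> + A * h * B)"
  shows "\<lbrakk>k \<le> N; 0 \<le> L; 0 \<le> B; C11 L B G\<rbrakk> \<Longrightarrow> \<bar>P k G - P 0 (\<lambda>x. G (euler h w k x))\<bar>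
     \<le> real k * h * S * (L * \<epsilon> * (1 + h * K) ^ k + A * h * (B + real k * h * \<beta> * L) * (1 + h * K) ^ (2 * k))"
proof (induction k arbitrary: L B G)
  case 0
  then show ?case by simp
next
  case (Suc k)
  define q where "q = 1 + h * K"
  have q: "1 \<le> q" using nn by (simp add: q_def)
  define G' where "G' = (\<lambda>x. G (x + h *\<^sub>R w k x))"
  have k: "k < N" using Suc.prems by simp
  have G': "C11 (L * q) (B * q\<^sup>2 + L * (h * \<beta>)) G'"
    unfolding G'_def q_def using Suc.prems nn
    by (intro C11_compose[OF Suc.prems(4) C11_euler_step[OF w[OF k]]]) auto
  have nn': "0 \<le> L * q" "0 \<le> B * q\<^sup>2 + L * (h * \<beta>)" using Suc.prems nn q by auto
  have IH: "\<bar>P k G' - P 0 (\<lambda>x. G' (euler h w k x))\<bar>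
     \<le> real k * h * S * (L * q * \<epsilon> * q ^ k + A * h * (B * q\<^sup>2 + L * (h * \<beta>) + real k * h * \<beta> * (L * q)) * q ^ (2 * k))"
    using Suc.IH[OF _ nn' G'] k unfolding q_def[symmetric] by simp
  have "L * (h * \<beta>) * 1 \<le> L * (h * \<beta>) * q\<^sup>2"
    using Suc.prems nn q by (intro mult_left_mono one_le_power) auto
  moreover have "real k * h * \<beta> * L * q \<le> real k * h * \<beta> * L * q\<^sup>2"
    using Suc.prems nn q by (intro mult_left_mono) (auto simp: power2_eq_square)
  ultimately have "B * q\<^sup>2 + L * (h * \<beta>) + real k * h * \<beta> * (L * q) \<le> (B + real (Suc k) * h * \<beta> * L) * q\<^sup>2"
    by (simp add: algebra_simps)
  then have "A * h * (B * q\<^sup>2 + L * (h * \<beta>) + real k * h * \<beta> * (L * q)) * q ^ (2 * k) \<le> A * h * ((B + real (Suc k) * h * \<beta> * L) * q\<^sup>2) * q ^ (2 * k)"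
    using nn q by (intro mult_right_mono mult_left_mono) auto
  also have "\<dots> = A * h * (B + real (Suc k) * h * \<beta> * L) * q ^ (2 * Suc k)"
    by (simp add: power_add power2_eq_square algebra_simps)
  finally have le: "L * q * \<epsilon> * q ^ k + A * h * (B * q\<^sup>2 + L * (h * \<beta>) + real k * h * \<beta> * (L * q)) * q ^ (2 * k)
     \<le> L * \<epsilon> * q ^ Suc k + A * h * (B + real (Suc k) * h * \<beta> * L) * q ^ (2 * Suc k)" (is "_ \<le> ?F")
    by simp
  have IH': "\<bar>P k G' - P 0 (\<lambda>x. G' (euler h w k x))\<bar> \<le> real k * h * S * ?F"
    by (rule order_trans[OF IH]) (use le nn in \<open>intro mult_left_mono, auto\<close>)
  have "L * \<epsilon> * 1 \<le> L * \<epsilon> * q ^ Suc k"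
    using Suc.prems nn q by (intro mult_left_mono one_le_power) auto
  moreover have "A * h * (B * 1) \<le> A * h * ((B + real (Suc k) * h * \<beta> * L) * q ^ (2 * Suc k))"
    using Suc.prems nn q by (intro mult_left_mono mult_mono one_le_power) auto
  ultimately have "L * \<epsilon> + A * h * B \<le> ?F" by (simp add: mult.assoc)
  then have "h * S * (L * \<epsilon> + A * h * B) \<le> h * S * ?F" using nn by (intro mult_left_mono) auto
  then have "\<bar>P (Suc k) G - P k G'\<bar> \<le> h * S * ?F"
    using step[OF k Suc.prems(2-4)] unfolding G'_def by linarith
  then have "\<bar>P (Suc k) G - P 0 (\<lambda>x. G' (euler h w k x))\<bar> \<le> h * S * ?F + real k * h * S * ?F"
    using IH' by linarith
  also have "\<dots> = real (Suc k) * h * S * ?F" by (simp add: algebra_simps)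
  finally show ?case unfolding q_def[symmetric] G'_def by simp
qed

context lipschitz_field begin

lemma euler_error:
  assumes w: "\<And>k x. k < N \<Longrightarrow> norm (w k x - v (real k * h) x) \<le> \<epsilon>" and h: "0 \<le> h" "real N * h \<le> 1"
    and y: "\<And>k. k < N \<Longrightarrow> norm (y (real (Suc k) * h) - y (real k * h) - h *\<^sub>R v (real k * h) (y (real k * h))) \<le> \<eta> * h"
    and nn: "0 \<le> \<epsilon>" "0 \<le> \<eta>"
  shows "k \<le> N \<Longrightarrow> norm (euler h w k (y 0) - y (real k * h)) \<le> real k * h * (\<epsilon> + \<eta>) * (1 + h * K) ^ k"
proof (induction k)
  case (Suc k)
  define q where "q = 1 + h * K"
  have q: "1 \<le> q" using h K_pos by (simp add: q_def)
  define x where "x = euler h w k (y 0)"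
  define z where "z = y (real k * h)"
  have k: "k < N" using Suc.prems by simp
  have "real k * h \<le> real N * h" using k h by (intro mult_right_mono) auto
  then have t: "real k * h \<in> {0..1}" using h by auto
  have "euler h w (Suc k) (y 0) - y (real (Suc k) * h)
     = (x - z) + h *\<^sub>R (w k x - v (real k * h) x) + h *\<^sub>R (v (real k * h) x - v (real k * h) z)
       - (y (real (Suc k) * h) - z - h *\<^sub>R v (real k * h) z)"
    by (simp add: x_def z_def algebra_simps)
  also have "norm \<dots> \<le> norm (x - z) + norm (h *\<^sub>R (w k x - v (real k * h) x)) + norm (h *\<^sub>R (v (real k * h) x - v (real k * h) z)) + norm (y (real (Suc k) * h) - z - h *\<^sub>R v (real k * h) z)"
    by (intro order_trans[OF norm_triangle_ineq4] add_right_mono order_trans[OF norm_triangle_ineq] order_refl)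
  also have "\<dots> \<le> norm (x - z) + h * \<epsilon> + h * (K * norm (x - z)) + \<eta> * h"
    using y[OF k] w[OF k, of x] v_lipschitz[OF t, of x z] h
    by (intro add_mono) (auto simp: z_def intro!: mult_left_mono)
  also have "\<dots> = q * norm (x - z) + h * (\<epsilon> + \<eta>)" by (simp add: q_def algebra_simps)
  also have "\<dots> \<le> q * (real k * h * (\<epsilon> + \<eta>) * q ^ k) + h * (\<epsilon> + \<eta>) * q ^ Suc k"
  proof (intro add_mono mult_left_mono)
    show "norm (x - z) \<le> real k * h * (\<epsilon> + \<eta>) * q ^ k" using Suc.IH k by (simp add: x_def z_def q_def)
    have "h * (\<epsilon> + \<eta>) * 1 \<le> h * (\<epsilon> + \<eta>) * q ^ Suc k" using h nn q by (intro mult_left_mono one_le_power) auto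
    then show "h * (\<epsilon> + \<eta>) \<le> h * (\<epsilon> + \<eta>) * q ^ Suc k" by simp
  qed (use q in auto)
  also have "\<dots> = real (Suc k) * h * (\<epsilon> + \<eta>) * q ^ Suc k" by (simp add: algebra_simps)
  finally show ?case by (simp add: q_def)
qed simp

end

context lipschitz_field begin

lemma linear_growth: obtains C where "0 \<le> C" "\<And>t x. t \<in> {0..1} \<Longrightarrow> norm (v t x) \<le> C + K * norm x"
proof -
  have "bounded ((\<lambda>t. v t 0) ` {0..1})"
    by (intro compact_imp_bounded compact_continuous_image v_continuous) simp
  then obtain C where C: "\<And>t. t \<in> {0..1} \<Longrightarrow> norm (v t 0) \<le> C" unfolding bounded_iff by blast
  show thesis
  proof (rule that)
    show "0 \<le> C" using C[of 0] norm_ge_zero[of "v 0 0"] by (simp del: norm_ge_zero)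
    fix t x assume t: "t \<in> {0..1::real}"
    have "norm (v t x) \<le> norm (v t 0) + norm (v t x - v t 0)" by (metis add.commute diff_add_cancel norm_triangle_ineq)
    then show "norm (v t x) \<le> C + K * norm x" using C[OF t] v_lipschitz[OF t, of x 0] by simp
  qed
qed

text \<open>Both the process and the flow are compared with the Euler scheme of step \<open>T / N\<close> for the
  velocity field mollified at scale \<open>1 / sqrt N\<close>: the process weakly, the flow pointwise.\<close>

lemma flow_transports_law:
  fixes M :: "'w measure" and X X' :: "real \<Rightarrow> 'w \<Rightarrow> real ^ 'n"
  assumes "prob_space M" and T: "0 < T" "T \<le> 1"
    and Xm: "\<And>t. t \<in> {0..T} \<Longrightarrow> X t \<in> borel_measurable M" "\<And>t. t \<in> {0..T} \<Longrightarrow> X' t \<in> borel_measurable M"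
    and Xim: "\<Xi> \<in> borel_measurable M" and Xi1: "\<And>\<omega>. 1 \<le> \<Xi> \<omega>" and Xi2: "integrable M (\<lambda>\<omega>. (\<Xi> \<omega>)\<^sup>2)"
    and bound: "0 \<le> A" "\<And>t \<omega>. t \<in> {0..T} \<Longrightarrow> norm (X t \<omega>) \<le> A * \<Xi> \<omega>" "\<And>t \<omega>. t \<in> {0..T} \<Longrightarrow> norm (X' t \<omega>) \<le> A * \<Xi> \<omega>"
    and diff: "\<And>\<eta>. 0 < \<eta> \<Longrightarrow> \<exists>d>0. \<forall>s\<in>{0..T}. \<forall>t\<in>{0..T}. \<bar>s - t\<bar> < d \<longrightarrow>
       (\<forall>\<omega>. norm (X s \<omega> - X t \<omega> - (s - t) *\<^sub>R X' t \<omega>) \<le> \<eta> * \<bar>s - t\<bar> * \<Xi> \<omega>)"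
    and cond: "\<And>t p C. \<lbrakk>t \<in> {0..T}; p \<in> borel_measurable borel; \<And>x. norm (p x) \<le> C\<rbrakk> \<Longrightarrow>
       (\<integral>\<omega>. p (X t \<omega>) \<bullet> X' t \<omega> \<partial>M) = (\<integral>\<omega>. p (X t \<omega>) \<bullet> v t (X t \<omega>) \<partial>M)"
  shows "distr M borel (X T) = distr M borel (\<lambda>\<omega>. flow T (X 0 \<omega>))"
proof -
  interpret prob_space M by fact
  have vm: "v t \<in> borel_measurable borel" if t: "t \<in> {0..1}" for t
  proof -
    have "K-lipschitz_on UNIV (v t)"
      by (rule lipschitz_onI) (use v_lipschitz[OF t] K_pos in \<open>auto simp: dist_norm\<close>)
    then show ?thesis by (intro borel_measurable_continuous_onI lipschitz_on_continuous_on)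
  qed
  have T01: "T \<in> {0..1}" using T by auto
  note [measurable] = flow_borel_measurable[OF T01]
  have X0m[measurable]: "X 0 \<in> borel_measurable M" and XTm[measurable]: "X T \<in> borel_measurable M"
    using Xm T by auto
  obtain Cv where Cv: "0 \<le> Cv" "\<And>t x. t \<in> {0..1} \<Longrightarrow> norm (v t x) \<le> Cv + K * norm x"
    using linear_growth by metis
  define A' where "A' = max A (Cv + K * A)"
  have A': "0 \<le> A'" "A \<le> A'" using bound(1) by (auto simp: A'_def)
  have Xi0: "0 \<le> \<Xi> \<omega>" for \<omega> using Xi1[of \<omega>] by linarith
  have bX: "norm (X t \<omega>) \<le> A' * \<Xi> \<omega>" "norm (X' t \<omega>) \<le> A' * \<Xi> \<omega>" if "t \<in> {0..T}" for t \<omega>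
    using bound(2,3)[OF that, of \<omega>] mult_right_mono[OF A'(2) Xi0[of \<omega>]] by linarith+
  have bv: "norm (v t (X t \<omega>)) \<le> A' * \<Xi> \<omega>" if t: "t \<in> {0..T}" for t \<omega>
  proof -
    have "norm (v t (X t \<omega>)) \<le> Cv + K * norm (X t \<omega>)" using t T by (intro Cv) auto
    also have "\<dots> \<le> Cv * \<Xi> \<omega> + K * (A * \<Xi> \<omega>)"
      using bound(2)[OF t, of \<omega>] K_pos Cv(1) mult_left_mono[OF Xi1 Cv(1), of \<omega>] by (intro add_mono mult_left_mono) auto
    also have "\<dots> = (Cv + K * A) * \<Xi> \<omega>" by (simp add: algebra_simps)
    also have "\<dots> \<le> A' * \<Xi> \<omega>" by (intro mult_right_mono Xi0) (simp add: A'_def)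
    finally show ?thesis .
  qed
  define S where "S = expectation (\<lambda>\<omega>. (\<Xi> \<omega>)\<^sup>2)"
  have S: "0 \<le> S" unfolding S_def by (intro integral_nonneg_AE) auto
  obtain Ca where Ca: "Ca \<ge> 1"
    "\<And>(u :: real ^ 'n \<Rightarrow> real ^ 'n) K \<epsilon>. \<lbrakk>0 < \<epsilon>; 0 \<le> K; \<And>x y. norm (u x - u y) \<le> K * norm (x - y)\<rbrakk> \<Longrightarrow>
      \<exists>w. (\<forall>x. norm (w x - u x) \<le> K * \<epsilon>) \<and> C11 (Ca * K) (Ca * K / \<epsilon>) w"
    using mollification[where 'a = "real ^ 'n" and 'b = "real ^ 'n"] by blast
  obtain Cb where Cb: "Cb \<ge> 1"
    "\<And>(u :: real ^ 'n \<Rightarrow> real) K \<epsilon>. \<lbrakk>0 < \<epsilon>; 0 \<le> K; \<And>x y. norm (u x - u y) \<le> K * norm (x - y)\<rbrakk> \<Longrightarrow>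
      \<exists>w. (\<forall>x. norm (w x - u x) \<le> K * \<epsilon>) \<and> C11 (Cb * K) (Cb * K / \<epsilon>) w"
    using mollification[where 'a = "real ^ 'n" and 'b = real] by blast
  define h where "h N = T / real (Suc N)" for N
  define \<epsilon> where "\<epsilon> N = 1 / sqrt (real (Suc N))" for N
  have h: "0 < h N" "real (Suc N) * h N = T" "h N \<le> 1" for N
    using T by (auto simp: h_def divide_simps)
  have \<epsilon>: "0 < \<epsilon> N" "\<epsilon> N \<le> 1" for N by (auto simp: \<epsilon>_def)
  have h\<epsilon>: "h N / \<epsilon> N \<le> \<epsilon> N" for N
  proof -
    have "h N \<le> 1 / real (Suc N)" using T by (simp add: h_def divide_right_mono)
    also have "\<dots> = \<epsilon> N * \<epsilon> N" by (simp add: \<epsilon>_def)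
    finally show ?thesis using \<epsilon>[of N] by (simp add: divide_simps)
  qed
  have \<epsilon>_lim: "\<epsilon> \<longlonglongrightarrow> 0"
    unfolding \<epsilon>_def[abs_def]
    by (intro real_tendsto_divide_at_top[OF tendsto_const] filterlim_compose[OF sqrt_at_top]
        filterlim_compose[OF filterlim_real_sequentially filterlim_Suc])
  have h_lim: "h \<longlonglongrightarrow> 0"
    unfolding h_def[abs_def]
    by (intro real_tendsto_divide_at_top[OF tendsto_const]
        filterlim_compose[OF filterlim_real_sequentially filterlim_Suc])
  have tk: "real k * h N \<in> {0..T}" if "k \<le> Suc N" for k N
  proof -
    have "real k * h N \<le> real (Suc N) * h N" using that h(1)[of N] by (intro mult_right_mono) auto
    then show ?thesis using h(1)[of N] unfolding h(2) by simp
  qed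
  have tk1: "real k * h N \<in> {0..1}" if "k \<le> Suc N" for k N using tk[OF that] T by auto
  have "\<exists>w. k < Suc N \<longrightarrow> (\<forall>x. norm (w x - v (real k * h N) x) \<le> K * \<epsilon> N) \<and> C11 (Ca * K) (Ca * K / \<epsilon> N) w" for N k
    using Ca(2)[OF \<epsilon>(1), of K "v (real k * h N)" N] v_lipschitz[OF tk1, of k N] K_pos by fastforce
  then have "\<exists>w. \<forall>N k. k < Suc N \<longrightarrow> (\<forall>x. norm (w N k x - v (real k * h N) x) \<le> K * \<epsilon> N) \<and> C11 (Ca * K) (Ca * K / \<epsilon> N) (w N k)"
    by (intro choice allI)
  then obtain w' where w': "\<And>N k x. k < Suc N \<Longrightarrow> norm (w' N k x - v (real k * h N) x) \<le> K * \<epsilon> N"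
    "\<And>N k. k < Suc N \<Longrightarrow> C11 (Ca * K) (Ca * K / \<epsilon> N) (w' N k)" by blast
  define w where "w N k = (if k < Suc N then w' N k else (\<lambda>_. 0))" for N k
  have w: "norm (w N k x - v (real k * h N) x) \<le> K * \<epsilon> N" "C11 (Ca * K) (Ca * K / \<epsilon> N) (w N k)" if "k < Suc N" for N k x
    using w' that by (auto simp: w_def)
  have wm[measurable]: "w N k \<in> borel_measurable borel" for N k
    using C11_borel_measurable[OF w'(2)[of k N]] by (auto simp: w_def)
  define E where "E N = euler (h N) (w N) (Suc N)" for N
  have Em[measurable]: "E N \<in> borel_measurable borel" for N
    unfolding E_def by (rule euler_borel_measurable[OF wm])
  have q_bound: "(1 + h N * c) ^ (m * Suc N) \<le> exp (c * real m)" if "0 \<le> c" for N c m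
  proof -
    have "(1 + h N * c) ^ (m * Suc N) \<le> exp (h N * c) ^ (m * Suc N)"
      using that h(1)[of N] by (intro power_mono exp_ge_add_one_self) auto
    also have "\<dots> = exp (real (m * Suc N) * (h N * c))" by (rule exp_of_nat_mult[symmetric])
    also have "real (m * Suc N) * (h N * c) = (real (Suc N) * h N) * (c * real m)"
      by (simp only: of_nat_mult mult_ac)
    also have "exp ((real (Suc N) * h N) * (c * real m)) \<le> exp (c * real m)"
      unfolding h(2) using T that by (auto intro!: mult_left_le_one_le)
    finally show ?thesis .
  qed

  have E_flow: "(\<lambda>N. E N x) \<longlonglongrightarrow> flow T x" for x
  proof (rule LIMSEQ_I)
    fix r :: real assume r: "0 < r"
    define \<eta> where "\<eta> = r / (4 * exp K)"
    have \<eta>: "0 < \<eta>" using r by (simp add: \<eta>_def)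
    have "continuous_on {0..1} (\<lambda>t. v t (flow t x))"
      by (intro continuous_on_along ivp_solution_continuous[OF flow_solution])
    then obtain d where d: "0 < d" "\<And>s t. \<lbrakk>s \<in> {0..1}; t \<in> {0..1}; \<bar>s - t\<bar> < d\<rbrakk> \<Longrightarrow>
       norm (flow s x - flow t x - (s - t) *\<^sub>R v t (flow t x)) \<le> \<eta> * \<bar>s - t\<bar>"
      using C1_uniform_taylor[of 1 "\<lambda>t. flow t x" "\<lambda>t. v t (flow t x)" \<eta>] flow_solution[of x] \<eta>
      unfolding ivp_solution_def by blast
    have ev1: "\<forall>\<^sub>F N in sequentially. h N < d"
      using order_tendstoD(2)[OF h_lim d(1)] .
    have ev2: "\<forall>\<^sub>F N in sequentially. \<epsilon> N < \<eta> / K"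
      using order_tendstoD(2)[OF \<epsilon>_lim, of "\<eta> / K"] \<eta> K_pos by simp
    have "\<forall>\<^sub>F N in sequentially. norm (E N x - flow T x) < r"
      using ev1 ev2
    proof eventually_elim
      case (elim N)
      have "norm (euler (h N) (w N) (Suc N) (flow 0 x) - flow (real (Suc N) * h N) x)
         \<le> real (Suc N) * h N * (K * \<epsilon> N + \<eta>) * (1 + h N * K) ^ Suc N"
      proof (rule euler_error[where N="Suc N" and y="\<lambda>t. flow t x"])
        show "norm (w N k x - v (real k * h N) x) \<le> K * \<epsilon> N" if "k < Suc N" for k x by (rule w(1)[OF that])
        show "0 \<le> h N" "real (Suc N) * h N \<le> 1" using h[of N] T by auto
        show "0 \<le> K * \<epsilon> N" "0 \<le> \<eta>" using K_pos \<epsilon>[of N] \<eta> by auto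
        fix k assume k: "k < Suc N"
        have "real (Suc k) * h N - real k * h N = h N" by (simp add: algebra_simps)
        then show "norm (flow (real (Suc k) * h N) x - flow (real k * h N) x - h N *\<^sub>R v (real k * h N) (flow (real k * h N) x)) \<le> \<eta> * h N"
          using d(2)[of "real (Suc k) * h N" "real k * h N"] tk1[of "Suc k" N] tk1[of k N] k elim(1) h(1)[of N] by simp
      qed simp
      also have "\<dots> \<le> 1 * (2 * \<eta>) * exp K"
      proof (intro mult_mono)
        show "real (Suc N) * h N \<le> 1" unfolding h(2) by (rule T)
        show "K * \<epsilon> N + \<eta> \<le> 2 * \<eta>" using elim(2) K_pos by (simp add: divide_simps mult.commute)
        show "(1 + h N * K) ^ Suc N \<le> exp K" using q_bound[of K N 1] K_pos by simp
        show "0 \<le> K * \<epsilon> N + \<eta>" "0 \<le> (1 + h N * K) ^ Suc N"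
          using K_pos \<epsilon>[of N] \<eta> h[of N] by auto
      qed (use \<eta> in auto)
      also have "\<dots> < r" using r by (simp add: \<eta>_def)
      finally show ?case
        using flow_solution[of x] by (simp only: E_def h(2) ivp_solution_def)
    qed
    then show "\<exists>no. \<forall>n\<ge>no. norm (E n x - flow T x) < r" by (simp add: eventually_sequentially)
  qed

  have E_law: "(\<lambda>N. expectation (\<lambda>\<omega>. f (E N (X 0 \<omega>)))) \<longlonglongrightarrow> expectation (\<lambda>\<omega>. f (X T \<omega>))"
    if f1: "\<And>x. \<bar>f x\<bar> \<le> 1" and fL: "\<And>x y. \<bar>f x - f y\<bar> \<le> L * dist x y" and L: "0 \<le> L"
      and [measurable]: "f \<in> borel_measurable borel" for f :: "real ^ 'n \<Rightarrow> real" and L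
  proof (rule LIMSEQ_I)
    fix r :: real assume r: "0 < r"
    define c0 where "c0 = 2 * (A' + 1)\<^sup>2"
    have c0: "0 \<le> c0" by (simp add: c0_def)
    define c1 where "c1 = S * (Cb * L * exp (Ca * K))"
    define c2 where "c2 = 2 * L + S * (Cb * L * K * exp (Ca * K) + c0 * (Cb * L + Ca * K * (Cb * L)) * exp (Ca * K * 2))"
    have c1: "0 \<le> c1" and c2: "0 \<le> c2" using S L Cb(1) Ca(1) K_pos c0 by (auto simp: c1_def c2_def)
    define \<eta> where "\<eta> = min 1 (r / (2 * (c1 + 1)))"
    have \<eta>: "0 < \<eta>" "\<eta> \<le> 1" using r c1 by (auto simp: \<eta>_def)
    obtain d where d: "d > 0" "\<And>s t \<omega>. s \<in> {0..T} \<Longrightarrow> t \<in> {0..T} \<Longrightarrow> \<bar>s - t\<bar> < d \<Longrightarrow>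
       norm (X s \<omega> - X t \<omega> - (s - t) *\<^sub>R X' t \<omega>) \<le> \<eta> * \<bar>s - t\<bar> * \<Xi> \<omega>"
      using diff[OF \<eta>(1)] by blast
    have ev1: "\<forall>\<^sub>F N in sequentially. h N < d" using order_tendstoD(2)[OF h_lim d(1)] .
    have ev2: "\<forall>\<^sub>F N in sequentially. \<epsilon> N < min (1 / K) (r / (2 * (c2 + 1)))"
      by (rule order_tendstoD(2)[OF \<epsilon>_lim]) (use r c2 K_pos in auto)
    have "\<forall>\<^sub>F N in sequentially. norm (expectation (\<lambda>\<omega>. f (E N (X 0 \<omega>))) - expectation (\<lambda>\<omega>. f (X T \<omega>))) < r"
      using ev1 ev2
    proof eventually_elim
      case (elim N)
      have e1: "K * \<epsilon> N \<le> 1" using elim(2) K_pos by (simp add: divide_simps mult.commute)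
      obtain g where g: "\<And>x. norm (g x - f x) \<le> L * \<epsilon> N" "C11 (Cb * L) (Cb * L / \<epsilon> N) g"
        using Cb(2)[OF \<epsilon>(1)[of N] L, of f] fL by (auto simp: dist_norm)
      have [measurable]: "g \<in> borel_measurable borel" by (rule C11_borel_measurable[OF g(2)])
      define P where "P k G = expectation (\<lambda>\<omega>. G (X (real k * h N) \<omega>))" for k and G :: "real ^ 'n \<Rightarrow> real"
      have "\<bar>P (Suc N) g - P 0 (\<lambda>x. g (euler (h N) (w N) (Suc N) x))\<bar>
        \<le> real (Suc N) * h N * S * (Cb * L * (\<eta> + K * \<epsilon> N) * (1 + h N * (Ca * K)) ^ Suc N
           + c0 * h N * (Cb * L / \<epsilon> N + real (Suc N) * h N * (Ca * K / \<epsilon> N) * (Cb * L)) * (1 + h N * (Ca * K)) ^ (2 * Suc N))"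
      proof (rule euler_weak_error[where N="Suc N"])
        show "C11 (Ca * K) (Ca * K / \<epsilon> N) (w N k)" if "k < Suc N" for k by (rule w(2)[OF that])
        show "0 \<le> Ca * K" "0 \<le> Ca * K / \<epsilon> N" "0 \<le> h N" "0 \<le> \<eta> + K * \<epsilon> N" "0 \<le> c0" "0 \<le> S" "0 \<le> Cb * L" "0 \<le> Cb * L / \<epsilon> N"
          using Ca(1) Cb(1) K_pos \<epsilon>[of N] h[of N] \<eta> c0 S L by auto
        show "C11 (Cb * L) (Cb * L / \<epsilon> N) g" by (rule g)
        fix k l b and G :: "real ^ 'n \<Rightarrow> real" assume k: "k < Suc N" and l: "0 \<le> l" and b: "0 \<le> b" and G: "C11 l b G"
        have hk: "real (Suc k) * h N - real k * h N = h N" by (simp add: algebra_simps)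
        have "\<bar>expectation (\<lambda>\<omega>. G (X (real (Suc k) * h N) \<omega>)) - expectation (\<lambda>\<omega>. G (X (real k * h N) \<omega> + h N *\<^sub>R w N k (X (real k * h N) \<omega>)))\<bar>
           \<le> h N * expectation (\<lambda>\<omega>. (\<Xi> \<omega>)\<^sup>2) * (l * (\<eta> + K * \<epsilon> N) + 2 * (A' + 1)\<^sup>2 * h N * b)"
        proof (rule euler_weak_step[where V="X' (real k * h N)" and u="v (real k * h N)" and \<Xi>=\<Xi>, OF G l b])
          show "X (real k * h N) \<in> borel_measurable M" "X (real (Suc k) * h N) \<in> borel_measurable M"
            "X' (real k * h N) \<in> borel_measurable M"
            using k by (auto intro!: Xm tk simp del: of_nat_Suc)
          show "v (real k * h N) \<in> borel_measurable borel" using k by (intro vm tk1) auto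
          show "norm (X (real k * h N) \<omega>) \<le> A' * \<Xi> \<omega>" "norm (X' (real k * h N) \<omega>) \<le> A' * \<Xi> \<omega>"
            "norm (v (real k * h N) (X (real k * h N) \<omega>)) \<le> A' * \<Xi> \<omega>" for \<omega>
            using k by (auto intro!: bX bv tk)
          show "norm (w N k x - v (real k * h N) x) \<le> K * \<epsilon> N" for x by (rule w(1)[OF k])
          show "norm (X (real (Suc k) * h N) \<omega> - X (real k * h N) \<omega> - h N *\<^sub>R X' (real k * h N) \<omega>) \<le> \<eta> * h N * \<Xi> \<omega>" for \<omega>
            using d(2)[OF tk[of "Suc k" N] tk[of k N], of \<omega>] k elim(1) h(1)[of N] unfolding hk by simp
          show "expectation (\<lambda>\<omega>. p (X (real k * h N) \<omega>) \<bullet> X' (real k * h N) \<omega>) = expectation (\<lambda>\<omega>. p (X (real k * h N) \<omega>) \<bullet> v (real k * h N) (X (real k * h N) \<omega>))"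
            if "p \<in> borel_measurable borel" "\<And>x. norm (p x) \<le> C" for p C
            using k that by (intro cond[of _ p C] tk) auto
        qed (use Xim wm Xi1 Xi2 A' K_pos \<epsilon>[of N] e1 \<eta> h[of N] in auto)
        then show "\<bar>P (Suc k) G - P k (\<lambda>x. G (x + h N *\<^sub>R w N k x))\<bar> \<le> h N * S * (l * (\<eta> + K * \<epsilon> N) + c0 * h N * b)"
          by (simp only: P_def S_def c0_def)
      qed simp
      also have "\<dots> \<le> 1 * S * (Cb * L * (\<eta> + K * \<epsilon> N) * exp (Ca * K) + c0 * ((Cb * L + Ca * K * (Cb * L)) * \<epsilon> N) * exp (Ca * K * 2))"
      proof -
        have q1: "(1 + h N * (Ca * K)) ^ Suc N \<le> exp (Ca * K)"
          using q_bound[of "Ca * K" N 1] Ca(1) K_pos by simp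
        have q2: "(1 + h N * (Ca * K)) ^ (2 * Suc N) \<le> exp (Ca * K * 2)"
          using q_bound[of "Ca * K" N 2] Ca(1) K_pos by simp
        have q0: "0 \<le> 1 + h N * (Ca * K)" using h[of N] Ca(1) K_pos by simp
        have "h N * (Cb * L / \<epsilon> N + real (Suc N) * h N * (Ca * K / \<epsilon> N) * (Cb * L)) = (Cb * L + T * (Ca * K) * (Cb * L)) * (h N / \<epsilon> N)"
          unfolding h(2) by (simp add: divide_inverse algebra_simps)
        also have "\<dots> \<le> (Cb * L + 1 * (Ca * K) * (Cb * L)) * \<epsilon> N"
          using T Ca(1) Cb(1) L K_pos h[of N] \<epsilon>[of N] by (intro mult_mono h\<epsilon> add_left_mono mult_right_mono) auto
        finally have le: "c0 * h N * (Cb * L / \<epsilon> N + real (Suc N) * h N * (Ca * K / \<epsilon> N) * (Cb * L)) \<le> c0 * ((Cb * L + Ca * K * (Cb * L)) * \<epsilon> N)"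
          using c0 by (simp add: mult.assoc mult_left_mono)
        have r0: "0 \<le> c0 * ((Cb * L + Ca * K * (Cb * L)) * \<epsilon> N)"
          using c0 Cb(1) Ca(1) L K_pos \<epsilon>[of N] by simp
        have p0: "0 \<le> Cb * L * (\<eta> + K * \<epsilon> N)"
          using Cb(1) L K_pos \<epsilon>[of N] \<eta> by simp
        have inner: "Cb * L * (\<eta> + K * \<epsilon> N) * (1 + h N * (Ca * K)) ^ Suc N
           + c0 * h N * (Cb * L / \<epsilon> N + real (Suc N) * h N * (Ca * K / \<epsilon> N) * (Cb * L)) * (1 + h N * (Ca * K)) ^ (2 * Suc N)
          \<le> Cb * L * (\<eta> + K * \<epsilon> N) * exp (Ca * K) + c0 * ((Cb * L + Ca * K * (Cb * L)) * \<epsilon> N) * exp (Ca * K * 2)"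
          by (rule add_mono[OF mult_left_mono[OF q1 p0] mult_mono[OF le q2 r0 zero_le_power[OF q0]]])
        have "0 \<le> Cb * L * (\<eta> + K * \<epsilon> N) * exp (Ca * K) + c0 * ((Cb * L + Ca * K * (Cb * L)) * \<epsilon> N) * exp (Ca * K * 2)"
          using p0 r0 by simp
        moreover have "T * S \<le> 1 * S" using T S by (intro mult_right_mono) auto
        moreover have "0 \<le> T * S" using T S by simp
        ultimately show ?thesis
          unfolding h(2) by (meson inner[unfolded h(2)] mult_left_mono mult_right_mono order_trans)
      qed
      also have "\<dots> = c1 * \<eta> + (c2 - 2 * L) * \<epsilon> N" by (simp add: c1_def c2_def algebra_simps)
      finally have main: "\<bar>expectation (\<lambda>\<omega>. g (X T \<omega>)) - expectation (\<lambda>\<omega>. g (E N (X 0 \<omega>)))\<bar> \<le> c1 * \<eta> + (c2 - 2 * L) * \<epsilon> N"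
        unfolding P_def h(2) E_def by simp
      have gf: "\<bar>expectation (\<lambda>\<omega>. g (Y \<omega>)) - expectation (\<lambda>\<omega>. f (Y \<omega>))\<bar> \<le> L * \<epsilon> N"
        if [measurable]: "Y \<in> borel_measurable M" for Y
      proof -
        have "\<bar>g x\<bar> \<le> 1 + L * \<epsilon> N" for x using g(1)[of x] f1[of x] by (simp add: abs_if split: if_splits)
        then have "integrable M (\<lambda>\<omega>. g (Y \<omega>))" by (intro integrable_const_bound[where B="1 + L * \<epsilon> N"]) auto
        moreover have "integrable M (\<lambda>\<omega>. f (Y \<omega>))" by (intro integrable_const_bound[where B=1]) (auto simp: f1)
        ultimately have "expectation (\<lambda>\<omega>. g (Y \<omega>)) - expectation (\<lambda>\<omega>. f (Y \<omega>)) = expectation (\<lambda>\<omega>. g (Y \<omega>) - f (Y \<omega>))"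
          and i: "integrable M (\<lambda>\<omega>. g (Y \<omega>) - f (Y \<omega>))" by simp_all
        then have "\<bar>expectation (\<lambda>\<omega>. g (Y \<omega>)) - expectation (\<lambda>\<omega>. f (Y \<omega>))\<bar> \<le> expectation (\<lambda>\<omega>. \<bar>g (Y \<omega>) - f (Y \<omega>)\<bar>)"
          using integral_abs_bound by metis
        also have "\<dots> \<le> expectation (\<lambda>\<omega>. L * \<epsilon> N)" using i g(1) by (intro integral_mono) auto
        finally show ?thesis by (simp add: prob_space)
      qed
      have "\<bar>expectation (\<lambda>\<omega>. f (E N (X 0 \<omega>))) - expectation (\<lambda>\<omega>. f (X T \<omega>))\<bar> \<le> c1 * \<eta> + c2 * \<epsilon> N"
        using main gf[of "X T"] gf[of "\<lambda>\<omega>. E N (X 0 \<omega>)"] by (simp add: algebra_simps)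
      also have "\<dots> < r"
      proof -
        have "c1 * \<eta> \<le> c1 * (r / (2 * (c1 + 1)))" using c1 by (intro mult_left_mono) (auto simp: \<eta>_def)
        also have "\<dots> \<le> r / 2" using c1 r by (simp add: divide_simps)
        finally have 1: "c1 * \<eta> \<le> r / 2" .
        have "c2 * \<epsilon> N \<le> c2 * (r / (2 * (c2 + 1)))" using c2 elim(2) by (intro mult_left_mono) auto
        also have "\<dots> < r / 2" using c2 r by (simp add: divide_simps)
        finally show ?thesis using 1 by linarith
      qed
      finally show ?case by simp
    qed
    then show "\<exists>no. \<forall>n\<ge>no. norm (expectation (\<lambda>\<omega>. f (E n (X 0 \<omega>))) - expectation (\<lambda>\<omega>. f (X T \<omega>))) < r"
      by (simp add: eventually_sequentially)
  qed

  show ?thesis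
  proof (rule measure_eqI_bounded_lipschitz)
    show "prob_space (distr M borel (X T))" "prob_space (distr M borel (\<lambda>\<omega>. flow T (X 0 \<omega>)))"
      by (auto intro!: prob_space_distr)
    fix f :: "real ^ 'n \<Rightarrow> real" and L
    assume f: "\<And>x. \<bar>f x\<bar> \<le> 1" "\<And>x y. \<bar>f x - f y\<bar> \<le> L * dist x y" "0 \<le> L" and fm[measurable]: "f \<in> borel_measurable borel"
    have "L-lipschitz_on UNIV f" by (rule lipschitz_onI) (use f in \<open>auto simp: dist_real_def\<close>)
    then have "isCont f x" for x
      using lipschitz_on_continuous_on[of L UNIV f] by (simp add: continuous_on_eq_continuous_at)
    then have "(\<lambda>N. f (E N x)) \<longlonglongrightarrow> f (flow T x)" for x
      by (rule isCont_tendsto_compose[OF _ E_flow])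
    then have "(\<lambda>N. expectation (\<lambda>\<omega>. f (E N (X 0 \<omega>)))) \<longlonglongrightarrow> expectation (\<lambda>\<omega>. f (flow T (X 0 \<omega>)))"
      using f(1) by (intro integral_dominated_convergence[where w="\<lambda>_. 1"]) auto
    then have "expectation (\<lambda>\<omega>. f (flow T (X 0 \<omega>))) = expectation (\<lambda>\<omega>. f (X T \<omega>))"
      using LIMSEQ_unique E_law[OF f fm] by blast
    then show "(\<integral>x. f x \<partial>distr M borel (X T)) = (\<integral>x. f x \<partial>distr M borel (\<lambda>\<omega>. flow T (X 0 \<omega>)))"
      by (simp add: integral_distr)
  qed auto
qed

end

section \<open>Conditional means under the Gaussian kernel\<close>

lemma integral_pos:
  fixes f :: "'a \<Rightarrow> real"
  assumes i: "integrable N f" and p: "\<And>x. 0 < f x" and N: "emeasure N (space N) \<noteq> 0"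
  shows "0 < (\<integral>x. f x \<partial>N)"
proof -
  have "(\<integral>x. f x \<partial>N) \<noteq> 0"
  proof
    assume "(\<integral>x. f x \<partial>N) = 0"
    then have "AE x in N. f x = 0"
      by (subst (asm) integral_nonneg_eq_0_iff_AE[OF i]) (auto simp: less_imp_le[OF p])
    then have "AE x in N. x \<notin> space N" by eventually_elim (use p in \<open>auto simp: less_le\<close>)
    then have "emeasure N (space N) = 0" by (subst (asm) AE_iff_measurable[of "space N"]) auto
    then show False using N by simp
  qed
  moreover have "0 \<le> (\<integral>x. f x \<partial>N)" by (intro integral_nonneg_AE) (auto simp: less_imp_le[OF p])
  ultimately show ?thesis by simp
qed

lemma gaussian_density:
  assumes "\<sigma> > 0"
  shows "(gaussian \<sigma> :: (real ^ 'n) measure) =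
    density lborel (\<lambda>x. ennreal ((1 / sqrt (2 * pi * \<sigma>\<^sup>2)) ^ CARD('n) * exp (- (norm x)\<^sup>2 / (2 * \<sigma>\<^sup>2))))"
proof -
  have "(\<Prod>i\<in>UNIV. normal_density 0 \<sigma> (x $ i)) =
      (1 / sqrt (2 * pi * \<sigma>\<^sup>2)) ^ CARD('n) * exp (- (norm x)\<^sup>2 / (2 * \<sigma>\<^sup>2))" for x :: "real ^ 'n"
  proof -
    have "(norm x)\<^sup>2 = (\<Sum>i\<in>UNIV. (x $ i)\<^sup>2)"
      by (simp add: norm_vec_def L2_set_def sum_nonneg)
    then have "- (norm x)\<^sup>2 / (2 * \<sigma>\<^sup>2) = (\<Sum>i\<in>UNIV. - (x $ i)\<^sup>2 / (2 * \<sigma>\<^sup>2))"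
      by (simp add: sum_divide_distrib[symmetric] sum_negf)
    then show ?thesis
      by (simp add: normal_density_def prod.distrib prod_constant exp_sum[symmetric] prod_dividef power_divide)
  qed
  then show ?thesis by (simp add: gaussian_def)
qed

definition kern :: "real \<Rightarrow> real \<Rightarrow> 'a::real_inner \<Rightarrow> 'a \<Rightarrow> real" where
  "kern a b x y = exp (- (norm (x - b *\<^sub>R y))\<^sup>2 / (2 * a\<^sup>2))"

definition kern_mean :: "'a::euclidean_space measure \<Rightarrow> real \<Rightarrow> real \<Rightarrow> 'a \<Rightarrow> 'a" where
  "kern_mean \<nu> a b x = (\<integral>y. kern a b x y *\<^sub>R y \<partial>\<nu>) /\<^sub>R (\<integral>y. kern a b x y \<partial>\<nu>)"

lemma kern_pos: "0 < kern a b x y" and kern_le_1: "kern a b x y \<le> 1"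
  by (simp_all add: kern_def)

lemma kern_measurable [measurable]:
  fixes f g :: "'w \<Rightarrow> 'a::euclidean_space"
  assumes [measurable]: "f \<in> borel_measurable M" "g \<in> borel_measurable M"
  shows "(\<lambda>\<omega>. kern a b (f \<omega>) (g \<omega>)) \<in> borel_measurable M"
  unfolding kern_def by measurable

lemma nn_integral_lborel_affine:
  fixes f :: "'a::euclidean_space \<Rightarrow> ennreal"
  assumes [measurable]: "f \<in> borel_measurable borel" and c: "c \<noteq> 0"
  shows "(\<integral>\<^sup>+x. f x \<partial>lborel) = ennreal (\<bar>c\<bar> ^ DIM('a)) * (\<integral>\<^sup>+x. f (t + c *\<^sub>R x) \<partial>lborel)"
  by (subst lborel_affine[OF c, of t])
     (simp add: nn_integral_density nn_integral_distr nn_integral_cmult ennreal_power)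

locale gaussian_pair = prob_space M for M :: "'w measure" +
  fixes Z X1 :: "'w \<Rightarrow> real ^ 'n" and \<nu> :: "(real ^ 'n) measure"
  assumes indep: "indep_var borel Z borel X1"
    and distr_Z: "distr M borel Z = gaussian 1" and distr_X1: "distr M borel X1 = \<nu>"
    and second_moment: "integrable \<nu> (\<lambda>x. (norm x)\<^sup>2)"
begin

lemma Z_measurable [measurable]: "Z \<in> borel_measurable M"
  and X1_measurable [measurable]: "X1 \<in> borel_measurable M"
  using indep indep_var_rv1 indep_var_rv2 by blast+

lemma sets_nu [simp, measurable_cong]: "sets \<nu> = sets borel" and space_nu [simp]: "space \<nu> = UNIV"
  unfolding distr_X1[symmetric] by simp_all

lemma prob_space_nu: "prob_space \<nu>"
  unfolding distr_X1[symmetric] by (rule prob_space_distr) simp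

sublocale nu: prob_space \<nu> by (rule prob_space_nu)

sublocale lborel_nu: pair_sigma_finite "lborel :: (real ^ 'n) measure" \<nu> ..

lemma prob_space_gaussian_1: "prob_space (gaussian 1 :: (real ^ 'n) measure)"
  unfolding distr_Z[symmetric] by (rule prob_space_distr) simp

definition normalizer :: "real \<Rightarrow> real" where
  "normalizer a = (1 / sqrt (2 * pi)) ^ CARD('n) / a ^ CARD('n)"

lemma normalizer_pos: "a > 0 \<Longrightarrow> normalizer a > 0"
  by (simp add: normalizer_def)

lemma joint_law:
  assumes a: "a > 0"
  shows "distr M (borel \<Otimes>\<^sub>M borel) (\<lambda>\<omega>. (a *\<^sub>R Z \<omega> + b *\<^sub>R X1 \<omega>, X1 \<omega>)) =
    density (lborel \<Otimes>\<^sub>M \<nu>) (\<lambda>p. ennreal (normalizer a * kern a b (fst p) (snd p)))"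
proof (rule measure_eqI)
  interpret G: prob_space "gaussian 1 :: (real ^ 'n) measure" by (rule prob_space_gaussian_1)
  interpret GN: pair_sigma_finite "gaussian 1 :: (real ^ 'n) measure" \<nu> ..
  define g :: "real ^ 'n \<Rightarrow> real" where "g z = (1 / sqrt (2 * pi)) ^ CARD('n) * exp (- (norm z)\<^sup>2 / 2)" for z
  have g: "(gaussian 1 :: (real ^ 'n) measure) = density lborel (\<lambda>z. ennreal (g z))"
    using gaussian_density[of 1, where 'n='n] by (simp add: g_def)
  have [measurable]: "g \<in> borel_measurable borel" unfolding g_def[abs_def] by measurable
  have sG[measurable_cong]: "sets (gaussian 1 :: (real ^ 'n) measure) = sets borel" by (simp add: g)
  show "sets (distr M (borel \<Otimes>\<^sub>M borel) (\<lambda>\<omega>. (a *\<^sub>R Z \<omega> + b *\<^sub>R X1 \<omega>, X1 \<omega>))) =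
    sets (density (lborel \<Otimes>\<^sub>M \<nu>) (\<lambda>p. ennreal (normalizer a * kern a b (fst p) (snd p))))"
    by (simp cong: sets_pair_measure_cong)
  fix A assume "A \<in> sets (distr M (borel \<Otimes>\<^sub>M borel) (\<lambda>\<omega>. (a *\<^sub>R Z \<omega> + b *\<^sub>R X1 \<omega>, X1 \<omega>)))"
  then have A[measurable]: "A \<in> sets (borel \<Otimes>\<^sub>M borel)" by simp
  have A'[measurable]: "A \<in> sets (lborel \<Otimes>\<^sub>M \<nu>)" using A by (simp cong: sets_pair_measure_cong)
  have joint: "distr M (borel \<Otimes>\<^sub>M borel) (\<lambda>\<omega>. (Z \<omega>, X1 \<omega>)) = gaussian 1 \<Otimes>\<^sub>M \<nu>"
    using indep unfolding indep_var_distribution_eq by (simp add: distr_Z distr_X1)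
  have "emeasure (distr M (borel \<Otimes>\<^sub>M borel) (\<lambda>\<omega>. (a *\<^sub>R Z \<omega> + b *\<^sub>R X1 \<omega>, X1 \<omega>))) A
      = (\<integral>\<^sup>+p. indicator A p \<partial>distr M (borel \<Otimes>\<^sub>M borel) (\<lambda>\<omega>. (a *\<^sub>R Z \<omega> + b *\<^sub>R X1 \<omega>, X1 \<omega>)))"
    by simp
  also have "\<dots> = (\<integral>\<^sup>+\<omega>. indicator A (a *\<^sub>R Z \<omega> + b *\<^sub>R X1 \<omega>, X1 \<omega>) \<partial>M)"
    by (rule nn_integral_distr) measurable
  also have "\<dots> = (\<integral>\<^sup>+p. indicator A (a *\<^sub>R fst p + b *\<^sub>R snd p, snd p) \<partial>distr M (borel \<Otimes>\<^sub>M borel) (\<lambda>\<omega>. (Z \<omega>, X1 \<omega>)))"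
    by (subst nn_integral_distr) auto
  also have "\<dots> = (\<integral>\<^sup>+y. \<integral>\<^sup>+z. indicator A (a *\<^sub>R z + b *\<^sub>R y, y) \<partial>gaussian 1 \<partial>\<nu>)"
    unfolding joint by (subst GN.nn_integral_snd[symmetric]) auto
  also have "\<dots> = (\<integral>\<^sup>+y. \<integral>\<^sup>+x. ennreal (normalizer a * kern a b x y) * indicator A (x, y) \<partial>lborel \<partial>\<nu>)"
  proof (rule nn_integral_cong)
    fix y
    have "(\<integral>\<^sup>+x. ennreal (normalizer a * kern a b x y) * indicator A (x, y) \<partial>lborel)
       = ennreal (a ^ CARD('n)) * (\<integral>\<^sup>+z. ennreal (normalizer a * kern a b (b *\<^sub>R y + a *\<^sub>R z) y) * indicator A (b *\<^sub>R y + a *\<^sub>R z, y) \<partial>lborel)"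
      using a by (subst nn_integral_lborel_affine[of _ a "b *\<^sub>R y"]) auto
    also have "\<dots> = (\<integral>\<^sup>+z. ennreal (a ^ CARD('n)) * (ennreal (normalizer a * kern a b (b *\<^sub>R y + a *\<^sub>R z) y) * indicator A (b *\<^sub>R y + a *\<^sub>R z, y)) \<partial>lborel)"
      by (subst nn_integral_cmult) auto
    also have "\<dots> = (\<integral>\<^sup>+z. ennreal (g z) * indicator A (a *\<^sub>R z + b *\<^sub>R y, y) \<partial>lborel)"
    proof (rule nn_integral_cong)
      fix z
      have "a ^ CARD('n) * (normalizer a * kern a b (b *\<^sub>R y + a *\<^sub>R z) y) = g z"
        using a by (simp add: normalizer_def kern_def g_def power_mult_distrib)
      moreover have "0 \<le> normalizer a * kern a b (b *\<^sub>R y + a *\<^sub>R z) y"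
        using normalizer_pos[OF a] kern_pos[of a b "b *\<^sub>R y + a *\<^sub>R z" y] by (simp add: less_imp_le)
      ultimately have "ennreal (a ^ CARD('n)) * ennreal (normalizer a * kern a b (b *\<^sub>R y + a *\<^sub>R z) y) = ennreal (g z)"
        using a by (simp add: ennreal_mult[symmetric])
      then show "ennreal (a ^ CARD('n)) * (ennreal (normalizer a * kern a b (b *\<^sub>R y + a *\<^sub>R z) y) * indicator A (b *\<^sub>R y + a *\<^sub>R z, y))
         = ennreal (g z) * indicator A (a *\<^sub>R z + b *\<^sub>R y, y)"
        by (simp add: mult.assoc[symmetric] add.commute)
    qed
    also have "\<dots> = (\<integral>\<^sup>+z. indicator A (a *\<^sub>R z + b *\<^sub>R y, y) \<partial>gaussian 1)"
      unfolding g by (subst nn_integral_density) auto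
    finally show "(\<integral>\<^sup>+z. indicator A (a *\<^sub>R z + b *\<^sub>R y, y) \<partial>gaussian 1)
       = (\<integral>\<^sup>+x. ennreal (normalizer a * kern a b x y) * indicator A (x, y) \<partial>lborel)" by simp
  qed
  also have "\<dots> = (\<integral>\<^sup>+p. ennreal (normalizer a * kern a b (fst p) (snd p)) * indicator A p \<partial>(lborel \<Otimes>\<^sub>M \<nu>))"
    by (subst lborel_nu.nn_integral_snd[symmetric]) auto
  also have "\<dots> = emeasure (density (lborel \<Otimes>\<^sub>M \<nu>) (\<lambda>p. ennreal (normalizer a * kern a b (fst p) (snd p)))) A"
    by (subst emeasure_density) auto
  finally show "emeasure (distr M (borel \<Otimes>\<^sub>M borel) (\<lambda>\<omega>. (a *\<^sub>R Z \<omega> + b *\<^sub>R X1 \<omega>, X1 \<omega>))) A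
    = emeasure (density (lborel \<Otimes>\<^sub>M \<nu>) (\<lambda>p. ennreal (normalizer a * kern a b (fst p) (snd p)))) A" .
qed

lemma joint_integral:
  fixes f :: "real ^ 'n \<Rightarrow> real ^ 'n \<Rightarrow> real"
  assumes a: "a > 0" and [measurable]: "(\<lambda>(x, y). f x y) \<in> borel_measurable (borel \<Otimes>\<^sub>M borel)"
    and int: "integrable M (\<lambda>\<omega>. f (a *\<^sub>R Z \<omega> + b *\<^sub>R X1 \<omega>) (X1 \<omega>))"
  shows "expectation (\<lambda>\<omega>. f (a *\<^sub>R Z \<omega> + b *\<^sub>R X1 \<omega>) (X1 \<omega>)) =
     (\<integral>x. (\<integral>y. normalizer a * kern a b x y * f x y \<partial>\<nu>) \<partial>lborel)"
proof -
  let ?D = "distr M (borel \<Otimes>\<^sub>M borel) (\<lambda>\<omega>. (a *\<^sub>R Z \<omega> + b *\<^sub>R X1 \<omega>, X1 \<omega>))"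
  have [measurable]: "(\<lambda>(x, y). f x y) \<in> borel_measurable (lborel \<Otimes>\<^sub>M \<nu>)" by measurable
  have nn: "0 \<le> normalizer a * kern a b x y" for x y
    using normalizer_pos[OF a] kern_pos[of a b x y] by simp
  have "integrable ?D (\<lambda>(x, y). f x y)"
    using int by (subst integrable_distr_eq) (auto simp: split_beta)
  then have "integrable (lborel \<Otimes>\<^sub>M \<nu>) (\<lambda>p. (normalizer a * kern a b (fst p) (snd p)) *\<^sub>R (case p of (x, y) \<Rightarrow> f x y))"
    unfolding joint_law[OF a] by (subst (asm) integrable_density) (auto simp: nn split_beta)
  then have i: "integrable (lborel \<Otimes>\<^sub>M \<nu>) (\<lambda>(x, y). normalizer a * kern a b x y * f x y)"
    by (simp add: case_prod_unfold)
  have "expectation (\<lambda>\<omega>. f (a *\<^sub>R Z \<omega> + b *\<^sub>R X1 \<omega>) (X1 \<omega>)) = (\<integral>p. (case p of (x, y) \<Rightarrow> f x y) \<partial>?D)"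
    by (subst integral_distr) auto
  also have "\<dots> = (\<integral>p. (normalizer a * kern a b (fst p) (snd p)) *\<^sub>R (case p of (x, y) \<Rightarrow> f x y) \<partial>(lborel \<Otimes>\<^sub>M \<nu>))"
    unfolding joint_law[OF a] by (subst integral_density[symmetric]) (auto simp: nn split_beta)
  also have "\<dots> = (\<integral>p. (case p of (x, y) \<Rightarrow> normalizer a * kern a b x y * f x y) \<partial>(lborel \<Otimes>\<^sub>M \<nu>))"
    by (simp add: split_beta)
  also have "\<dots> = (\<integral>x. (\<integral>y. normalizer a * kern a b x y * f x y \<partial>\<nu>) \<partial>lborel)"
    using lborel_nu.integral_fst'[OF i] by simp
  finally show ?thesis .
qed

lemma integrable_exp_neg_square:
  assumes c: "c > 0"
  shows "integrable lborel (\<lambda>u :: real ^ 'n. exp (- c * (norm u)\<^sup>2))"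
proof -
  interpret G: prob_space "gaussian 1 :: (real ^ 'n) measure" by (rule prob_space_gaussian_1)
  define C where "C = (1 / sqrt (2 * pi)) ^ CARD('n)"
  have C: "C > 0" by (simp add: C_def)
  have "(\<integral>\<^sup>+x. ennreal (C * exp (- (norm x)\<^sup>2 / 2)) \<partial>(lborel :: (real ^ 'n) measure)) = emeasure (gaussian 1 :: (real ^ 'n) measure) UNIV"
    using gaussian_density[of 1, where 'n='n] by (simp add: C_def emeasure_density)
  also have "\<dots> < \<infinity>" using G.emeasure_finite[of UNIV] by (simp add: less_top[symmetric])
  finally have "integrable lborel (\<lambda>x :: real ^ 'n. C * exp (- (norm x)\<^sup>2 / 2))"
    using C by (intro integrableI_bounded) (auto simp: abs_mult)
  then have i: "integrable lborel (\<lambda>x :: real ^ 'n. exp (- (norm x)\<^sup>2 / 2))" using C by simp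
  define s where "s = sqrt (2 * c)"
  have s: "s > 0" "s\<^sup>2 = 2 * c" using c by (auto simp: s_def)
  have e: "exp (- c * (norm u)\<^sup>2) = exp (- (norm (0 + s *\<^sub>R u))\<^sup>2 / 2)" for u :: "real ^ 'n"
    by (simp add: power_mult_distrib s(2))
  have "(\<integral>\<^sup>+x. ennreal (exp (- (norm x)\<^sup>2 / 2)) \<partial>(lborel :: (real ^ 'n) measure)) < \<infinity>"
    using i unfolding integrable_iff_bounded by simp
  then have "(\<integral>\<^sup>+u. ennreal (exp (- c * (norm u)\<^sup>2)) \<partial>(lborel :: (real ^ 'n) measure)) < \<infinity>"
    unfolding e using s(1)
    by (subst (asm) nn_integral_lborel_affine[of _ s 0]) (auto simp: ennreal_mult_less_top)
  then show ?thesis by (intro integrableI_bounded) auto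
qed

lemma square_integrable_Z: "integrable M (\<lambda>\<omega>. (norm (Z \<omega>))\<^sup>2)"
proof -
  have "integrable lborel (\<lambda>z :: real ^ 'n. ((1 / sqrt (2 * pi)) ^ CARD('n) * exp (- (norm z)\<^sup>2 / 2)) *\<^sub>R (norm z)\<^sup>2)"
  proof (rule Bochner_Integration.integrable_bound[OF integrable_mult_right[OF integrable_exp_neg_square[of "1/4"], of "4 * (1 / sqrt (2 * pi)) ^ CARD('n)"]])
    show "AE z in lborel. norm (((1 / sqrt (2 * pi)) ^ CARD('n) * exp (- (norm z)\<^sup>2 / 2)) *\<^sub>R (norm z)\<^sup>2) \<le> norm (4 * (1 / sqrt (2 * pi)) ^ CARD('n) * exp (- (1/4) * (norm (z :: real ^ 'n))\<^sup>2))"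
    proof (rule AE_I2)
      fix z :: "real ^ 'n"
      have "(norm z)\<^sup>2 / 4 \<le> exp ((norm z)\<^sup>2 / 4)" using exp_ge_add_one_self[of "(norm z)\<^sup>2 / 4"] by linarith
      then have "exp (- (norm z)\<^sup>2 / 2) * ((norm z)\<^sup>2 / 4) \<le> exp (- (norm z)\<^sup>2 / 2) * exp ((norm z)\<^sup>2 / 4)"
        by (intro mult_left_mono) auto
      also have "\<dots> = exp (- (1/4) * (norm z)\<^sup>2)" by (simp add: exp_add[symmetric] algebra_simps)
      finally have "(1 / sqrt (2 * pi)) ^ CARD('n) * (exp (- (norm z)\<^sup>2 / 2) * (norm z)\<^sup>2) \<le> (1 / sqrt (2 * pi)) ^ CARD('n) * (4 * exp (- (1/4) * (norm z)\<^sup>2))"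
        by (intro mult_left_mono) auto
      then show "norm (((1 / sqrt (2 * pi)) ^ CARD('n) * exp (- (norm z)\<^sup>2 / 2)) *\<^sub>R (norm z)\<^sup>2) \<le> norm (4 * (1 / sqrt (2 * pi)) ^ CARD('n) * exp (- (1/4) * (norm z)\<^sup>2))"
        by (simp add: abs_mult mult_ac)
    qed
  qed auto
  then have "integrable (gaussian 1) (\<lambda>z :: real ^ 'n. (norm z)\<^sup>2)"
    using gaussian_density[of 1, where 'n='n] by (simp add: integrable_density)
  then have "integrable (distr M borel Z) (\<lambda>z. (norm z)\<^sup>2)" by (simp add: distr_Z)
  then show ?thesis by (subst (asm) integrable_distr_eq) auto
qed

lemma square_integrable_X1: "integrable M (\<lambda>\<omega>. (norm (X1 \<omega>))\<^sup>2)"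
proof -
  have "integrable (distr M borel X1) (\<lambda>z. (norm z)\<^sup>2)" by (simp add: distr_X1 second_moment)
  then show ?thesis by (subst (asm) integrable_distr_eq) auto
qed

lemma square_integrable_bound: "integrable M (\<lambda>\<omega>. (1 + norm (Z \<omega>) + norm (X1 \<omega>))\<^sup>2)"
proof (rule Bochner_Integration.integrable_bound)
  show "integrable M (\<lambda>\<omega>. 3 * (1 + (norm (Z \<omega>))\<^sup>2 + (norm (X1 \<omega>))\<^sup>2))"
    using square_integrable_Z square_integrable_X1 by simp
  have "(1 + p + q)\<^sup>2 \<le> 3 * (1 + p\<^sup>2 + q\<^sup>2)" for p q :: real
  proof -
    have "0 \<le> (1 - p)\<^sup>2 + (1 - q)\<^sup>2 + (p - q)\<^sup>2" by simp
    then show ?thesis by (simp add: power2_eq_square algebra_simps)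
  qed
  then show "AE \<omega> in M. norm ((1 + norm (Z \<omega>) + norm (X1 \<omega>))\<^sup>2) \<le> norm (3 * (1 + (norm (Z \<omega>))\<^sup>2 + (norm (X1 \<omega>))\<^sup>2))"
    by (intro AE_I2) simp
qed auto

lemma integrable_linear_bound:
  assumes [measurable]: "f \<in> borel_measurable M" and "\<And>\<omega>. \<bar>f \<omega>\<bar> \<le> C * (1 + norm (Z \<omega>) + norm (X1 \<omega>))"
  shows "integrable M (f :: 'w \<Rightarrow> real)"
proof (rule Bochner_Integration.integrable_bound)
  show "integrable M (\<lambda>\<omega>. \<bar>C\<bar> * (1 + norm (Z \<omega>) + norm (X1 \<omega>))\<^sup>2)"
    using square_integrable_bound by simp
  have "\<bar>f \<omega>\<bar> \<le> \<bar>C\<bar> * (1 + norm (Z \<omega>) + norm (X1 \<omega>))\<^sup>2" for \<omega>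
  proof -
    let ?q = "1 + norm (Z \<omega>) + norm (X1 \<omega>)"
    have "C * ?q \<le> \<bar>C\<bar> * ?q" by (intro mult_right_mono) auto
    also have "\<dots> \<le> \<bar>C\<bar> * ?q\<^sup>2" by (intro mult_left_mono self_le_power) auto
    finally show ?thesis using assms(2)[of \<omega>] by linarith
  qed
  then show "AE \<omega> in M. norm (f \<omega>) \<le> norm (\<bar>C\<bar> * (1 + norm (Z \<omega>) + norm (X1 \<omega>))\<^sup>2)"
    by (intro AE_I2) (simp add: abs_mult)
qed simp

end

context gaussian_pair begin

lemma integrable_nu_norm: "integrable \<nu> norm"
proof (rule Bochner_Integration.integrable_bound)
  show "integrable \<nu> (\<lambda>x. 1 + (norm x)\<^sup>2)" using second_moment by simp
  have "norm x \<le> 1 + (norm x)\<^sup>2" for x :: "real ^ 'n"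
  proof -
    have "2 * norm x \<le> 1 + (norm x)\<^sup>2" using zero_le_power2[of "norm x - 1"] by (simp add: power2_diff)
    then show ?thesis using norm_ge_zero[of x] by linarith
  qed
  then show "AE x in \<nu>. norm (norm x) \<le> norm (1 + (norm x)\<^sup>2)" by (intro AE_I2) simp
qed simp

lemma integrable_kern: "integrable \<nu> (\<lambda>y. kern a b x y)"
  by (rule nu.integrable_const_bound[where B=1]) (auto simp: kern_le_1 less_imp_le[OF kern_pos])

lemma integral_kern_pos: "0 < (\<integral>y. kern a b x y \<partial>\<nu>)"
  by (rule integral_pos[OF integrable_kern kern_pos]) (use nu.emeasure_space_1 in simp)

lemma integrable_kern_growth:
  fixes f :: "real ^ 'n \<Rightarrow> 'b::euclidean_space"
  assumes [measurable]: "f \<in> borel_measurable borel" and f: "\<And>y. norm (f y) \<le> C * (1 + norm y)"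
  shows "integrable \<nu> (\<lambda>y. kern a b x y *\<^sub>R f y)"
proof (rule Bochner_Integration.integrable_bound)
  show "integrable \<nu> (\<lambda>y. C * (1 + norm y))" using integrable_nu_norm by simp
  have "norm (kern a b x y *\<^sub>R f y) \<le> norm (C * (1 + norm y))" for y
  proof -
    have "kern a b x y * norm (f y) \<le> 1 * norm (f y)" by (intro mult_right_mono kern_le_1) auto
    then show ?thesis using f[of y] kern_pos[of a b x y] by simp
  qed
  then show "AE y in \<nu>. norm (kern a b x y *\<^sub>R f y) \<le> norm (C * (1 + norm y))" by simp
qed simp

lemma integrable_kern_id: "integrable \<nu> (\<lambda>y. kern a b x y *\<^sub>R y)"
  by (rule integrable_kern_growth[where C=1]) auto

lemma kern_mean_orthogonal:
  assumes a: "a > 0" and m: "kern_mean \<nu> a b \<in> borel_measurable borel" "\<And>x. norm (kern_mean \<nu> a b x) \<le> C * (1 + norm x)"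
    and p[measurable]: "p \<in> borel_measurable borel" and pb: "\<And>x. norm (p x) \<le> B"
  shows "integrable M (\<lambda>\<omega>. p (a *\<^sub>R Z \<omega> + b *\<^sub>R X1 \<omega>) \<bullet> X1 \<omega>)"
    "integrable M (\<lambda>\<omega>. p (a *\<^sub>R Z \<omega> + b *\<^sub>R X1 \<omega>) \<bullet> kern_mean \<nu> a b (a *\<^sub>R Z \<omega> + b *\<^sub>R X1 \<omega>))"
    "expectation (\<lambda>\<omega>. p (a *\<^sub>R Z \<omega> + b *\<^sub>R X1 \<omega>) \<bullet> X1 \<omega>) =
     expectation (\<lambda>\<omega>. p (a *\<^sub>R Z \<omega> + b *\<^sub>R X1 \<omega>) \<bullet> kern_mean \<nu> a b (a *\<^sub>R Z \<omega> + b *\<^sub>R X1 \<omega>))"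
proof -
  note [measurable] = m(1)
  let ?q = "\<lambda>\<omega>. 1 + norm (Z \<omega>) + norm (X1 \<omega>)"
  have B: "0 \<le> B" using pb[of 0] norm_ge_zero[of "p 0"] by linarith
  have C: "0 \<le> C" using m(2)[of 0] norm_ge_zero[of "kern_mean \<nu> a b 0"] by (simp del: norm_ge_zero)
  have pi: "\<bar>p x \<bullet> y\<bar> \<le> B * norm y" for x y
    by (rule order_trans[OF Cauchy_Schwarz_ineq2]) (intro mult_right_mono pb norm_ge_zero)
  show i1: "integrable M (\<lambda>\<omega>. p (a *\<^sub>R Z \<omega> + b *\<^sub>R X1 \<omega>) \<bullet> X1 \<omega>)"
  proof (rule integrable_linear_bound[where C=B])
    show "\<bar>p (a *\<^sub>R Z \<omega> + b *\<^sub>R X1 \<omega>) \<bullet> X1 \<omega>\<bar> \<le> B * ?q \<omega>" for \<omega>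
      by (rule order_trans[OF pi]) (intro mult_left_mono B, auto)
  qed simp
  show i2: "integrable M (\<lambda>\<omega>. p (a *\<^sub>R Z \<omega> + b *\<^sub>R X1 \<omega>) \<bullet> kern_mean \<nu> a b (a *\<^sub>R Z \<omega> + b *\<^sub>R X1 \<omega>))"
  proof (rule integrable_linear_bound[where C="B * (C * (1 + \<bar>a\<bar> + \<bar>b\<bar>))"])
    fix \<omega>
    have "norm (a *\<^sub>R Z \<omega> + b *\<^sub>R X1 \<omega>) \<le> \<bar>a\<bar> * norm (Z \<omega>) + \<bar>b\<bar> * norm (X1 \<omega>)"
      using norm_triangle_ineq[of "a *\<^sub>R Z \<omega>" "b *\<^sub>R X1 \<omega>"] by simp
    moreover have "1 + \<bar>a\<bar> * norm (Z \<omega>) + \<bar>b\<bar> * norm (X1 \<omega>) \<le> (1 + \<bar>a\<bar> + \<bar>b\<bar>) * ?q \<omega>"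
      by (simp add: algebra_simps)
    ultimately have "1 + norm (a *\<^sub>R Z \<omega> + b *\<^sub>R X1 \<omega>) \<le> (1 + \<bar>a\<bar> + \<bar>b\<bar>) * ?q \<omega>" by linarith
    then have "C * (1 + norm (a *\<^sub>R Z \<omega> + b *\<^sub>R X1 \<omega>)) \<le> C * ((1 + \<bar>a\<bar> + \<bar>b\<bar>) * ?q \<omega>)"
      using C by (rule mult_left_mono)
    then have "norm (kern_mean \<nu> a b (a *\<^sub>R Z \<omega> + b *\<^sub>R X1 \<omega>)) \<le> C * ((1 + \<bar>a\<bar> + \<bar>b\<bar>) * ?q \<omega>)"
      using m(2) order_trans by blast
    then have "B * norm (kern_mean \<nu> a b (a *\<^sub>R Z \<omega> + b *\<^sub>R X1 \<omega>)) \<le> B * (C * ((1 + \<bar>a\<bar> + \<bar>b\<bar>) * ?q \<omega>))"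
      using B by (rule mult_left_mono)
    then show "\<bar>p (a *\<^sub>R Z \<omega> + b *\<^sub>R X1 \<omega>) \<bullet> kern_mean \<nu> a b (a *\<^sub>R Z \<omega> + b *\<^sub>R X1 \<omega>)\<bar> \<le> B * (C * (1 + \<bar>a\<bar> + \<bar>b\<bar>)) * ?q \<omega>"
      using pi[of "a *\<^sub>R Z \<omega> + b *\<^sub>R X1 \<omega>" "kern_mean \<nu> a b (a *\<^sub>R Z \<omega> + b *\<^sub>R X1 \<omega>)"] by (simp only: mult.assoc)
  qed simp
  have "expectation (\<lambda>\<omega>. p (a *\<^sub>R Z \<omega> + b *\<^sub>R X1 \<omega>) \<bullet> X1 \<omega>) =
      (\<integral>x. (\<integral>y. normalizer a * kern a b x y * (p x \<bullet> y) \<partial>\<nu>) \<partial>lborel)"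
    by (rule joint_integral[OF a, where f="\<lambda>x y. p x \<bullet> y"]) (use i1 in auto)
  also have "\<dots> = (\<integral>x. (\<integral>y. normalizer a * kern a b x y * (p x \<bullet> kern_mean \<nu> a b x) \<partial>\<nu>) \<partial>lborel)"
  proof (rule Bochner_Integration.integral_cong[OF refl])
    fix x
    have "(\<integral>y. normalizer a * kern a b x y * (p x \<bullet> y) \<partial>\<nu>) = (\<integral>y. normalizer a * (p x \<bullet> (kern a b x y *\<^sub>R y)) \<partial>\<nu>)"
      by (simp add: mult.assoc)
    also have "\<dots> = normalizer a * (p x \<bullet> (\<integral>y. kern a b x y *\<^sub>R y \<partial>\<nu>))"
      using integrable_kern_id by (subst integral_mult_right_zero) (simp only: integral_inner_right)
    also have "(\<integral>y. kern a b x y *\<^sub>R y \<partial>\<nu>) = (\<integral>y. kern a b x y \<partial>\<nu>) *\<^sub>R kern_mean \<nu> a b x"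
      using integral_kern_pos[of a b x] by (simp add: kern_mean_def)
    also have "normalizer a * (p x \<bullet> ((\<integral>y. kern a b x y \<partial>\<nu>) *\<^sub>R kern_mean \<nu> a b x)) = (\<integral>y. normalizer a * kern a b x y * (p x \<bullet> kern_mean \<nu> a b x) \<partial>\<nu>)"
      by simp
    finally show "(\<integral>y. normalizer a * kern a b x y * (p x \<bullet> y) \<partial>\<nu>) = (\<integral>y. normalizer a * kern a b x y * (p x \<bullet> kern_mean \<nu> a b x) \<partial>\<nu>)" .
  qed
  also have "\<dots> = expectation (\<lambda>\<omega>. p (a *\<^sub>R Z \<omega> + b *\<^sub>R X1 \<omega>) \<bullet> kern_mean \<nu> a b (a *\<^sub>R Z \<omega> + b *\<^sub>R X1 \<omega>))"
    by (rule joint_integral[OF a, where f="\<lambda>x y. p x \<bullet> kern_mean \<nu> a b x", symmetric]) (use i2 in auto)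
  finally show "expectation (\<lambda>\<omega>. p (a *\<^sub>R Z \<omega> + b *\<^sub>R X1 \<omega>) \<bullet> X1 \<omega>) =
     expectation (\<lambda>\<omega>. p (a *\<^sub>R Z \<omega> + b *\<^sub>R X1 \<omega>) \<bullet> kern_mean \<nu> a b (a *\<^sub>R Z \<omega> + b *\<^sub>R X1 \<omega>))" .
qed

definition cond_velocity :: "real \<Rightarrow> real \<Rightarrow> real \<Rightarrow> real \<Rightarrow> real ^ 'n \<Rightarrow> real ^ 'n" where
  "cond_velocity a b a' b' x = (a' / a) *\<^sub>R (x - b *\<^sub>R kern_mean \<nu> a b x) + b' *\<^sub>R kern_mean \<nu> a b x"

lemma cond_velocity_orthogonal:
  assumes a: "a > 0" and m: "kern_mean \<nu> a b \<in> borel_measurable borel" "\<And>x. norm (kern_mean \<nu> a b x) \<le> C * (1 + norm x)"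
    and p[measurable]: "p \<in> borel_measurable borel" and pb: "\<And>x. norm (p x) \<le> B"
  shows "integrable M (\<lambda>\<omega>. p (a *\<^sub>R Z \<omega> + b *\<^sub>R X1 \<omega>) \<bullet> (a' *\<^sub>R Z \<omega> + b' *\<^sub>R X1 \<omega>))"
    "integrable M (\<lambda>\<omega>. p (a *\<^sub>R Z \<omega> + b *\<^sub>R X1 \<omega>) \<bullet> cond_velocity a b a' b' (a *\<^sub>R Z \<omega> + b *\<^sub>R X1 \<omega>))"
    "expectation (\<lambda>\<omega>. p (a *\<^sub>R Z \<omega> + b *\<^sub>R X1 \<omega>) \<bullet> (a' *\<^sub>R Z \<omega> + b' *\<^sub>R X1 \<omega>)) =
     expectation (\<lambda>\<omega>. p (a *\<^sub>R Z \<omega> + b *\<^sub>R X1 \<omega>) \<bullet> cond_velocity a b a' b' (a *\<^sub>R Z \<omega> + b *\<^sub>R X1 \<omega>))"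
proof -
  note o = kern_mean_orthogonal[OF assms]
  define X where "X \<omega> = a *\<^sub>R Z \<omega> + b *\<^sub>R X1 \<omega>" for \<omega>
  have [measurable]: "X \<in> borel_measurable M" unfolding X_def[abs_def] by measurable
  have B: "0 \<le> B" using pb[of 0] norm_ge_zero[of "p 0"] by linarith
  have iX: "integrable M (\<lambda>\<omega>. p (X \<omega>) \<bullet> X \<omega>)"
  proof (rule integrable_linear_bound[where C="B * (\<bar>a\<bar> + \<bar>b\<bar>)"])
    fix \<omega>
    have "norm (X \<omega>) \<le> \<bar>a\<bar> * norm (Z \<omega>) + \<bar>b\<bar> * norm (X1 \<omega>)"
      using norm_triangle_ineq[of "a *\<^sub>R Z \<omega>" "b *\<^sub>R X1 \<omega>"] by (simp add: X_def)
    also have "\<dots> \<le> (\<bar>a\<bar> + \<bar>b\<bar>) * (1 + norm (Z \<omega>) + norm (X1 \<omega>))" by (simp add: algebra_simps)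
    finally have "B * norm (X \<omega>) \<le> B * ((\<bar>a\<bar> + \<bar>b\<bar>) * (1 + norm (Z \<omega>) + norm (X1 \<omega>)))" using B by (rule mult_left_mono)
    moreover have "\<bar>p (X \<omega>) \<bullet> X \<omega>\<bar> \<le> B * norm (X \<omega>)"
      by (rule order_trans[OF Cauchy_Schwarz_ineq2]) (intro mult_right_mono pb norm_ge_zero)
    ultimately show "\<bar>p (X \<omega>) \<bullet> X \<omega>\<bar> \<le> B * (\<bar>a\<bar> + \<bar>b\<bar>) * (1 + norm (Z \<omega>) + norm (X1 \<omega>))" by (simp only: mult.assoc)
  qed measurable
  note o = o[folded X_def]
  have e1: "p (X \<omega>) \<bullet> (a' *\<^sub>R Z \<omega> + b' *\<^sub>R X1 \<omega>) = (a' / a) * (p (X \<omega>) \<bullet> X \<omega>) + (b' - a' / a * b) * (p (X \<omega>) \<bullet> X1 \<omega>)" for \<omega>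
  proof -
    have "a' *\<^sub>R Z \<omega> + b' *\<^sub>R X1 \<omega> = (a' / a) *\<^sub>R X \<omega> + (b' - a' / a * b) *\<^sub>R X1 \<omega>"
      using a by (simp add: X_def algebra_simps)
    then show ?thesis by (simp only: inner_add_right inner_scaleR_right)
  qed
  have e2: "p (X \<omega>) \<bullet> cond_velocity a b a' b' (X \<omega>) = (a' / a) * (p (X \<omega>) \<bullet> X \<omega>) + (b' - a' / a * b) * (p (X \<omega>) \<bullet> kern_mean \<nu> a b (X \<omega>))" for \<omega>
    by (simp add: cond_velocity_def inner_add_right inner_diff_right algebra_simps)
  show "integrable M (\<lambda>\<omega>. p (a *\<^sub>R Z \<omega> + b *\<^sub>R X1 \<omega>) \<bullet> (a' *\<^sub>R Z \<omega> + b' *\<^sub>R X1 \<omega>))"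
    unfolding X_def[symmetric] e1 using iX o by simp
  show "integrable M (\<lambda>\<omega>. p (a *\<^sub>R Z \<omega> + b *\<^sub>R X1 \<omega>) \<bullet> cond_velocity a b a' b' (a *\<^sub>R Z \<omega> + b *\<^sub>R X1 \<omega>))"
    unfolding X_def[symmetric] e2 using iX o by simp
  show "expectation (\<lambda>\<omega>. p (a *\<^sub>R Z \<omega> + b *\<^sub>R X1 \<omega>) \<bullet> (a' *\<^sub>R Z \<omega> + b' *\<^sub>R X1 \<omega>)) =
     expectation (\<lambda>\<omega>. p (a *\<^sub>R Z \<omega> + b *\<^sub>R X1 \<omega>) \<bullet> cond_velocity a b a' b' (a *\<^sub>R Z \<omega> + b *\<^sub>R X1 \<omega>))"
    unfolding X_def[symmetric] e1 e2 using iX o by simp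
qed

lemma interpolant_charges_open:
  assumes a: "a > 0" and U: "open U" "U \<noteq> {}"
    and null: "AE \<omega> in M. a *\<^sub>R Z \<omega> + b *\<^sub>R X1 \<omega> \<notin> U"
  shows False
proof -
  let ?D = "distr M (borel \<Otimes>\<^sub>M borel) (\<lambda>\<omega>. (a *\<^sub>R Z \<omega> + b *\<^sub>R X1 \<omega>, X1 \<omega>))"
  have [measurable]: "U \<in> sets borel" using U by simp
  have pred[measurable]: "Measurable.pred (borel \<Otimes>\<^sub>M borel) (\<lambda>p :: (real ^ 'n) \<times> (real ^ 'n). fst p \<notin> U)" by measurable
  have "AE p in ?D. fst p \<notin> U" using null by (subst AE_distr_iff) auto
  then have "AE p in lborel \<Otimes>\<^sub>M \<nu>. 0 < ennreal (normalizer a * kern a b (fst p) (snd p)) \<longrightarrow> fst p \<notin> U"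
    unfolding joint_law[OF a] by (subst (asm) AE_density) auto
  then have "AE p in lborel \<Otimes>\<^sub>M \<nu>. fst p \<notin> U"
  proof eventually_elim
    case (elim p)
    have "0 < normalizer a * kern a b (fst p) (snd p)" by (intro mult_pos_pos normalizer_pos a kern_pos)
    then show ?case using elim by simp
  qed
  then have "AE x in lborel. AE y in \<nu>. fst (x, y) \<notin> U"
    by (rule lborel_nu.AE_pair)
  then have "AE x in lborel. x \<notin> U" by simp
  then have "emeasure lborel U = 0" by (subst (asm) AE_iff_measurable[of U]) auto
  then show False using U open_not_negligible[of U] by (simp add: negligible_iff_emeasure0)
qed

lemma cond_exp_given_eq:
  assumes a: "a > 0" and m: "continuous_on UNIV (kern_mean \<nu> a b)" "\<And>x. norm (kern_mean \<nu> a b x) \<le> C * (1 + norm x)"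
  shows "cond_exp_given M (\<lambda>\<omega>. a' *\<^sub>R Z \<omega> + b' *\<^sub>R X1 \<omega>) (\<lambda>\<omega>. a *\<^sub>R Z \<omega> + b *\<^sub>R X1 \<omega>) = cond_velocity a b a' b'"
proof -
  define X where "X \<omega> = a *\<^sub>R Z \<omega> + b *\<^sub>R X1 \<omega>" for \<omega>
  define Y where "Y \<omega> = a' *\<^sub>R Z \<omega> + b' *\<^sub>R X1 \<omega>" for \<omega>
  define w where "w = cond_velocity a b a' b'"
  have Xm[measurable]: "X \<in> borel_measurable M" unfolding X_def[abs_def] by measurable
  have [measurable]: "Y \<in> borel_measurable M" unfolding Y_def[abs_def] by measurable
  have wc: "continuous_on UNIV w" unfolding w_def cond_velocity_def by (intro continuous_intros m(1))
  then have wm[measurable]: "w \<in> borel_measurable borel" by (rule borel_measurable_continuous_onI)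
  have mm: "kern_mean \<nu> a b \<in> borel_measurable borel" by (rule borel_measurable_continuous_onI[OF m(1)])
  note o = cond_velocity_orthogonal[OF a mm m(2), of _ _ a' b', folded X_def Y_def w_def]
  let ?F = "vimage_algebra (space M) X borel"
  have sub: "subalgebra M ?F"
    unfolding subalgebra_def using measurable_sets[OF Xm] by (auto simp: sets_vimage_algebra2)
  interpret F: finite_measure_subalgebra M ?F by unfold_locales (rule sub)
  have XF: "X \<in> borel_measurable ?F" by (rule measurable_vimage_algebra1) auto
  have good: "AE \<omega> in M. w (X \<omega>) $ i = real_cond_exp M ?F (\<lambda>\<omega>. Y \<omega> $ i) \<omega>" for i
  proof -
    have "AE \<omega> in M. real_cond_exp M ?F (\<lambda>\<omega>. Y \<omega> $ i) \<omega> = w (X \<omega>) $ i"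
    proof (rule F.real_cond_exp_charact)
      fix A assume "A \<in> sets ?F"
      then obtain S where S: "S \<in> sets borel" "A = X -` S \<inter> space M" by (auto simp: sets_vimage_algebra2)
      note [measurable] = S(1)
      define p where "p x = indicator S x *\<^sub>R (axis i 1 :: real ^ 'n)" for x
      have [measurable]: "p \<in> borel_measurable borel" unfolding p_def[abs_def] by measurable
      have pb: "norm (p x) \<le> 1" for x by (auto simp: p_def indicator_def)
      have "(\<integral>\<omega>\<in>A. Y \<omega> $ i \<partial>M) = expectation (\<lambda>\<omega>. p (X \<omega>) \<bullet> Y \<omega>)"
        unfolding set_lebesgue_integral_def
        by (intro Bochner_Integration.integral_cong) (auto simp: p_def S(2) inner_axis' indicator_def)
      also have "\<dots> = expectation (\<lambda>\<omega>. p (X \<omega>) \<bullet> w (X \<omega>))" by (rule o(3)[OF _ pb]) measurable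
      also have "\<dots> = (\<integral>\<omega>\<in>A. w (X \<omega>) $ i \<partial>M)"
        unfolding set_lebesgue_integral_def
        by (intro Bochner_Integration.integral_cong) (auto simp: p_def S(2) inner_axis' indicator_def)
      finally show "(\<integral>\<omega>\<in>A. Y \<omega> $ i \<partial>M) = (\<integral>\<omega>\<in>A. w (X \<omega>) $ i \<partial>M)" .
    next
      have "integrable M (\<lambda>\<omega>. (axis i 1 :: real ^ 'n) \<bullet> Y \<omega>)"
        by (rule o(1)[of "\<lambda>_. axis i 1" 1]) auto
      then show "integrable M (\<lambda>\<omega>. Y \<omega> $ i)" by (simp add: inner_axis')
      have "integrable M (\<lambda>\<omega>. (axis i 1 :: real ^ 'n) \<bullet> w (X \<omega>))"
        by (rule o(2)[of "\<lambda>_. axis i 1" 1]) auto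
      then show "integrable M (\<lambda>\<omega>. w (X \<omega>) $ i)" by (simp add: inner_axis')
      show "(\<lambda>\<omega>. w (X \<omega>) $ i) \<in> borel_measurable ?F"
        by (rule measurable_compose[OF XF borel_measurable_continuous_onI]) (intro continuous_intros wc)
    qed
    then show ?thesis by eventually_elim simp
  qed
  have uniq: "u = w" if u: "continuous_on UNIV u" "\<forall>i. AE \<omega> in M. u (X \<omega>) $ i = real_cond_exp M ?F (\<lambda>\<omega>. Y \<omega> $ i) \<omega>" for u
  proof -
    have "AE \<omega> in M. \<forall>i\<in>UNIV. u (X \<omega>) $ i = w (X \<omega>) $ i"
    proof (rule AE_finite_allI)
      fix i
      have "AE \<omega> in M. u (X \<omega>) $ i = real_cond_exp M ?F (\<lambda>\<omega>. Y \<omega> $ i) \<omega>" using u(2) by blast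
      then show "AE \<omega> in M. u (X \<omega>) $ i = w (X \<omega>) $ i" using good[of i] by eventually_elim simp
    qed simp
    then have "AE \<omega> in M. X \<omega> \<notin> {x. u x \<noteq> w x}" by eventually_elim (simp add: vec_eq_iff)
    moreover have "open {x. u x \<noteq> w x}" by (intro open_Collect_neq u wc)
    ultimately have "{x. u x \<noteq> w x} = {}" using interpolant_charges_open[OF a] unfolding X_def by blast
    then show ?thesis by auto
  qed
  have "(THE m. continuous_on UNIV m \<and> (\<forall>i. AE \<omega> in M. m (X \<omega>) $ i = real_cond_exp M ?F (\<lambda>\<omega>. Y \<omega> $ i) \<omega>)) = w"
  proof (rule the_equality)
    show "continuous_on UNIV w \<and> (\<forall>i. AE \<omega> in M. w (X \<omega>) $ i = real_cond_exp M ?F (\<lambda>\<omega>. Y \<omega> $ i) \<omega>)"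
      using wc good by blast
    show "u = w" if "continuous_on UNIV u \<and> (\<forall>i. AE \<omega> in M. u (X \<omega>) $ i = real_cond_exp M ?F (\<lambda>\<omega>. Y \<omega> $ i) \<omega>)" for u
      using that uniq by blast
  qed
  then have "cond_exp_given M Y X = w" by (simp only: cond_exp_given_def)
  moreover have "(\<lambda>\<omega>. a' *\<^sub>R Z \<omega> + b' *\<^sub>R X1 \<omega>) = Y" "(\<lambda>\<omega>. a *\<^sub>R Z \<omega> + b *\<^sub>R X1 \<omega>) = X"
    by (simp_all add: fun_eq_iff X_def Y_def)
  ultimately show ?thesis by (simp only: w_def)
qed

end

section \<open>From Lipschitz bounds to the flow and its law\<close>

lemma continuous_on_integral_dominated:
  fixes f :: "'t::metric_space \<Rightarrow> 'a \<Rightarrow> 'b::euclidean_space"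
  assumes m: "\<And>t. t \<in> S \<Longrightarrow> f t \<in> borel_measurable N" and g: "integrable N g"
    and b: "\<And>t y. t \<in> S \<Longrightarrow> norm (f t y) \<le> g y" and c: "\<And>y. continuous_on S (\<lambda>t. f t y)"
  shows "continuous_on S (\<lambda>t. \<integral>y. f t y \<partial>N)"
  unfolding continuous_on_sequentially
proof (intro ballI allI impI)
  fix t s assume t: "t \<in> S" and s: "(\<forall>n. s n \<in> S) \<and> s \<longlonglongrightarrow> t"
  have "(\<lambda>n. f (s n) y) \<longlonglongrightarrow> f t y" for y
    using c[of y] t s unfolding continuous_on_sequentially by (auto simp: o_def)
  then show "((\<lambda>t. \<integral>y. f t y \<partial>N) \<circ> s) \<longlonglongrightarrow> (\<integral>y. f t y \<partial>N)"
    unfolding o_def using m t s b g by (intro integral_dominated_convergence[where w=g]) auto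
qed

lemma kern_continuous_on:
  assumes "continuous_on S a" "continuous_on S b" "\<And>t. t \<in> S \<Longrightarrow> a t \<noteq> 0"
  shows "continuous_on S (\<lambda>t. kern (a t) (b t) x y)"
  unfolding kern_def using assms by (intro continuous_intros) auto

lemma kern_mean_continuous_on:
  fixes N :: "'a::euclidean_space measure"
  assumes "prob_space N" and sets: "sets N = sets borel" and int: "integrable N norm"
    and ab: "continuous_on S a" "continuous_on S b" "\<And>t. t \<in> S \<Longrightarrow> a t \<noteq> (0 :: real)"
    and pos: "\<And>t. t \<in> S \<Longrightarrow> (\<integral>y. kern (a t) (b t) x y \<partial>N) \<noteq> 0"
  shows "continuous_on (S :: real set) (\<lambda>t. kern_mean N (a t) (b t) x)"
proof -
  interpret prob_space N by fact
  note [measurable_cong] = sets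
  have k1: "norm (kern p q x y *\<^sub>R y) \<le> norm y" for p q y
    using mult_right_mono[OF kern_le_1 norm_ge_zero, of p q x y y] kern_pos[of p q x y] by simp
  have k2: "norm (kern p q x y) \<le> 1" for p q y
    using kern_le_1[of p q x y] kern_pos[of p q x y] by simp
  have "continuous_on S (\<lambda>t. \<integral>y. kern (a t) (b t) x y *\<^sub>R y \<partial>N)"
    by (rule continuous_on_integral_dominated[OF _ int k1])
      (auto intro!: continuous_intros kern_continuous_on ab)
  moreover have "continuous_on S (\<lambda>t. \<integral>y. kern (a t) (b t) x y \<partial>N)"
    by (rule continuous_on_integral_dominated[OF _ _ k2])
      (auto intro!: continuous_intros kern_continuous_on ab)
  ultimately show ?thesis
    unfolding kern_mean_def using pos by (intro continuous_intros) auto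
qed

locale schedule =
  fixes a b :: "real \<Rightarrow> real"
  assumes schedule: "interpolation_schedule a b"
begin

abbreviation a' :: "real \<Rightarrow> real" where "a' \<equiv> time_deriv a"
abbreviation b' :: "real \<Rightarrow> real" where "b' \<equiv> time_deriv b"

lemma at_within_half_open: "t \<in> {0..<1} \<Longrightarrow> at t within {0..<1} = at t within {0..1::real}"
  by (rule at_within_nhd[of _ "{..<1}"]) auto

lemma a_deriv: "t \<in> {0..<1} \<Longrightarrow> (a has_real_derivative a' t) (at t within {0..1})"
  and a'_continuous: "continuous_on {0..<1} a'"
proof -
  obtain f where f: "\<And>t. t \<in> {0..<1} \<Longrightarrow> (a has_real_derivative f t) (at t within {0..<1})" "C1_on {0..<1} f"
    using schedule unfolding interpolation_schedule_def C2_on_def by blast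
  have f1: "(a has_real_derivative f t) (at t within {0..1})" if "t \<in> {0..<1}" for t
    using f(1)[OF that] at_within_half_open[OF that] by simp
  have e: "a' t = f t" if "t \<in> {0..<1}" for t
    unfolding time_deriv_def using that f1[OF that]
    by (intro vector_derivative_within_cbox[of 0 1, simplified]) (auto simp: has_real_derivative_iff_has_vector_derivative)
  show "(a has_real_derivative a' t) (at t within {0..1})" if "t \<in> {0..<1}"
    using f1[OF that] e[OF that] by simp
  have "continuous_on {0..<1} f"
    using f(2) unfolding C1_on_def by (meson DERIV_continuous_on)
  then show "continuous_on {0..<1} a'" by (rule continuous_on_eq) (use e in simp)
qed

lemma b_deriv: "t \<in> {0..1} \<Longrightarrow> (b has_real_derivative b' t) (at t within {0..1})"
  and b'_continuous: "continuous_on {0..1} b'"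
proof -
  obtain f where f: "\<And>t. t \<in> {0..1} \<Longrightarrow> (b has_real_derivative f t) (at t within {0..1})" "continuous_on {0..1} f"
    using schedule unfolding interpolation_schedule_def C1_on_def by blast
  have e: "b' t = f t" if "t \<in> {0..1}" for t
    unfolding time_deriv_def using that f(1)[OF that]
    by (intro vector_derivative_within_cbox[of 0 1, simplified]) (auto simp: has_real_derivative_iff_has_vector_derivative)
  show "(b has_real_derivative b' t) (at t within {0..1})" if "t \<in> {0..1}"
    using f(1)[OF that] e[OF that] by simp
  show "continuous_on {0..1} b'" by (rule continuous_on_eq[OF f(2)]) (use e in simp)
qed

lemma b_continuous: "continuous_on {0..1} b"
  using b_deriv DERIV_continuous_on by blast

lemma nonincreasing_if_deriv:
  fixes f :: "real \<Rightarrow> real"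
  assumes "\<And>t. t \<in> {s..u} \<Longrightarrow> (f has_real_derivative f' t) (at t within {s..u})" "s \<le> u" "\<And>t. t \<in> {s..u} \<Longrightarrow> f' t \<le> 0"
  shows "f u \<le> f s"
proof -
  have "\<exists>t\<in>{s..u}. f u - f s = f' t * (u - s)"
    using assms(1,2) by (intro mvt_very_simple) (auto simp: has_field_derivative_def)
  then obtain t where t: "t \<in> {s..u}" "f u - f s = f' t * (u - s)" by blast
  then have "f u - f s \<le> 0" using assms(2,3) by (auto intro: mult_nonpos_nonneg)
  then show ?thesis by simp
qed

lemma a_le: "t \<in> {0..<1} \<Longrightarrow> a t \<le> a 0"
  by (rule nonincreasing_if_deriv[where f'=a'])
    (use schedule in \<open>auto simp: interpolation_schedule_def intro!: DERIV_subset[OF a_deriv]\<close>)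

lemma b_le: "t \<in> {0..1} \<Longrightarrow> b t \<le> 1"
proof -
  assume t: "t \<in> {0..1}"
  have "- b 1 \<le> - b t"
  proof (rule nonincreasing_if_deriv[where f="\<lambda>t. - b t" and f'="\<lambda>t. - b' t"])
    show "((\<lambda>t. - b t) has_real_derivative - b' s) (at s within {t..1})" if "s \<in> {t..1}" for s
      using that t by (intro DERIV_minus DERIV_subset[OF b_deriv]) auto
  qed (use schedule t in \<open>auto simp: interpolation_schedule_def\<close>)
  then show ?thesis using schedule by (simp add: interpolation_schedule_def)
qed

lemma a_pos: "t \<in> {0..<1} \<Longrightarrow> 0 < a t" and a_1: "a 1 = 0" and b_1: "b 1 = 1"
  and a_nonneg: "t \<in> {0..1} \<Longrightarrow> 0 \<le> a t"
  and b_nonneg: "t \<in> {0..1} \<Longrightarrow> 0 \<le> b t" and b_pos: "t \<in> {0<..1} \<Longrightarrow> 0 < b t"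
proof -
  show p: "0 < a t" if "t \<in> {0..<1}" for t
    using schedule that by (cases "t = 0") (auto simp: interpolation_schedule_def)
  show 1: "a 1 = 0" "b 1 = 1" using schedule by (auto simp: interpolation_schedule_def)
  show "0 \<le> a t" if "t \<in> {0..1}" for t using p[of t] 1 that by (cases "t = 1") auto
  show bp: "0 < b t" if "t \<in> {0<..1}" for t
    using schedule that 1 by (cases "t = 1") (auto simp: interpolation_schedule_def)
  show "0 \<le> b t" if "t \<in> {0..1}" for t
    using schedule that bp[of t] by (cases "t = 0") (auto simp: interpolation_schedule_def)
qed

text \<open>Half the derivative of \<open>a\<^sup>2\<close>, which unlike \<open>a'\<close> is continuous up to \<open>t = 1\<close>.\<close>

definition sq' :: "real \<Rightarrow> real" where "sq' t = time_deriv (\<lambda>t. (a t)\<^sup>2) t / 2"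

lemma sq'_continuous: "continuous_on {0..1} sq'"
  and sq_continuous: "continuous_on {0..1} (\<lambda>t. (a t)\<^sup>2)"
  and sq'_eq: "t \<in> {0..<1} \<Longrightarrow> sq' t = a t * a' t"
proof -
  obtain f where f: "\<And>t. t \<in> {0..1} \<Longrightarrow> ((\<lambda>t. (a t)\<^sup>2) has_real_derivative f t) (at t within {0..1})" "continuous_on {0..1} f"
    using schedule unfolding interpolation_schedule_def C1_on_def by blast
  have e: "sq' t = f t / 2" if "t \<in> {0..1}" for t
    unfolding sq'_def time_deriv_def using that f(1)[OF that]
    by (subst vector_derivative_within_cbox[of 0 1, simplified, where f'="f t"]) (auto simp: has_real_derivative_iff_has_vector_derivative)
  have "continuous_on {0..1} (\<lambda>t. f t / 2)" by (intro continuous_intros f) auto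
  then show "continuous_on {0..1} sq'" by (rule continuous_on_eq) (use e in simp)
  show "continuous_on {0..1} (\<lambda>t. (a t)\<^sup>2)" using f(1) DERIV_continuous_on by blast
  show "sq' t = a t * a' t" if t: "t \<in> {0..<1}"
  proof -
    have "((\<lambda>t. (a t)\<^sup>2) has_real_derivative 2 * a t * a' t) (at t within {0..1})"
      by (rule derivative_eq_intros a_deriv t | simp)+
    then have "((\<lambda>t. (a t)\<^sup>2) has_vector_derivative 2 * a t * a' t) (at t within {0..1})"
      by (simp add: has_real_derivative_iff_has_vector_derivative)
    moreover have "((\<lambda>t. (a t)\<^sup>2) has_vector_derivative f t) (at t within {0..1})"
      using f(1) t by (simp add: has_real_derivative_iff_has_vector_derivative)
    ultimately have "f t = 2 * a t * a' t"
      using vector_derivative_unique_within_closed_interval[of 0 1 t] t by auto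
    then show ?thesis using e[of t] t by simp
  qed
qed

lemma a_continuous: "continuous_on {0..1} a"
proof -
  have "continuous_on {0..1} (\<lambda>t. sqrt ((a t)\<^sup>2))" by (intro continuous_intros sq_continuous)
  then show ?thesis by (rule continuous_on_eq) (use a_nonneg in simp)
qed

lemma at_left_1: "at_left (1::real) = at 1 within {0..<1}"
  by (rule at_within_nhd[of _ "{0<..}"]) auto

lemma tendsto_at_left_1:
  assumes "continuous_on {0..1} f"
  shows "(f \<longlongrightarrow> f 1) (at_left (1::real))"
  unfolding at_left_1 using assms unfolding continuous_on by (meson atLeastAtMost_iff atLeastLessThan_subseteq_atLeastAtMost_iff order_refl tendsto_within_subset zero_le_one)

end

text \<open>What remains to be checked for the individual classes of targets: Lipschitz bounds uniform in
  time, and convergence at the final time.\<close>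

locale regular_interpolation = schedule a b + gaussian_pair M Z X1 \<nu>
  for a b :: "real \<Rightarrow> real" and M :: "'w measure" and Z X1 :: "'w \<Rightarrow> real ^ 'n" and \<nu> :: "(real ^ 'n) measure" +
  fixes K :: real and v1 :: "real ^ 'n \<Rightarrow> real ^ 'n"
  assumes K: "0 < K"
    and mean_lipschitz: "\<And>t. t \<in> {0..<1} \<Longrightarrow> \<exists>L. L-lipschitz_on UNIV (kern_mean \<nu> (a t) (b t))"
    and velocity_lipschitz: "\<And>t x y. t \<in> {0..<1} \<Longrightarrow>
       norm (cond_velocity (a t) (b t) (a' t) (b' t) x - cond_velocity (a t) (b t) (a' t) (b' t) y) \<le> K * norm (x - y)"
    and velocity_limit: "\<And>x. ((\<lambda>t. cond_velocity (a t) (b t) (a' t) (b' t) x) \<longlongrightarrow> v1 x) (at_left 1)"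
begin

definition vel :: "real \<Rightarrow> real ^ 'n \<Rightarrow> real ^ 'n" where
  "vel t x = (if t = 1 then v1 x else cond_velocity (a t) (b t) (a' t) (b' t) x)"

lemma mean_continuous: "t \<in> {0..<1} \<Longrightarrow> continuous_on UNIV (kern_mean \<nu> (a t) (b t))"
  using mean_lipschitz lipschitz_on_continuous_on by blast

lemma mean_growth:
  assumes "t \<in> {0..<1}" obtains C where "\<And>x. norm (kern_mean \<nu> (a t) (b t) x) \<le> C * (1 + norm x)"
proof -
  let ?m = "kern_mean \<nu> (a t) (b t)"
  obtain L where L: "L-lipschitz_on UNIV ?m" using mean_lipschitz[OF assms] by blast
  have "norm (?m x) \<le> (norm (?m 0) + L) * (1 + norm x)" for x
  proof -
    have "norm (?m x) \<le> norm (?m 0) + norm (?m x - ?m 0)" by (metis add.commute diff_add_cancel norm_triangle_ineq)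
    also have "norm (?m x - ?m 0) \<le> L * norm x" using lipschitz_on_normD[OF L, of x 0] by simp
    also have "norm (?m 0) + L * norm x \<le> (norm (?m 0) + L) * (1 + norm x)"
      using lipschitz_on_nonneg[OF L] by (simp add: algebra_simps)
    finally show ?thesis by simp
  qed
  then show thesis by (rule that)
qed

lemma vel_continuous: "continuous_on {0..1} (\<lambda>t. vel t x)"
proof -
  have ac: "continuous_on {0..<1} a" and bc: "continuous_on {0..<1} b" and b'c: "continuous_on {0..<1} b'"
    by (rule continuous_on_subset[OF a_continuous] continuous_on_subset[OF b_continuous] continuous_on_subset[OF b'_continuous], auto)+
  have nz: "a t \<noteq> 0" if "t \<in> {0..<1}" for t using a_pos[OF that] by simp
  have "continuous_on {0..<1} (\<lambda>t. kern_mean \<nu> (a t) (b t) x)"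
    by (rule kern_mean_continuous_on[OF prob_space_nu _ integrable_nu_norm ac bc])
      (use nz integral_kern_pos in \<open>auto simp: less_le\<close>)
  then have *: "continuous_on {0..<1} (\<lambda>t. cond_velocity (a t) (b t) (a' t) (b' t) x)"
    unfolding cond_velocity_def using nz by (intro continuous_intros ac bc b'c a'_continuous) auto
  show ?thesis
    unfolding continuous_on
  proof
    fix t :: real assume t: "t \<in> {0..1}"
    show "((\<lambda>t. vel t x) \<longlongrightarrow> vel t x) (at t within {0..1})"
    proof (cases "t = 1")
      case True
      have e: "at (1::real) within {0..1} = at_left 1" by (rule at_within_nhd[of _ "{0<..}"]) auto
      have "\<forall>\<^sub>F t in at_left 1. cond_velocity (a t) (b t) (a' t) (b' t) x = vel t x"
        unfolding eventually_at_filter by (rule always_eventually) (auto simp: vel_def)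
      from Lim_transform_eventually[OF velocity_limit this] show ?thesis
        unfolding True e by (simp add: vel_def)
    next
      case False
      then have t': "t \<in> {0..<1}" using t by auto
      have "((\<lambda>t. cond_velocity (a t) (b t) (a' t) (b' t) x) \<longlongrightarrow> vel t x) (at t within {0..1})"
        using * t' False unfolding continuous_on at_within_half_open[OF t', symmetric] by (simp add: vel_def)
      moreover have "\<forall>\<^sub>F s in at t within {0..1}. cond_velocity (a s) (b s) (a' s) (b' s) x = vel s x"
      proof -
        have "\<forall>\<^sub>F s in nhds t. s \<noteq> 1" using t' by (intro t1_space_nhds) auto
        then show ?thesis unfolding eventually_at_filter by eventually_elim (simp add: vel_def)
      qed
      ultimately show ?thesis by (rule Lim_transform_eventually)
    qed
  qed
qed

sublocale lipschitz_field vel K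
proof
  show "0 < K" by (rule K)
  show "continuous_on {0..1} (\<lambda>t. vel t x)" for x by (rule vel_continuous)
  fix t :: real and x y assume t: "t \<in> {0..1}"
  show "norm (vel t x - vel t y) \<le> K * norm (x - y)"
  proof (cases "t = 1")
    case True
    have "norm (v1 x - v1 y) \<le> K * norm (x - y)"
    proof (rule tendsto_upperbound)
      show "((\<lambda>t. norm (cond_velocity (a t) (b t) (a' t) (b' t) x - cond_velocity (a t) (b t) (a' t) (b' t) y)) \<longlongrightarrow> norm (v1 x - v1 y)) (at_left 1)"
        by (intro tendsto_intros velocity_limit)
      have "\<forall>\<^sub>F t in at_left 1. t \<in> {0..<1::real}"
        unfolding at_left_1 eventually_at_filter by simp
      then show "\<forall>\<^sub>F t in at_left 1. norm (cond_velocity (a t) (b t) (a' t) (b' t) x - cond_velocity (a t) (b t) (a' t) (b' t) y) \<le> K * norm (x - y)"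
        by eventually_elim (rule velocity_lipschitz)
    qed simp
    then show ?thesis using True by (simp add: vel_def)
  next
    case False
    then show ?thesis using velocity_lipschitz[of t x y] t by (simp add: vel_def)
  qed
qed

lemma interior_velocity_eq:
  assumes "t \<in> {0<..<1}"
  shows "interior_velocity M a b Z X1 t = vel t"
proof -
  have t: "t \<in> {0..<1}" using assms by auto
  obtain C where C: "\<And>x. norm (kern_mean \<nu> (a t) (b t) x) \<le> C * (1 + norm x)" using mean_growth[OF t] by blast
  have "interior_velocity M a b Z X1 t = cond_velocity (a t) (b t) (a' t) (b' t)"
    unfolding interior_velocity_def interpolant_def[abs_def]
    by (rule cond_exp_given_eq[OF a_pos[OF t] mean_continuous[OF t] C])
  then show ?thesis using assms by (auto simp: vel_def fun_eq_iff)
qed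

lemma velocity_eq:
  assumes t: "t \<in> {0..1}"
  shows "velocity M a b Z X1 t = vel t"
proof
  fix x
  consider "t = 0" | "t = 1" | "t \<in> {0<..<1}" using t by fastforce
  then show "velocity M a b Z X1 t x = vel t x"
  proof cases
    case 1
    have e: "at_right (0::real) = at 0 within {0..1}" by (rule at_within_nhd[of _ "{..<1}"]) auto
    have "((\<lambda>s. vel s x) \<longlongrightarrow> vel 0 x) (at_right 0)"
      using vel_continuous[of x] unfolding continuous_on e by simp
    moreover have "\<forall>\<^sub>F s in at_right 0. vel s x = interior_velocity M a b Z X1 s x"
      using eventually_at_right_less eventually_at_right_real[of 0 "1::real"]
      by (auto elim!: eventually_mono simp: interior_velocity_eq)
    ultimately have "((\<lambda>s. interior_velocity M a b Z X1 s x) \<longlongrightarrow> vel 0 x) (at_right 0)" by (rule Lim_transform_eventually)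
    then show ?thesis using 1 by (simp add: velocity_def tendsto_Lim)
  next
    case 2
    have "((\<lambda>s. vel s x) \<longlongrightarrow> vel 1 x) (at_left 1)" by (rule tendsto_at_left_1[OF vel_continuous])
    moreover have "\<forall>\<^sub>F s in at_left 1. vel s x = interior_velocity M a b Z X1 s x"
      using eventually_at_left_real[of 0 "1::real"]
      by (auto elim!: eventually_mono simp: interior_velocity_eq)
    ultimately have "((\<lambda>s. interior_velocity M a b Z X1 s x) \<longlongrightarrow> vel 1 x) (at_left 1)" by (rule Lim_transform_eventually)
    then show ?thesis using 2 by (simp add: velocity_def tendsto_Lim)
  next
    case 3
    then show ?thesis by (auto simp: velocity_def interior_velocity_eq)
  qed
qed

lemma ivp_solution_velocity_iff: "ivp_solution (velocity M a b Z X1) x y \<longleftrightarrow> ivp_solution vel x y"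
  unfolding ivp_solution_def using velocity_eq by auto

lemma interpolant_measurable [measurable]: "interpolant a b Z X1 t \<in> borel_measurable M"
  unfolding interpolant_def[abs_def] by measurable

lemma flow_law_before_1:
  assumes T: "0 < T" "T < 1"
  shows "distr M borel (interpolant a b Z X1 T) = distr M borel (\<lambda>\<omega>. flow T (interpolant a b Z X1 0 \<omega>))"
proof -
  let ?X = "interpolant a b Z X1" and ?X' = "\<lambda>t \<omega>. a' t *\<^sub>R Z \<omega> + b' t *\<^sub>R X1 \<omega>"
  let ?\<Xi> = "\<lambda>\<omega>. 1 + norm (Z \<omega>) + norm (X1 \<omega>)"
  have sub: "{0..T} \<subseteq> {0..<1}" "{0..T} \<subseteq> {0..1}" using T by auto
  have ca: "continuous_on {0..T} a" and cb: "continuous_on {0..T} b" and ca': "continuous_on {0..T} a'" and cb': "continuous_on {0..T} b'"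
    using a_continuous b_continuous a'_continuous b'_continuous sub continuous_on_subset by blast+
  have "bounded ((\<lambda>t. \<bar>a t\<bar> + \<bar>b t\<bar> + \<bar>a' t\<bar> + \<bar>b' t\<bar>) ` {0..T})"
    by (intro compact_imp_bounded compact_continuous_image continuous_intros ca cb ca' cb') simp
  then obtain A where A: "\<And>t. t \<in> {0..T} \<Longrightarrow> \<bar>\<bar>a t\<bar> + \<bar>b t\<bar> + \<bar>a' t\<bar> + \<bar>b' t\<bar>\<bar> \<le> A"
    unfolding bounded_iff real_norm_def by blast
  have A0: "0 \<le> A" using A[of 0] T by (meson abs_ge_zero atLeastAtMost_iff less_imp_le order_refl order_trans)
  have lin: "norm (p *\<^sub>R Z \<omega> + q *\<^sub>R X1 \<omega>) \<le> c * ?\<Xi> \<omega>" if "\<bar>p\<bar> \<le> c" "\<bar>q\<bar> \<le> c" for p q c \<omega>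
  proof -
    have "norm (p *\<^sub>R Z \<omega> + q *\<^sub>R X1 \<omega>) \<le> \<bar>p\<bar> * norm (Z \<omega>) + \<bar>q\<bar> * norm (X1 \<omega>)"
      using norm_triangle_ineq[of "p *\<^sub>R Z \<omega>" "q *\<^sub>R X1 \<omega>"] by simp
    also have "\<dots> \<le> c * norm (Z \<omega>) + c * norm (X1 \<omega>)" using that by (intro add_mono mult_right_mono) auto
    also have "\<dots> \<le> c * ?\<Xi> \<omega>" using that by (simp add: algebra_simps)
    finally show ?thesis .
  qed
  show ?thesis
  proof (rule flow_transports_law[where X'="?X'" and \<Xi>="?\<Xi>" and A=A])
    show "prob_space M" by unfold_locales
    show "0 < T" "T \<le> 1" using T by auto
    show "0 \<le> A" by (rule A0)
    show "integrable M (\<lambda>\<omega>. (?\<Xi> \<omega>)\<^sup>2)" by (rule square_integrable_bound)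
    show "norm (?X t \<omega>) \<le> A * ?\<Xi> \<omega>" "norm (?X' t \<omega>) \<le> A * ?\<Xi> \<omega>" if "t \<in> {0..T}" for t \<omega>
      unfolding interpolant_def using A[OF that] by (auto intro!: lin)
  next
    fix \<eta> :: real assume \<eta>: "0 < \<eta>"
    have da: "(a has_vector_derivative a' t) (at t within {0..T})" if "t \<in> {0..T}" for t
      using that sub has_vector_derivative_within_subset[OF a_deriv[unfolded has_real_derivative_iff_has_vector_derivative] sub(2)] by blast
    have db: "(b has_vector_derivative b' t) (at t within {0..T})" if "t \<in> {0..T}" for t
      using that sub has_vector_derivative_within_subset[OF b_deriv[unfolded has_real_derivative_iff_has_vector_derivative] sub(2)] by blast
    obtain d1 where d1: "0 < d1" "\<And>s t. s \<in> {0..T} \<Longrightarrow> t \<in> {0..T} \<Longrightarrow> \<bar>s - t\<bar> < d1 \<Longrightarrow> norm (a s - a t - (s - t) *\<^sub>R a' t) \<le> \<eta> * \<bar>s - t\<bar>"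
      using C1_uniform_taylor[OF da ca' \<eta>] by blast
    obtain d2 where d2: "0 < d2" "\<And>s t. s \<in> {0..T} \<Longrightarrow> t \<in> {0..T} \<Longrightarrow> \<bar>s - t\<bar> < d2 \<Longrightarrow> norm (b s - b t - (s - t) *\<^sub>R b' t) \<le> \<eta> * \<bar>s - t\<bar>"
      using C1_uniform_taylor[OF db cb' \<eta>] by blast
    show "\<exists>d>0. \<forall>s\<in>{0..T}. \<forall>t\<in>{0..T}. \<bar>s - t\<bar> < d \<longrightarrow>
       (\<forall>\<omega>. norm (?X s \<omega> - ?X t \<omega> - (s - t) *\<^sub>R ?X' t \<omega>) \<le> \<eta> * \<bar>s - t\<bar> * ?\<Xi> \<omega>)"
    proof (intro exI[of _ "min d1 d2"] conjI ballI impI allI)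
      show "0 < min d1 d2" using d1 d2 by simp
      fix s t \<omega> assume st: "s \<in> {0..T}" "t \<in> {0..T}" "\<bar>s - t\<bar> < min d1 d2"
      have "?X s \<omega> - ?X t \<omega> - (s - t) *\<^sub>R ?X' t \<omega> = (a s - a t - (s - t) * a' t) *\<^sub>R Z \<omega> + (b s - b t - (s - t) * b' t) *\<^sub>R X1 \<omega>"
        by (simp add: interpolant_def algebra_simps)
      then show "norm (?X s \<omega> - ?X t \<omega> - (s - t) *\<^sub>R ?X' t \<omega>) \<le> \<eta> * \<bar>s - t\<bar> * ?\<Xi> \<omega>"
        using d1(2)[of s t] d2(2)[of s t] st by (auto intro!: lin)
    qed
  next
    fix t C and p :: "real ^ 'n \<Rightarrow> real ^ 'n"
    assume t: "t \<in> {0..T}" and p: "p \<in> borel_measurable borel" "\<And>x. norm (p x) \<le> C"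
    then have t': "t \<in> {0..<1}" using sub by auto
    obtain D where D: "\<And>x. norm (kern_mean \<nu> (a t) (b t) x) \<le> D * (1 + norm x)" using mean_growth[OF t'] by blast
    have "vel t = cond_velocity (a t) (b t) (a' t) (b' t)" using t' by (auto simp: vel_def fun_eq_iff)
    then show "(\<integral>\<omega>. p (?X t \<omega>) \<bullet> ?X' t \<omega> \<partial>M) = (\<integral>\<omega>. p (?X t \<omega>) \<bullet> vel t (?X t \<omega>) \<partial>M)"
      unfolding interpolant_def
      using cond_velocity_orthogonal(3)[OF a_pos[OF t'] borel_measurable_continuous_onI[OF mean_continuous[OF t']] D p] by simp
  qed auto
qed

lemma flow_0: "flow 0 x = x"
  using flow_solution[of x] by (simp add: ivp_solution_def)

lemma flow_law:
  assumes t: "t \<in> {0..1}"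
  shows "distr M borel (\<lambda>\<omega>. flow t (interpolant a b Z X1 0 \<omega>)) = distr M borel (interpolant a b Z X1 t)"
proof -
  consider "t = 0" | "0 < t" "t < 1" | "t = 1" using t by fastforce
  then show ?thesis
  proof cases
    case 1
    then show ?thesis by (simp add: flow_0)
  next
    case 2
    then show ?thesis by (simp add: flow_law_before_1)
  next
    case 3
    define s where "s n = 1 - 1 / real (n + 2)" for n
    have s: "0 < s n" "s n < 1" "s n \<in> {0..1}" for n by (auto simp: s_def divide_simps)
    have "(\<lambda>n. 1 - 1 / real (n + 2)) \<longlonglongrightarrow> 1 - 0"
      by (intro tendsto_intros real_tendsto_divide_at_top[OF tendsto_const] filterlim_compose[OF filterlim_real_sequentially] filterlim_add_const_nat_at_top)
    then have lim: "s \<longlonglongrightarrow> 1" unfolding s_def[abs_def] by simp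
    have along: "(\<lambda>n. f (s n)) \<longlonglongrightarrow> f 1" if "continuous_on {0..1} f" for f :: "real \<Rightarrow> 'c::topological_space"
      using continuous_on_tendsto_compose[OF that lim] s by simp
    have [measurable]: "flow (s n) \<in> borel_measurable borel" "flow 1 \<in> borel_measurable borel" for n
      using flow_borel_measurable s by auto
    have "distr M borel (\<lambda>\<omega>. flow 1 (interpolant a b Z X1 0 \<omega>)) = distr M borel (interpolant a b Z X1 1)"
    proof (rule measure_eqI_bounded_lipschitz)
      show "prob_space (distr M borel (interpolant a b Z X1 1))" "prob_space (distr M borel (\<lambda>\<omega>. flow 1 (interpolant a b Z X1 0 \<omega>)))"
        by (auto intro!: prob_space_distr)
      fix f :: "real ^ 'n \<Rightarrow> real" and L
      assume f: "\<And>x. \<bar>f x\<bar> \<le> 1" "\<And>x y. \<bar>f x - f y\<bar> \<le> L * dist x y" "0 \<le> L" and fm[measurable]: "f \<in> borel_measurable borel"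
      have "L-lipschitz_on UNIV f" by (rule lipschitz_onI) (use f in \<open>auto simp: dist_real_def\<close>)
      then have fc: "continuous_on UNIV f" by (rule lipschitz_on_continuous_on)
      have "continuous_on {0..1} (\<lambda>t. f (flow t x))" for x
        by (rule continuous_on_compose2[OF fc ivp_solution_continuous[OF flow_solution]]) auto
      then have 1: "(\<lambda>n. expectation (\<lambda>\<omega>. f (flow (s n) (interpolant a b Z X1 0 \<omega>)))) \<longlonglongrightarrow> expectation (\<lambda>\<omega>. f (flow 1 (interpolant a b Z X1 0 \<omega>)))"
        using f(1) along by (intro integral_dominated_convergence[where w="\<lambda>_. 1"]) auto
      have "continuous_on {0..1} (\<lambda>t. f (interpolant a b Z X1 t \<omega>))" for \<omega>
        unfolding interpolant_def
        by (rule continuous_on_compose2[OF fc]) (auto intro!: continuous_intros a_continuous b_continuous)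
      then have 2: "(\<lambda>n. expectation (\<lambda>\<omega>. f (interpolant a b Z X1 (s n) \<omega>))) \<longlonglongrightarrow> expectation (\<lambda>\<omega>. f (interpolant a b Z X1 1 \<omega>))"
        using f(1) along by (intro integral_dominated_convergence[where w="\<lambda>_. 1"]) auto
      have "expectation (\<lambda>\<omega>. f (flow (s n) (interpolant a b Z X1 0 \<omega>))) = expectation (\<lambda>\<omega>. f (interpolant a b Z X1 (s n) \<omega>))" for n
      proof -
        have "(\<integral>x. f x \<partial>distr M borel (\<lambda>\<omega>. flow (s n) (interpolant a b Z X1 0 \<omega>))) = (\<integral>x. f x \<partial>distr M borel (interpolant a b Z X1 (s n)))"
          using flow_law_before_1[OF s(1,2)] by simp
        then show ?thesis by (simp add: integral_distr)
      qed
      then have "expectation (\<lambda>\<omega>. f (flow 1 (interpolant a b Z X1 0 \<omega>))) = expectation (\<lambda>\<omega>. f (interpolant a b Z X1 1 \<omega>))"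
        using 1 2 LIMSEQ_unique by simp
      then show "(\<integral>x. f x \<partial>distr M borel (\<lambda>\<omega>. flow 1 (interpolant a b Z X1 0 \<omega>))) = (\<integral>x. f x \<partial>distr M borel (interpolant a b Z X1 1))"
        by (simp add: integral_distr)
    qed auto
    then show ?thesis using 3 by simp
  qed
qed

lemma unique_flow_and_law:
  defines "v \<equiv> velocity M a b Z X1" and "\<mu> \<equiv> distr M borel (interpolant a b Z X1 0)"
  shows "\<exists>X :: real \<Rightarrow> real ^ 'n \<Rightarrow> real ^ 'n.
           (\<forall>x. ivp_solution v x (\<lambda>t. X t x) \<and>
                (\<forall>y. ivp_solution v x y \<longrightarrow> (\<forall>t\<in>{0..1}. y t = X t x))) \<and>
           (\<forall>t\<in>{0..1}. X t \<in> borel_measurable borel \<and>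
                distr \<mu> borel (X t) = distr M borel (interpolant a b Z X1 t))"
proof (intro exI[of _ flow] conjI allI impI ballI)
  show "ivp_solution v x (\<lambda>t. flow t x)" for x
    unfolding v_def ivp_solution_velocity_iff by (rule flow_solution)
  show "y t = flow t x" if "ivp_solution v x y" "t \<in> {0..1}" for x y t
    using that ivp_solution_unique[OF _ flow_solution] unfolding v_def ivp_solution_velocity_iff by blast
  fix t :: real assume t: "t \<in> {0..1}"
  show [measurable]: "flow t \<in> borel_measurable borel" by (rule flow_borel_measurable[OF t])
  show "distr \<mu> borel (flow t) = distr M borel (interpolant a b Z X1 t)"
    unfolding \<mu>_def flow_law[OF t, symmetric] by (subst distr_distr) (auto simp: o_def)
qed

end

section \<open>Exponential tilts of the conditional law\<close>

lemma abs_exp_minus_1_le: "\<bar>exp r - 1\<bar> \<le> \<bar>r\<bar> * exp \<bar>r\<bar>" for r :: real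
proof (cases "0 \<le> r")
  case True
  have "(1 - r) * exp r \<le> exp (- r) * exp r"
    using exp_ge_add_one_self[of "- r"] by (intro mult_right_mono) auto
  then have "exp r - 1 \<le> r * exp r" by (simp add: exp_minus_inverse left_diff_distrib exp_add[symmetric])
  moreover have "1 \<le> exp r" using True by simp
  ultimately show ?thesis using True by simp
next
  case False
  have "1 - exp r \<le> - r" using exp_ge_add_one_self[of r] by linarith
  also have "\<dots> \<le> - r * exp (- r)" using False mult_left_mono[of 1 "exp (- r)" "- r"] by simp
  finally show ?thesis using False by simp
qed

lemma lipschitz_of_local:
  fixes f :: "'a::real_normed_vector \<Rightarrow> 'b::real_normed_vector"
  assumes r: "0 < r" and loc: "\<And>x k. norm k \<le> r \<Longrightarrow> norm (f (x + k) - f x) \<le> c * norm k"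
  shows "norm (f x - f y) \<le> c * norm (x - y)"
proof -
  obtain n :: nat where n: "norm (x - y) / r < real n" using reals_Archimedean2 by blast
  then have n0: "0 < real n" using r by (smt (verit) divide_nonneg_pos norm_ge_zero)
  define k where "k = (1 / real n) *\<^sub>R (x - y)"
  have nk: "norm k = norm (x - y) / real n" using n0 by (simp add: k_def)
  have kr: "norm k \<le> r" unfolding nk using n n0 r by (simp add: divide_simps mult.commute less_imp_le)
  have "norm (f (y + real i *\<^sub>R k) - f y) \<le> real i * (c * norm k)" for i
  proof (induction i)
    case (Suc i)
    have "f (y + real (Suc i) *\<^sub>R k) - f y = (f ((y + real i *\<^sub>R k) + k) - f (y + real i *\<^sub>R k)) + (f (y + real i *\<^sub>R k) - f y)"
      by (simp add: algebra_simps)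
    also have "norm \<dots> \<le> c * norm k + real i * (c * norm k)"
      by (intro norm_triangle_mono loc kr Suc.IH)
    finally show ?case by (simp add: algebra_simps)
  qed simp
  from this[of n] show ?thesis using n0 by (simp add: nk k_def)
qed

text \<open>Dominates \<open>|u|\<close> times the first-order change of \<open>exp (k \<bullet> u)\<close> whenever \<open>|k| \<le> 1\<close>.\<close>

definition tilt_weight :: "'a::real_normed_vector \<Rightarrow> real" where
  "tilt_weight u = (1 + norm u)\<^sup>2 * exp (norm u)"

lemma tilt_weight_bounds: "1 \<le> tilt_weight u" "norm u \<le> tilt_weight u" "norm u * exp (norm u) \<le> tilt_weight u"
  "norm u * (norm u * exp (norm u)) \<le> tilt_weight u" "exp (norm u) \<le> tilt_weight u"
proof -
  let ?r = "norm u"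
  have e: "1 \<le> exp ?r" by simp
  have sq: "1 \<le> (1 + ?r)\<^sup>2" "?r \<le> (1 + ?r)\<^sup>2" "?r * ?r \<le> (1 + ?r)\<^sup>2" by (auto simp: power2_eq_square algebra_simps)
  have *: "x * exp ?r \<le> tilt_weight u" if "x \<le> (1 + ?r)\<^sup>2" for x
    unfolding tilt_weight_def using that by (intro mult_right_mono) auto
  show "exp ?r \<le> tilt_weight u" using *[OF sq(1)] by simp
  then show "1 \<le> tilt_weight u" using e by linarith
  show p: "?r * exp ?r \<le> tilt_weight u" by (rule *[OF sq(2)])
  show "?r * (?r * exp ?r) \<le> tilt_weight u" using *[OF sq(3)] by (simp add: mult.assoc)
  have "?r * 1 \<le> ?r * exp ?r" by (intro mult_left_mono) auto
  then show "?r \<le> tilt_weight u" using p by linarith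
qed

lemma tilt_weight_measurable [measurable]: "tilt_weight \<in> borel_measurable borel"
  unfolding tilt_weight_def[abs_def] by measurable

lemma tilted_average_difference:
  fixes W :: "'c \<Rightarrow> real" and u :: "'c \<Rightarrow> 'a::euclidean_space" and g :: "'c \<Rightarrow> 'b::euclidean_space"
  assumes [measurable]: "W \<in> borel_measurable N" "u \<in> borel_measurable N" "g \<in> borel_measurable N"
    and W: "\<And>y. 0 \<le> W y" "integrable N W" "0 < (\<integral>y. W y \<partial>N)"
    and S: "integrable N (\<lambda>y. W y * tilt_weight (u y))" "(\<integral>y. W y * tilt_weight (u y) \<partial>N) \<le> S * (\<integral>y. W y \<partial>N)"
    and g: "\<And>y. norm (g y - g0) \<le> C * norm (u y)" and C: "0 \<le> C" and k: "norm k \<le> 1 / (2 * S)"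
  shows "norm ((\<integral>y. (W y * exp (k \<bullet> u y)) *\<^sub>R g y \<partial>N) /\<^sub>R (\<integral>y. W y * exp (k \<bullet> u y) \<partial>N)
      - (\<integral>y. W y *\<^sub>R g y \<partial>N) /\<^sub>R (\<integral>y. W y \<partial>N)) \<le> 4 * C * S\<^sup>2 * norm k"
proof -
  define N0 where "N0 = (\<integral>y. W y \<partial>N)"
  define N1 where "N1 = (\<integral>y. W y * exp (k \<bullet> u y) \<partial>N)"
  define A0 where "A0 = (\<integral>y. W y *\<^sub>R (g y - g0) \<partial>N)"
  define A1 where "A1 = (\<integral>y. (W y * exp (k \<bullet> u y)) *\<^sub>R (g y - g0) \<partial>N)"
  have N0: "0 < N0" using W by (simp add: N0_def)
  have "N0 \<le> (\<integral>y. W y * tilt_weight (u y) \<partial>N)"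
    unfolding N0_def using W(1) mult_left_mono[OF tilt_weight_bounds(1) W(1)] by (intro integral_mono W S) simp
  then have "1 * N0 \<le> S * N0" using S(2) by (simp add: N0_def)
  then have S1: "1 \<le> S" using N0 by (simp only: mult_le_cancel_right_pos)
  have k1: "norm k \<le> 1" using k S1 by (smt (verit) divide_le_eq_1)
  have ku: "\<bar>k \<bullet> u y\<bar> \<le> norm k * norm (u y)" for y by (rule Cauchy_Schwarz_ineq2)
  have ku1: "\<bar>k \<bullet> u y\<bar> \<le> norm (u y)" for y
    using ku[of y] mult_right_mono[OF k1 norm_ge_zero[of "u y"]] by simp
  have e_le: "exp (k \<bullet> u y) \<le> exp (norm (u y))" for y using ku1[of y] by simp
  have em1: "\<bar>exp (k \<bullet> u y) - 1\<bar> \<le> norm k * (norm (u y) * exp (norm (u y)))" for y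
  proof -
    have "\<bar>exp (k \<bullet> u y) - 1\<bar> \<le> \<bar>k \<bullet> u y\<bar> * exp \<bar>k \<bullet> u y\<bar>" by (rule abs_exp_minus_1_le)
    also have "\<dots> \<le> (norm k * norm (u y)) * exp (norm (u y))"
      using ku1[of y] by (intro mult_mono ku) auto
    finally show ?thesis by (simp add: mult.assoc)
  qed
  have dom: "integrable N f" "norm (\<integral>y. f y \<partial>N) \<le> c * S * N0"
    if [measurable]: "f \<in> borel_measurable N" and f: "\<And>y. norm (f y) \<le> c * (W y * tilt_weight (u y))" and c: "0 \<le> c"
    for f :: "'c \<Rightarrow> 'd::euclidean_space" and c
  proof -
    show i: "integrable N f"
      by (rule Bochner_Integration.integrable_bound[OF integrable_mult_right[OF S(1), of c]])
        (use f in \<open>auto intro!: AE_I2 order_trans[OF _ abs_ge_self]\<close>)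
    have "norm (\<integral>y. f y \<partial>N) \<le> (\<integral>y. c * (W y * tilt_weight (u y)) \<partial>N)"
      by (rule order_trans[OF integral_norm_bound integral_mono]) (use i S f in auto)
    also have "\<dots> = c * (\<integral>y. W y * tilt_weight (u y) \<partial>N)" by simp
    also have "\<dots> \<le> c * (S * N0)" using S(2) c unfolding N0_def by (rule mult_left_mono)
    finally show "norm (\<integral>y. f y \<partial>N) \<le> c * S * N0" by (simp only: mult.assoc)
  qed
  have Wt: "W y * x \<le> W y * tilt_weight (u y)" if "x \<le> tilt_weight (u y)" for x y
    by (rule mult_left_mono[OF that W(1)])
  have iA0: "integrable N (\<lambda>y. W y *\<^sub>R (g y - g0))" and bA0: "norm A0 \<le> C * S * N0"
  proof -
    have *: "norm (W y *\<^sub>R (g y - g0)) \<le> C * (W y * tilt_weight (u y))" for y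
    proof -
      have "norm (W y *\<^sub>R (g y - g0)) \<le> W y * (C * norm (u y))"
        using W(1)[of y] g[of y] by (simp add: mult_left_mono)
      also have "\<dots> = C * (W y * norm (u y))" by simp
      also have "\<dots> \<le> C * (W y * tilt_weight (u y))" by (intro mult_left_mono Wt tilt_weight_bounds C)
      finally show ?thesis .
    qed
    show "integrable N (\<lambda>y. W y *\<^sub>R (g y - g0))" by (rule dom(1)[OF _ * C]) measurable
    show "norm A0 \<le> C * S * N0" unfolding A0_def by (rule dom(2)[OF _ * C]) measurable
  qed
  have iN1: "integrable N (\<lambda>y. W y * exp (k \<bullet> u y))"
  proof (rule dom(1)[of _ 1])
    show "norm (W y * exp (k \<bullet> u y)) \<le> 1 * (W y * tilt_weight (u y))" for y
      using Wt[OF order_trans[OF e_le tilt_weight_bounds(5)], of y] W(1)[of y] by simp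
  qed auto
  have iA1: "integrable N (\<lambda>y. (W y * exp (k \<bullet> u y)) *\<^sub>R (g y - g0))"
  proof (rule dom(1)[of _ C])
    fix y
    have "norm ((W y * exp (k \<bullet> u y)) *\<^sub>R (g y - g0)) \<le> (W y * exp (norm (u y))) * (C * norm (u y))"
      using W(1)[of y] g[of y] e_le[of y] by (simp add: abs_mult) (intro mult_mono, auto intro!: mult_left_mono)
    also have "\<dots> = C * (W y * (norm (u y) * exp (norm (u y))))" by simp
    also have "\<dots> \<le> C * (W y * tilt_weight (u y))" by (intro mult_left_mono Wt tilt_weight_bounds C)
    finally show "norm ((W y * exp (k \<bullet> u y)) *\<^sub>R (g y - g0)) \<le> C * (W y * tilt_weight (u y))" .
  qed (use C in auto)
  have dN: "\<bar>N1 - N0\<bar> \<le> norm k * S * N0"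
  proof -
    have "N1 - N0 = (\<integral>y. W y * (exp (k \<bullet> u y) - 1) \<partial>N)"
      unfolding N1_def N0_def using iN1 W(2) by (simp add: right_diff_distrib)
    moreover have "norm (\<integral>y. W y * (exp (k \<bullet> u y) - 1) \<partial>N) \<le> norm k * S * N0"
    proof (rule dom(2))
      fix y
      have "norm (W y * (exp (k \<bullet> u y) - 1)) \<le> W y * (norm k * (norm (u y) * exp (norm (u y))))"
        using W(1)[of y] em1[of y] by (simp add: abs_mult mult_left_mono)
      also have "\<dots> = norm k * (W y * (norm (u y) * exp (norm (u y))))" by simp
      also have "\<dots> \<le> norm k * (W y * tilt_weight (u y))" by (intro mult_left_mono Wt tilt_weight_bounds norm_ge_zero)
      finally show "norm (W y * (exp (k \<bullet> u y) - 1)) \<le> norm k * (W y * tilt_weight (u y))" .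
    qed auto
    ultimately show ?thesis by simp
  qed
  have dA: "norm (A1 - A0) \<le> (C * norm k) * S * N0"
  proof -
    have "A1 - A0 = (\<integral>y. (W y * (exp (k \<bullet> u y) - 1)) *\<^sub>R (g y - g0) \<partial>N)"
      unfolding A1_def A0_def using iA1 iA0 by (simp add: right_diff_distrib scaleR_diff_left)
    moreover have "norm (\<integral>y. (W y * (exp (k \<bullet> u y) - 1)) *\<^sub>R (g y - g0) \<partial>N) \<le> (C * norm k) * S * N0"
    proof (rule dom(2))
      fix y
      have "norm ((W y * (exp (k \<bullet> u y) - 1)) *\<^sub>R (g y - g0)) = W y * (\<bar>exp (k \<bullet> u y) - 1\<bar> * norm (g y - g0))"
        using W(1)[of y] by (simp add: abs_mult)
      also have "\<dots> \<le> W y * ((norm k * (norm (u y) * exp (norm (u y)))) * (C * norm (u y)))"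
        using em1[of y] g[of y] W(1)[of y] by (intro mult_left_mono mult_mono) auto
      also have "\<dots> = (C * norm k) * (W y * (norm (u y) * (norm (u y) * exp (norm (u y)))))" by simp
      also have "\<dots> \<le> (C * norm k) * (W y * tilt_weight (u y))"
        using C by (intro mult_left_mono Wt tilt_weight_bounds) auto
      finally show "norm ((W y * (exp (k \<bullet> u y) - 1)) *\<^sub>R (g y - g0)) \<le> (C * norm k) * (W y * tilt_weight (u y))" .
    qed (use C in auto)
    ultimately show ?thesis by simp
  qed
  have "norm k * S \<le> 1 / 2" using k S1 by (simp add: field_simps)
  then have "norm k * S * N0 \<le> 1 / 2 * N0" using N0 by (intro mult_right_mono) auto
  then have N1: "N0 / 2 \<le> N1" using dN by linarith
  then have N1p: "0 < N1" using N0 by linarith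
  have e1: "(\<integral>y. (W y * exp (k \<bullet> u y)) *\<^sub>R g y \<partial>N) = A1 + N1 *\<^sub>R g0"
  proof -
    have "(\<lambda>y. (W y * exp (k \<bullet> u y)) *\<^sub>R g y) = (\<lambda>y. (W y * exp (k \<bullet> u y)) *\<^sub>R (g y - g0) + (W y * exp (k \<bullet> u y)) *\<^sub>R g0)"
      by (simp add: scaleR_diff_right)
    then show ?thesis using iA1 iN1 by (simp add: A1_def N1_def)
  qed
  have e0: "(\<integral>y. W y *\<^sub>R g y \<partial>N) = A0 + N0 *\<^sub>R g0"
  proof -
    have "(\<lambda>y. W y *\<^sub>R g y) = (\<lambda>y. W y *\<^sub>R (g y - g0) + W y *\<^sub>R g0)"
      by (simp add: scaleR_diff_right)
    then show ?thesis using iA0 W(2) by (simp add: A0_def N0_def)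
  qed
  have "(A1 + N1 *\<^sub>R g0) /\<^sub>R N1 - (A0 + N0 *\<^sub>R g0) /\<^sub>R N0 = (1 / N1) *\<^sub>R (A1 - A0) - ((N1 - N0) / (N0 * N1)) *\<^sub>R A0"
  proof -
    have "(N1 - N0) / (N0 * N1) = 1 / N0 - 1 / N1" using N0 N1p by (simp add: field_simps)
    then show ?thesis using N0 N1p
      by (simp add: scaleR_add_right scaleR_diff_right scaleR_diff_left divide_inverse)
  qed
  also have "norm \<dots> \<le> (1 / N1) * norm (A1 - A0) + (\<bar>N1 - N0\<bar> / (N0 * N1)) * norm A0"
    using N0 N1p by (intro order_trans[OF norm_triangle_ineq4]) (simp add: abs_mult)
  also have "\<dots> \<le> (2 / N0) * ((C * norm k) * S * N0) + ((norm k * S * N0) / (N0 * (N0 / 2))) * (C * S * N0)"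
  proof (intro add_mono mult_mono)
    show "1 / N1 \<le> 2 / N0" using N1 N0 N1p by (simp add: field_simps)
    show "\<bar>N1 - N0\<bar> / (N0 * N1) \<le> (norm k * S * N0) / (N0 * (N0 / 2))"
      using N0 N1 dN S1 by (intro frac_le) auto
  qed (use dA bA0 N0 N1p S1 C in auto)
  also have "\<dots> = 2 * C * norm k * S * 1 + 2 * C * norm k * S * S" using N0 by (simp add: field_simps)
  also have "\<dots> \<le> 2 * C * norm k * S * S + 2 * C * norm k * S * S"
    using C S1 by (intro add_right_mono mult_left_mono) auto
  also have "\<dots> = 4 * C * S\<^sup>2 * norm k" by (simp add: power2_eq_square)
  finally show ?thesis unfolding e0 e1 N0_def[symmetric] N1_def[symmetric] .
qed

definition kern_avg :: "'a::euclidean_space measure \<Rightarrow> real \<Rightarrow> real \<Rightarrow> ('a \<Rightarrow> 'b::euclidean_space) \<Rightarrow> 'a \<Rightarrow> 'b" where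
  "kern_avg N a b g x = (\<integral>y. kern a b x y *\<^sub>R g y \<partial>N) /\<^sub>R (\<integral>y. kern a b x y \<partial>N)"

lemma kern_mean_eq_avg: "kern_mean N a b = kern_avg N a b (\<lambda>y. y)"
  by (simp add: kern_mean_def kern_avg_def fun_eq_iff)

text \<open>Moving \<open>x\<close> by \<open>k\<close> tilts the conditional law by \<open>exp ((b / a\<^sup>2) k \<bullet> y)\<close>, up to normalization.\<close>

lemma kern_shift:
  "kern a b (x + k) y =
    exp (- (2 * (k \<bullet> x) + (norm k)\<^sup>2) / (2 * a\<^sup>2) + (b / a\<^sup>2) * (k \<bullet> y0)) * (kern a b x y * exp ((b / a\<^sup>2) * (k \<bullet> (y - y0))))"
proof -
  have "(norm (x + k - b *\<^sub>R y))\<^sup>2 = (norm (x - b *\<^sub>R y))\<^sup>2 + (2 * (k \<bullet> x) + (norm k)\<^sup>2) - 2 * b * (k \<bullet> y)"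
    by (simp add: power2_norm_eq_inner inner_add inner_diff inner_commute algebra_simps)
  moreover have "(b / a\<^sup>2) * (k \<bullet> y0) + (b / a\<^sup>2) * (k \<bullet> (y - y0)) = 2 * b * (k \<bullet> y) / (2 * a\<^sup>2)"
    by (simp add: inner_diff_right right_diff_distrib)
  ultimately have "- (norm (x + k - b *\<^sub>R y))\<^sup>2 / (2 * a\<^sup>2) =
      (- (2 * (k \<bullet> x) + (norm k)\<^sup>2) / (2 * a\<^sup>2) + (b / a\<^sup>2) * (k \<bullet> y0)) + (- (norm (x - b *\<^sub>R y))\<^sup>2 / (2 * a\<^sup>2) + (b / a\<^sup>2) * (k \<bullet> (y - y0)))"
    by (simp only: minus_divide_left[symmetric] add_divide_distrib diff_divide_distrib)
  then show ?thesis by (simp only: kern_def exp_add)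
qed

lemma mult_norm_scaled: "0 < e \<Longrightarrow> C * e * norm (v /\<^sub>R e) = C * norm v"
  by (simp add: field_simps)

lemma kern_avg_lipschitz:
  fixes N :: "'a::euclidean_space measure" and g :: "'a \<Rightarrow> 'b::euclidean_space"
  assumes sets: "sets N = sets borel" and g[measurable]: "g \<in> borel_measurable borel"
    and gl: "\<And>y z. norm (g y - g z) \<le> C * norm (y - z)" and C: "0 \<le> C" and e: "0 < e" and S: "0 < S"
    and int: "\<And>x. integrable N (\<lambda>y. kern a b x y)" "\<And>x. 0 < (\<integral>y. kern a b x y \<partial>N)"
    and mom: "\<And>x. \<exists>y0. integrable N (\<lambda>y. kern a b x y * tilt_weight ((y - y0) /\<^sub>R e)) \<and>
       (\<integral>y. kern a b x y * tilt_weight ((y - y0) /\<^sub>R e) \<partial>N) \<le> S * (\<integral>y. kern a b x y \<partial>N)"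
  shows "norm (kern_avg N a b g x - kern_avg N a b g x') \<le> (4 * C * S\<^sup>2 * e\<^sup>2 * (\<bar>b\<bar> / a\<^sup>2)) * norm (x - x')"
proof (rule lipschitz_of_local[where r="1 / (2 * S * e * (\<bar>b\<bar> / a\<^sup>2 + 1))"])
  note [measurable_cong] = sets
  define q where "q = b / a\<^sup>2"
  have aq: "\<bar>q\<bar> = \<bar>b\<bar> / a\<^sup>2" by (simp add: q_def)
  show "0 < 1 / (2 * S * e * (\<bar>b\<bar> / a\<^sup>2 + 1))"
    using e S by (intro divide_pos_pos mult_pos_pos) (auto intro: add_nonneg_pos)
  fix x k :: 'a
  assume k: "norm k \<le> 1 / (2 * S * e * (\<bar>b\<bar> / a\<^sup>2 + 1))"
  obtain y0 where y0: "integrable N (\<lambda>y. kern a b x y * tilt_weight ((y - y0) /\<^sub>R e))"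
     "(\<integral>y. kern a b x y * tilt_weight ((y - y0) /\<^sub>R e) \<partial>N) \<le> S * (\<integral>y. kern a b x y \<partial>N)"
    using mom[of x] by blast
  define k' where "k' = (e * q) *\<^sub>R k"
  define c where "c = exp (- (2 * (k \<bullet> x) + (norm k)\<^sup>2) / (2 * a\<^sup>2) + q * (k \<bullet> y0))"
  have nk': "norm k' = e * \<bar>q\<bar> * norm k" using e by (simp add: k'_def abs_mult)
  have "norm k' \<le> e * (\<bar>q\<bar> + 1) * (1 / (2 * S * e * (\<bar>q\<bar> + 1)))"
    unfolding nk' using e k[folded aq] by (intro mult_mono) auto
  also have "\<dots> = 1 / (2 * S)"
  proof -
    have "e * p * (1 / (2 * S * e * p)) = 1 / (2 * S)" if "0 < p" for p using e that by simp
    moreover have "0 < \<bar>q\<bar> + 1" by (simp add: add_nonneg_pos)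
    ultimately show ?thesis by blast
  qed
  finally have k'S: "norm k' \<le> 1 / (2 * S)" .
  have ks: "kern a b (x + k) y = c * (kern a b x y * exp (k' \<bullet> ((y - y0) /\<^sub>R e)))" for y
    using kern_shift[of a b x k y y0] e by (simp add: c_def k'_def q_def)
  have c: "c \<noteq> 0" by (simp add: c_def)
  have avg: "kern_avg N a b g (x + k) = (\<integral>y. (kern a b x y * exp (k' \<bullet> ((y - y0) /\<^sub>R e))) *\<^sub>R g y \<partial>N) /\<^sub>R (\<integral>y. kern a b x y * exp (k' \<bullet> ((y - y0) /\<^sub>R e)) \<partial>N)"
  proof -
    have "(\<integral>y. kern a b (x + k) y *\<^sub>R g y \<partial>N) = (\<integral>y. c *\<^sub>R ((kern a b x y * exp (k' \<bullet> ((y - y0) /\<^sub>R e))) *\<^sub>R g y) \<partial>N)"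
      by (simp only: ks scaleR_scaleR)
    also have "\<dots> = c *\<^sub>R (\<integral>y. (kern a b x y * exp (k' \<bullet> ((y - y0) /\<^sub>R e))) *\<^sub>R g y \<partial>N)"
      by (rule integral_scaleR_right)
    finally have 1: "(\<integral>y. kern a b (x + k) y *\<^sub>R g y \<partial>N) = c *\<^sub>R (\<integral>y. (kern a b x y * exp (k' \<bullet> ((y - y0) /\<^sub>R e))) *\<^sub>R g y \<partial>N)" .
    have 2: "(\<integral>y. kern a b (x + k) y \<partial>N) = c * (\<integral>y. kern a b x y * exp (k' \<bullet> ((y - y0) /\<^sub>R e)) \<partial>N)"
      unfolding ks by (rule integral_mult_right_zero)
    show ?thesis unfolding kern_avg_def 1 2 using c by (simp add: inverse_mult_distrib)
  qed
  have "norm (kern_avg N a b g (x + k) - kern_avg N a b g x) \<le> 4 * (C * e) * S\<^sup>2 * norm k'"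
    unfolding avg unfolding kern_avg_def
  proof (rule tilted_average_difference[where ?g0.0="g y0", OF _ _ _ _ int(1) int(2) y0 _ _ k'S])
    show "norm (g y - g y0) \<le> C * e * norm ((y - y0) /\<^sub>R e)" for y using gl[of y y0] by (simp only: mult_norm_scaled[OF e])
    show "0 \<le> C * e" using C e by simp
    show "0 \<le> kern a b x y" for y by (rule less_imp_le[OF kern_pos])
  qed measurable
  also have "\<dots> = (4 * C * S\<^sup>2 * e\<^sup>2 * (\<bar>b\<bar> / a\<^sup>2)) * norm k"
    unfolding nk' aq by (simp add: power2_eq_square)
  finally show "norm (kern_avg N a b g (x + k) - kern_avg N a b g x) \<le> (4 * C * S\<^sup>2 * e\<^sup>2 * (\<bar>b\<bar> / a\<^sup>2)) * norm k" .
qed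

lemma lborel_integral_affine:
  fixes f :: "'a::euclidean_space \<Rightarrow> 'b::euclidean_space"
  assumes [measurable]: "f \<in> borel_measurable borel" and c: "0 < c"
  shows "integrable lborel f \<longleftrightarrow> integrable lborel (\<lambda>u. f (t + c *\<^sub>R u))"
    "(\<integral>y. f y \<partial>lborel) = c ^ DIM('a) *\<^sub>R (\<integral>u. f (t + c *\<^sub>R u) \<partial>lborel)"
proof -
  have l: "lborel = density (distr lborel borel (\<lambda>u. t + c *\<^sub>R u)) (\<lambda>_::'a. ennreal (c ^ DIM('a)))"
    using lborel_affine[of c t] c by (simp add: ennreal_power)
  show "integrable lborel f \<longleftrightarrow> integrable lborel (\<lambda>u. f (t + c *\<^sub>R u))"
  proof -
    have "integrable lborel f \<longleftrightarrow> integrable lborel (\<lambda>u. c ^ DIM('a) *\<^sub>R f (t + c *\<^sub>R u))"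
      using c by (subst l) (simp add: integrable_density integrable_distr_eq)
    also have "\<dots> \<longleftrightarrow> integrable lborel (\<lambda>u. f (t + c *\<^sub>R u))"
    proof
      assume "integrable lborel (\<lambda>u. c ^ DIM('a) *\<^sub>R f (t + c *\<^sub>R u))"
      then have "integrable lborel (\<lambda>u. inverse (c ^ DIM('a)) *\<^sub>R (c ^ DIM('a) *\<^sub>R f (t + c *\<^sub>R u)))"
        by (rule integrable_scaleR_right)
      then show "integrable lborel (\<lambda>u. f (t + c *\<^sub>R u))" using c by simp
    qed (rule integrable_scaleR_right)
    finally show ?thesis .
  qed
  show "(\<integral>y. f y \<partial>lborel) = c ^ DIM('a) *\<^sub>R (\<integral>u. f (t + c *\<^sub>R u) \<partial>lborel)"
    using c by (subst l) (simp add: integral_density integral_distr)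
qed

context gaussian_pair begin

lemma integrable_tilt_envelope:
  assumes l: "0 < l"
  shows "integrable lborel (\<lambda>u :: real ^ 'n. exp (- (l / 2 * (norm u)\<^sup>2 - L * norm u)) * tilt_weight u)"
proof (rule Bochner_Integration.integrable_bound)
  show "integrable lborel (\<lambda>u :: real ^ 'n. exp ((L + 3)\<^sup>2 / l) * exp (- (l / 4) * (norm u)\<^sup>2))"
    using l by (intro integrable_mult_right integrable_exp_neg_square) auto
  have "exp (- (l / 2 * r\<^sup>2 - L * r)) * ((1 + r)\<^sup>2 * exp r) \<le> exp ((L + 3)\<^sup>2 / l) * exp (- (l / 4) * r\<^sup>2)" if r: "0 \<le> r" for r :: real
  proof -
    have "(1 + r)\<^sup>2 \<le> (exp r)\<^sup>2" using r exp_ge_add_one_self[of r] by (intro power_mono) auto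
    then have "exp (- (l / 2 * r\<^sup>2 - L * r)) * ((1 + r)\<^sup>2 * exp r) \<le> exp (- (l / 2 * r\<^sup>2 - L * r)) * ((exp r)\<^sup>2 * exp r)"
      by (intro mult_left_mono mult_right_mono) auto
    also have "\<dots> = exp (- (l / 2 * r\<^sup>2 - L * r) + 3 * r)"
      by (simp add: power2_eq_square exp_add[symmetric])
    also have "\<dots> \<le> exp ((L + 3)\<^sup>2 / l + - (l / 4) * r\<^sup>2)"
    proof -
      have "0 \<le> (l * r / 2 - (L + 3))\<^sup>2 / l" using l by simp
      also have "\<dots> = l / 4 * r\<^sup>2 - (L + 3) * r + (L + 3)\<^sup>2 / l"
        using l by (simp add: power2_eq_square field_simps)
      finally show ?thesis by (simp add: algebra_simps)
    qed
    finally show ?thesis by (simp only: exp_add)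
  qed
  then show "AE u in lborel. norm (exp (- (l / 2 * (norm u)\<^sup>2 - L * norm u)) * tilt_weight u) \<le> norm (exp ((L + 3)\<^sup>2 / l) * exp (- (l / 4) * (norm (u :: real ^ 'n))\<^sup>2))"
    by (intro AE_I2) (simp add: tilt_weight_def abs_mult)
qed measurable

lemma envelope_moment:
  assumes l: "0 < l" and l': "0 < l'" and L: "0 \<le> L"
  obtains S where "0 < S"
    "\<And>(V :: real ^ 'n \<Rightarrow> real) y0 a. \<lbrakk>V \<in> borel_measurable borel; 0 < a;
       \<And>u. l / 2 * (norm u)\<^sup>2 - L * norm u \<le> V (y0 + a *\<^sub>R u) - V y0;
       \<And>u. V (y0 + a *\<^sub>R u) - V y0 \<le> l' / 2 * (norm u)\<^sup>2 + L * norm u\<rbrakk> \<Longrightarrow>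
      integrable lborel (\<lambda>y. exp (- V y) * tilt_weight ((y - y0) /\<^sub>R a)) \<and>
      (\<integral>y. exp (- V y) * tilt_weight ((y - y0) /\<^sub>R a) \<partial>lborel) \<le> S * (\<integral>y. exp (- V y) \<partial>lborel)"
proof -
  define I where "I = (\<integral>u. exp (- (l / 2 * (norm u)\<^sup>2 - L * norm u)) * tilt_weight u \<partial>(lborel :: (real ^ 'n) measure))"
  define J where "J = (\<integral>u. exp (- (l' / 2 * (norm u)\<^sup>2 + L * norm u)) \<partial>(lborel :: (real ^ 'n) measure))"
  have iI: "integrable lborel (\<lambda>u :: real ^ 'n. exp (- (l / 2 * (norm u)\<^sup>2 - L * norm u)) * tilt_weight u)"
    by (rule integrable_tilt_envelope[OF l])
  have iJ: "integrable lborel (\<lambda>u :: real ^ 'n. exp (- (l' / 2 * (norm u)\<^sup>2 + L * norm u)))"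
  proof (rule Bochner_Integration.integrable_bound)
    show "integrable lborel (\<lambda>u :: real ^ 'n. exp (- (l' / 2) * (norm u)\<^sup>2))"
      using l' by (intro integrable_exp_neg_square) auto
    show "AE u in lborel. norm (exp (- (l' / 2 * (norm u)\<^sup>2 + L * norm u))) \<le> norm (exp (- (l' / 2) * (norm (u :: real ^ 'n))\<^sup>2))"
      using L by (intro AE_I2) auto
  qed measurable
  note pos = integral_pos[where N="lborel :: (real ^ 'n) measure", simplified]
  have J: "0 < J" unfolding J_def by (rule pos[OF iJ]) simp
  have I: "0 < I" unfolding I_def
    by (rule pos[OF iI]) (intro mult_pos_pos, simp, rule less_le_trans[OF _ tilt_weight_bounds(1)], simp)
  show thesis
  proof (rule that[of "I / J"])
    show "0 < I / J" using I J by simp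
    fix V :: "real ^ 'n \<Rightarrow> real" and y0 a
    assume [measurable]: "V \<in> borel_measurable borel" and a: "0 < a"
      and lo: "\<And>u. l / 2 * (norm u)\<^sup>2 - L * norm u \<le> V (y0 + a *\<^sub>R u) - V y0"
      and up: "\<And>u. V (y0 + a *\<^sub>R u) - V y0 \<le> l' / 2 * (norm u)\<^sup>2 + L * norm u"
    define c where "c = exp (- V y0)"
    have c: "0 < c" by (simp add: c_def)
    have lo': "exp (- V (y0 + a *\<^sub>R u)) \<le> c * exp (- (l / 2 * (norm u)\<^sup>2 - L * norm u))" for u
      using lo[of u] by (simp add: c_def exp_add[symmetric])
    have up': "c * exp (- (l' / 2 * (norm u)\<^sup>2 + L * norm u)) \<le> exp (- V (y0 + a *\<^sub>R u))" for u
      using up[of u] by (simp add: c_def exp_add[symmetric])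
    have tw: "0 \<le> tilt_weight u" for u :: "real ^ 'n" using tilt_weight_bounds(1)[of u] by linarith
    have lo'': "exp (- V (y0 + a *\<^sub>R u)) * tilt_weight u \<le> c * (exp (- (l / 2 * (norm u)\<^sup>2 - L * norm u)) * tilt_weight u)" for u
      using mult_right_mono[OF lo' tw] by (simp only: mult.assoc)
    have i1: "integrable lborel (\<lambda>u. exp (- V (y0 + a *\<^sub>R u)) * tilt_weight u)"
      by (rule Bochner_Integration.integrable_bound[OF integrable_mult_right[OF iI, of c]])
        (use lo'' tw c in \<open>auto simp: abs_mult\<close>)
    have i2: "integrable lborel (\<lambda>u. exp (- V (y0 + a *\<^sub>R u)))"
    proof (rule Bochner_Integration.integrable_bound[OF i1])
      show "AE u in lborel. norm (exp (- V (y0 + a *\<^sub>R u))) \<le> norm (exp (- V (y0 + a *\<^sub>R u)) * tilt_weight u)"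
        using tw by (intro AE_I2) (simp add: abs_mult tilt_weight_bounds)
    qed measurable
    have m: "(\<lambda>y. exp (- V y) * tilt_weight ((y - y0) /\<^sub>R a)) \<in> borel_measurable borel" "(\<lambda>y. exp (- V y)) \<in> borel_measurable borel"
      by measurable
    have "(\<integral>u. exp (- V (y0 + a *\<^sub>R u)) * tilt_weight u \<partial>lborel) \<le> (\<integral>u. c * (exp (- (l / 2 * (norm u)\<^sup>2 - L * norm u)) * tilt_weight u) \<partial>(lborel :: (real ^ 'n) measure))"
      using lo'' by (intro integral_mono i1 integrable_mult_right iI)
    also have "\<dots> = (I / J) * (c * J)" using J by (simp add: I_def)
    also have "\<dots> = (I / J) * (\<integral>u. c * exp (- (l' / 2 * (norm u)\<^sup>2 + L * norm u)) \<partial>(lborel :: (real ^ 'n) measure))" by (simp add: J_def)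
    also have "\<dots> \<le> (I / J) * (\<integral>u. exp (- V (y0 + a *\<^sub>R u)) \<partial>lborel)"
      using I J up' by (intro mult_left_mono integral_mono i2 integrable_mult_right iJ) auto
    finally have "(\<integral>u. exp (- V (y0 + a *\<^sub>R u)) * tilt_weight u \<partial>lborel) \<le> (I / J) * (\<integral>u. exp (- V (y0 + a *\<^sub>R u)) \<partial>lborel)" .
    then have "a ^ CARD('n) * (\<integral>u. exp (- V (y0 + a *\<^sub>R u)) * tilt_weight u \<partial>lborel) \<le> a ^ CARD('n) * ((I / J) * (\<integral>u. exp (- V (y0 + a *\<^sub>R u)) \<partial>lborel))"
      using a by (intro mult_left_mono) auto
    then show "integrable lborel (\<lambda>y. exp (- V y) * tilt_weight ((y - y0) /\<^sub>R a)) \<and>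
      (\<integral>y. exp (- V y) * tilt_weight ((y - y0) /\<^sub>R a) \<partial>lborel) \<le> I / J * (\<integral>y. exp (- V y) \<partial>lborel)"
      using i1 a unfolding lborel_integral_affine[OF m(1) a, of y0] lborel_integral_affine(2)[OF m(2) a, of y0]
      by (simp add: mult.left_commute)
  qed
qed

end

section \<open>Targets with a smooth potential\<close>

lemma kern_avg_near:
  fixes N :: "'a::euclidean_space measure" and g :: "'a \<Rightarrow> 'b::euclidean_space"
  assumes sets: "sets N = sets borel" and g[measurable]: "g \<in> borel_measurable borel"
    and gl: "\<And>y. norm (g y - g y0) \<le> C * norm (y - y0)" and C: "0 \<le> C" and e: "0 < e"
    and int: "integrable N (\<lambda>y. kern a b x y)" "0 < (\<integral>y. kern a b x y \<partial>N)"
    and mom: "integrable N (\<lambda>y. kern a b x y * tilt_weight ((y - y0) /\<^sub>R e))"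
      "(\<integral>y. kern a b x y * tilt_weight ((y - y0) /\<^sub>R e) \<partial>N) \<le> S * (\<integral>y. kern a b x y \<partial>N)"
  shows "norm (kern_avg N a b g x - g y0) \<le> C * e * S"
proof -
  note [measurable_cong] = sets
  let ?N0 = "\<integral>y. kern a b x y \<partial>N"
  have le: "norm (kern a b x y *\<^sub>R (g y - g y0)) \<le> C * e * (kern a b x y * tilt_weight ((y - y0) /\<^sub>R e))" for y
  proof -
    have "norm (g y - g y0) \<le> C * e * norm ((y - y0) /\<^sub>R e)" using gl[of y] by (simp only: mult_norm_scaled[OF e])
    also have "\<dots> \<le> C * e * tilt_weight ((y - y0) /\<^sub>R e)"
      using C e by (intro mult_left_mono tilt_weight_bounds) auto
    finally show ?thesis using kern_pos[of a b x y] by (simp add: mult.left_commute mult_left_mono)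
  qed
  have i: "integrable N (\<lambda>y. kern a b x y *\<^sub>R (g y - g y0))"
    by (rule Bochner_Integration.integrable_bound[OF integrable_mult_right[OF mom(1), of "C * e"]])
      (measurable, use le in \<open>auto intro!: AE_I2 order_trans[OF _ abs_ge_self]\<close>)
  have "(\<integral>y. kern a b x y *\<^sub>R g y \<partial>N) = (\<integral>y. kern a b x y *\<^sub>R (g y - g y0) + kern a b x y *\<^sub>R g y0 \<partial>N)"
    by (simp add: scaleR_diff_right)
  also have "\<dots> = (\<integral>y. kern a b x y *\<^sub>R (g y - g y0) \<partial>N) + ?N0 *\<^sub>R g y0" using i int by simp
  finally have "kern_avg N a b g x - g y0 = (\<integral>y. kern a b x y *\<^sub>R (g y - g y0) \<partial>N) /\<^sub>R ?N0"
    using int by (simp add: kern_avg_def scaleR_add_right)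
  moreover have "norm (\<integral>y. kern a b x y *\<^sub>R (g y - g y0) \<partial>N) \<le> C * e * S * ?N0"
  proof -
    have "norm (\<integral>y. kern a b x y *\<^sub>R (g y - g y0) \<partial>N) \<le> (\<integral>y. C * e * (kern a b x y * tilt_weight ((y - y0) /\<^sub>R e)) \<partial>N)"
      by (rule Bochner_Integration.integral_norm_bound_integral[OF i]) (use mom le in auto)
    also have "\<dots> = C * e * (\<integral>y. kern a b x y * tilt_weight ((y - y0) /\<^sub>R e) \<partial>N)" by simp
    also have "\<dots> \<le> C * e * (S * ?N0)" using mom(2) C e by (intro mult_left_mono) auto
    finally show ?thesis by (simp only: mult.assoc)
  qed
  ultimately show ?thesis using int(2) by (simp add: divide_simps mult.commute)
qed

locale potential_target = gaussian_pair M Z X1 \<nu>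
  for M :: "'w measure" and Z X1 :: "'w \<Rightarrow> real ^ 'n" and \<nu> :: "(real ^ 'n) measure" +
  fixes U :: "real ^ 'n \<Rightarrow> real" and G :: "real ^ 'n \<Rightarrow> real ^ 'n" and K :: real
  assumes nu_density: "\<nu> = density lborel (\<lambda>x. ennreal (exp (- U x)))"
    and U_measurable [measurable]: "U \<in> borel_measurable borel"
    and K: "0 < K" and G_lipschitz: "\<And>x y. norm (G x - G y) \<le> K * norm (x - y)"
    and U_upper: "\<And>y h. U (y + h) \<le> U y + G y \<bullet> h + K / 2 * (norm h)\<^sup>2"
begin

definition post :: "real \<Rightarrow> real \<Rightarrow> real ^ 'n \<Rightarrow> real ^ 'n \<Rightarrow> real" where
  "post a b x y = U y + (norm (x - b *\<^sub>R y))\<^sup>2 / (2 * a\<^sup>2)"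

lemma post_measurable [measurable]: "post a b x \<in> borel_measurable borel"
  unfolding post_def[abs_def] by measurable

lemma exp_post: "exp (- post a b x y) = exp (- U y) * kern a b x y"
  by (simp add: post_def kern_def exp_add[symmetric])

lemma G_continuous: "continuous_on UNIV G"
proof -
  have "K-lipschitz_on UNIV G" by (rule lipschitz_onI) (use G_lipschitz K in \<open>auto simp: dist_norm\<close>)
  then show ?thesis by (rule lipschitz_on_continuous_on)
qed

lemma G_measurable [measurable]: "G \<in> borel_measurable borel"
  by (rule borel_measurable_continuous_onI[OF G_continuous])

lemma integral_kern_nu:
  fixes f :: "real ^ 'n \<Rightarrow> 'b::euclidean_space"
  assumes [measurable]: "f \<in> borel_measurable borel"
  shows "integrable \<nu> (\<lambda>y. kern a b x y *\<^sub>R f y) \<longleftrightarrow> integrable lborel (\<lambda>y. exp (- post a b x y) *\<^sub>R f y)"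
    "(\<integral>y. kern a b x y *\<^sub>R f y \<partial>\<nu>) = (\<integral>y. exp (- post a b x y) *\<^sub>R f y \<partial>lborel)"
  unfolding nu_density by (simp_all add: integrable_density integral_density exp_post)

lemmas integral_kern_nu_real = integral_kern_nu[where 'b=real, unfolded real_scaleR_def]

lemma stein_identity:
  assumes a: "0 < a"
  shows "kern_avg \<nu> a b G x = (b / a\<^sup>2) *\<^sub>R (x - b *\<^sub>R kern_mean \<nu> a b x)"
proof -
  define E where "E y = exp (- post a b x y)" for y
  have Em[measurable]: "E \<in> borel_measurable borel" unfolding E_def[abs_def] by measurable
  have Ep: "0 < E y" for y by (simp add: E_def)
  define g where "g y = G y - (b / a\<^sup>2) *\<^sub>R (x - b *\<^sub>R y)" for y
  define C where "C = K + b\<^sup>2 / a\<^sup>2"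
  have C: "0 \<le> C" using K by (simp add: C_def)
  have G_growth: "norm (G y) \<le> (norm (G 0) + K) * (1 + norm y)" for y
  proof -
    have "norm (G y) \<le> norm (G 0) + norm (G y - G 0)" by (metis add.commute diff_add_cancel norm_triangle_ineq)
    moreover have "norm (G y - G 0) \<le> K * norm y" using G_lipschitz[of y 0] by simp
    moreover have "0 \<le> norm y * norm (G 0)" by simp
    moreover have "(norm (G 0) + K) * (1 + norm y) = norm (G 0) + K + K * norm y + norm y * norm (G 0)"
      by (simp add: algebra_simps)
    ultimately show ?thesis using K by linarith
  qed
  have iE: "integrable lborel E" and iEy: "integrable lborel (\<lambda>y. E y *\<^sub>R y)" and iEG: "integrable lborel (\<lambda>y. E y *\<^sub>R G y)"
    using integral_kern_nu_real(1)[of "\<lambda>_. 1" a b x] integrable_kern[of a b x]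
      integral_kern_nu(1)[of "\<lambda>y. y" a b x] integrable_kern_id[of a b x]
      integral_kern_nu(1)[of G a b x] integrable_kern_growth[OF G_measurable G_growth, of a b x]
    by (simp_all add: E_def[abs_def])
  have Eg: "(\<lambda>y. E y *\<^sub>R g y) = (\<lambda>y. E y *\<^sub>R G y - (b / a\<^sup>2) *\<^sub>R (E y *\<^sub>R x) + (b / a\<^sup>2 * b) *\<^sub>R (E y *\<^sub>R y))"
    by (simp add: g_def fun_eq_iff algebra_simps)
  have iEg: "integrable lborel (\<lambda>y. E y *\<^sub>R g y)"
    unfolding Eg
    by (intro Bochner_Integration.integrable_add Bochner_Integration.integrable_diff integrable_scaleR_right integrable_scaleR_left iE iEy iEG)
  have half: "0 \<le> (\<integral>y. E y *\<^sub>R g y \<partial>lborel) \<bullet> h" for h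
  proof (rule field_le_epsilon)
    fix e :: real assume e: "0 < e"
    define I where "I = (\<integral>y. E y \<partial>lborel)"
    have I: "0 \<le> I" unfolding I_def by (intro integral_nonneg_AE) (simp add: less_imp_le[OF Ep])
    define s where "s = e / (C / 2 * (norm h)\<^sup>2 * I + 1)"
    have den: "0 < C / 2 * (norm h)\<^sup>2 * I + 1" using C I by (intro add_nonneg_pos mult_nonneg_nonneg) auto
    have s: "0 < s" using e den by (simp add: s_def)
    have up: "post a b x (y + s *\<^sub>R h) \<le> post a b x y + s * (g y \<bullet> h) + C / 2 * (s\<^sup>2 * (norm h)\<^sup>2)" for y
    proof -
      have n: "(norm (x - b *\<^sub>R (y + s *\<^sub>R h)))\<^sup>2 = (norm (x - b *\<^sub>R y))\<^sup>2 - 2 * b * s * ((x - b *\<^sub>R y) \<bullet> h) + b\<^sup>2 * (s\<^sup>2 * (norm h)\<^sup>2)"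
      proof -
        have "x - b *\<^sub>R (y + s *\<^sub>R h) = (x - b *\<^sub>R y) - (b * s) *\<^sub>R h" by (simp add: algebra_simps)
        then have "(norm (x - b *\<^sub>R (y + s *\<^sub>R h)))\<^sup>2 = ((x - b *\<^sub>R y) - (b * s) *\<^sub>R h) \<bullet> ((x - b *\<^sub>R y) - (b * s) *\<^sub>R h)"
          by (simp only: power2_norm_eq_inner)
        also have "\<dots> = (x - b *\<^sub>R y) \<bullet> (x - b *\<^sub>R y) - 2 * b * s * ((x - b *\<^sub>R y) \<bullet> h) + b\<^sup>2 * (s\<^sup>2 * (h \<bullet> h))"
          unfolding inner_diff_left[of "x - b *\<^sub>R y" "(b * s) *\<^sub>R h"] inner_diff_right[of _ "x - b *\<^sub>R y" "(b * s) *\<^sub>R h"]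
          by (simp only: inner_scaleR_left inner_scaleR_right inner_commute[of h "x - b *\<^sub>R y"] power2_eq_square) algebra
        finally show ?thesis by (simp only: power2_norm_eq_inner)
      qed
      have "U (y + s *\<^sub>R h) \<le> U y + s * (G y \<bullet> h) + K / 2 * (s\<^sup>2 * (norm h)\<^sup>2)"
        using U_upper[of y "s *\<^sub>R h"] by (simp add: power_mult_distrib)
      moreover have "(norm (x - b *\<^sub>R (y + s *\<^sub>R h)))\<^sup>2 / (2 * a\<^sup>2) = (norm (x - b *\<^sub>R y))\<^sup>2 / (2 * a\<^sup>2)
          - s * ((b / a\<^sup>2) * ((x - b *\<^sub>R y) \<bullet> h)) + (b\<^sup>2 / a\<^sup>2) / 2 * (s\<^sup>2 * (norm h)\<^sup>2)"
        unfolding n using a by (simp add: field_simps)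
      moreover have "s * (g y \<bullet> h) = s * (G y \<bullet> h) - s * ((b / a\<^sup>2) * ((x - b *\<^sub>R y) \<bullet> h))"
        by (simp only: g_def inner_diff_left[of "G y"] inner_scaleR_left right_diff_distrib)
      moreover have "C / 2 * (s\<^sup>2 * (norm h)\<^sup>2) = K / 2 * (s\<^sup>2 * (norm h)\<^sup>2) + (b\<^sup>2 / a\<^sup>2) / 2 * (s\<^sup>2 * (norm h)\<^sup>2)"
        by (simp add: C_def add_divide_distrib distrib_right)
      ultimately show ?thesis unfolding post_def by linarith
    qed
    have exp_lower: "1 - q \<le> exp (- q)" for q :: real using exp_ge_add_one_self[of "- q"] by simp
    have lo: "E y - s * (E y * (g y \<bullet> h)) - C / 2 * (s\<^sup>2 * (norm h)\<^sup>2) * E y \<le> E (s *\<^sub>R h + y)" for y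
    proof -
      have "E y * (1 - (s * (g y \<bullet> h) + C / 2 * (s\<^sup>2 * (norm h)\<^sup>2))) \<le> E y * exp (- (s * (g y \<bullet> h) + C / 2 * (s\<^sup>2 * (norm h)\<^sup>2)))"
        by (intro mult_left_mono less_imp_le[OF Ep] exp_lower)
      also have "\<dots> \<le> E (s *\<^sub>R h + y)"
        using up[of y] by (simp add: E_def exp_add[symmetric] add.commute)
      finally show ?thesis by (simp add: algebra_simps)
    qed
    have igh: "integrable lborel (\<lambda>y. E y * (g y \<bullet> h))"
      using integrable_inner_left[of h, OF iEg] by simp
    have iEs: "integrable lborel (\<lambda>y. E (s *\<^sub>R h + y))"
      using iE lborel_integral_affine(1)[OF Em, of 1 "s *\<^sub>R h"] by simp
    have "I - s * (\<integral>y. E y * (g y \<bullet> h) \<partial>lborel) - C / 2 * (s\<^sup>2 * (norm h)\<^sup>2) * I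
       = (\<integral>y. E y - s * (E y * (g y \<bullet> h)) - C / 2 * (s\<^sup>2 * (norm h)\<^sup>2) * E y \<partial>lborel)"
      using iE igh by (simp add: I_def)
    also have "\<dots> \<le> (\<integral>y. E (s *\<^sub>R h + y) \<partial>lborel)"
      using iE igh iEs lo by (intro integral_mono) auto
    also have "\<dots> = I" unfolding I_def by (rule integral_translation[OF Em])
    finally have "0 \<le> s * ((\<integral>y. E y * (g y \<bullet> h) \<partial>lborel) + C / 2 * (norm h)\<^sup>2 * I * s)"
      by (simp add: power2_eq_square algebra_simps)
    then have "0 \<le> (\<integral>y. E y * (g y \<bullet> h) \<partial>lborel) + C / 2 * (norm h)\<^sup>2 * I * s"
      using s by (simp only: zero_le_mult_iff) auto
    also have "C / 2 * (norm h)\<^sup>2 * I * s \<le> e"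
    proof -
      have "C / 2 * (norm h)\<^sup>2 * I * s \<le> (C / 2 * (norm h)\<^sup>2 * I + 1) * s" using s by (intro mult_right_mono) auto
      also have "\<dots> = e" using den by (simp add: s_def)
      finally show ?thesis .
    qed
    also have "(\<integral>y. E y * (g y \<bullet> h) \<partial>lborel) = (\<integral>y. E y *\<^sub>R g y \<partial>lborel) \<bullet> h"
      by (subst integral_inner_left[symmetric]) (auto simp: iEg)
    finally show "0 \<le> (\<integral>y. E y *\<^sub>R g y \<partial>lborel) \<bullet> h + e" by simp
  qed
  have "(\<integral>y. E y *\<^sub>R g y \<partial>lborel) = 0"
  proof -
    have "w = 0" if "\<And>h. 0 \<le> w \<bullet> h" for w :: "real ^ 'n"
    proof -
      have "w \<bullet> w \<le> 0" using that[of "- w"] by simp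
      then show ?thesis using inner_gt_zero_iff[of w] by linarith
    qed
    then show ?thesis using half by blast
  qed
  then have "(\<integral>y. E y *\<^sub>R G y \<partial>lborel) - (b / a\<^sup>2) *\<^sub>R ((\<integral>y. E y \<partial>lborel) *\<^sub>R x) + (b / a\<^sup>2 * b) *\<^sub>R (\<integral>y. E y *\<^sub>R y \<partial>lborel) = 0"
    unfolding Eg using iE iEy iEG by (simp del: scaleR_scaleR)
  then have e: "(\<integral>y. kern a b x y *\<^sub>R G y \<partial>\<nu>) = (b / a\<^sup>2) *\<^sub>R ((\<integral>y. kern a b x y \<partial>\<nu>) *\<^sub>R x) - (b / a\<^sup>2 * b) *\<^sub>R (\<integral>y. kern a b x y *\<^sub>R y \<partial>\<nu>)"
    using integral_kern_nu_real(2)[of "\<lambda>_. 1" a b x] integral_kern_nu(2)[of "\<lambda>y. y" a b x] integral_kern_nu(2)[of G a b x]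
    by (simp add: E_def algebra_simps)
  show ?thesis
    unfolding kern_avg_def e kern_mean_def using integral_kern_pos[of a b x] by (simp add: algebra_simps)
qed

end

locale potential_interpolation = schedule a b + potential_target M Z X1 \<nu> U G K
  for a b :: "real \<Rightarrow> real" and M :: "'w measure" and Z X1 :: "'w \<Rightarrow> real ^ 'n" and \<nu> :: "(real ^ 'n) measure"
    and U :: "real ^ 'n \<Rightarrow> real" and G :: "real ^ 'n \<Rightarrow> real ^ 'n" and K :: real +
  fixes S :: real
  assumes S: "0 < S"
    and post_moment: "\<And>t x. t \<in> {0..<1} \<Longrightarrow> \<exists>y0.
       integrable lborel (\<lambda>y. exp (- post (a t) (b t) x y) * tilt_weight ((y - y0) /\<^sub>R a t)) \<and>
       (\<integral>y. exp (- post (a t) (b t) x y) * tilt_weight ((y - y0) /\<^sub>R a t) \<partial>lborel) \<le> S * (\<integral>y. exp (- post (a t) (b t) x y) \<partial>lborel)"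
begin

lemma kern_moment:
  assumes t: "t \<in> {0..<1}"
  obtains y0 where "integrable \<nu> (\<lambda>y. kern (a t) (b t) x y * tilt_weight ((y - y0) /\<^sub>R a t))"
    "(\<integral>y. kern (a t) (b t) x y * tilt_weight ((y - y0) /\<^sub>R a t) \<partial>\<nu>) \<le> S * (\<integral>y. kern (a t) (b t) x y \<partial>\<nu>)"
proof -
  obtain y0 where y0: "integrable lborel (\<lambda>y. exp (- post (a t) (b t) x y) * tilt_weight ((y - y0) /\<^sub>R a t))"
    "(\<integral>y. exp (- post (a t) (b t) x y) * tilt_weight ((y - y0) /\<^sub>R a t) \<partial>lborel) \<le> S * (\<integral>y. exp (- post (a t) (b t) x y) \<partial>lborel)"
    using post_moment[OF t, of x] by blast
  have [measurable]: "(\<lambda>y. tilt_weight ((y - y0) /\<^sub>R a t)) \<in> borel_measurable borel" by measurable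
  show thesis
    using y0 integral_kern_nu_real[of "\<lambda>y. tilt_weight ((y - y0) /\<^sub>R a t)" "a t" "b t" x]
      integral_kern_nu_real(2)[of "\<lambda>_. 1" "a t" "b t" x]
    by (intro that[of y0]) simp_all
qed

lemma avg_lipschitz:
  fixes g :: "real ^ 'n \<Rightarrow> real ^ 'n"
  assumes t: "t \<in> {0..<1}" and g: "\<And>y z. norm (g y - g z) \<le> C * norm (y - z)" "0 \<le> C" "g \<in> borel_measurable borel"
  shows "norm (kern_avg \<nu> (a t) (b t) g x - kern_avg \<nu> (a t) (b t) g x') \<le> (4 * C * S\<^sup>2) * norm (x - x')"
proof -
  have a: "0 < a t" by (rule a_pos[OF t])
  have b: "0 \<le> b t" "b t \<le> 1" using b_nonneg[of t] b_le[of t] t by auto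
  have "norm (kern_avg \<nu> (a t) (b t) g x - kern_avg \<nu> (a t) (b t) g x') \<le> (4 * C * S\<^sup>2 * (a t)\<^sup>2 * (\<bar>b t\<bar> / (a t)\<^sup>2)) * norm (x - x')"
    by (rule kern_avg_lipschitz[OF sets_nu g(3,1,2) a S integrable_kern integral_kern_pos]) (rule kern_moment[OF t], intro exI conjI)
  also have "4 * C * S\<^sup>2 * (a t)\<^sup>2 * (\<bar>b t\<bar> / (a t)\<^sup>2) = 4 * C * S\<^sup>2 * b t" using a b by simp
  also have "4 * C * S\<^sup>2 * b t * norm (x - x') \<le> 4 * C * S\<^sup>2 * 1 * norm (x - x')"
    using b g(2) by (intro mult_right_mono mult_left_mono) auto
  finally show ?thesis by simp
qed

definition mean :: "real \<Rightarrow> real ^ 'n \<Rightarrow> real ^ 'n" where "mean t = kern_mean \<nu> (a t) (b t)"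
definition grad :: "real \<Rightarrow> real ^ 'n \<Rightarrow> real ^ 'n" where "grad t = kern_avg \<nu> (a t) (b t) G"

lemma mean_lip: "t \<in> {0..<1} \<Longrightarrow> norm (mean t x - mean t y) \<le> (4 * S\<^sup>2) * norm (x - y)"
  using avg_lipschitz[of t "\<lambda>y. y" 1 x y] unfolding mean_def kern_mean_eq_avg by simp

lemma grad_lip: "t \<in> {0..<1} \<Longrightarrow> norm (grad t x - grad t y) \<le> (4 * K * S\<^sup>2) * norm (x - y)"
  using avg_lipschitz[of t G K x y] K G_lipschitz unfolding grad_def by simp

lemma stein: "t \<in> {0..<1} \<Longrightarrow> x - b t *\<^sub>R mean t x = ((a t)\<^sup>2 / b t) *\<^sub>R grad t x" if "b t \<noteq> 0"
  using stein_identity[OF a_pos, of t "b t" x] that a_pos[of t] by (simp add: mean_def grad_def)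

lemma velocity_via_grad:
  assumes t: "t \<in> {0<..<1}"
  shows "cond_velocity (a t) (b t) (a' t) (b' t) x = (b' t / b t) *\<^sub>R x + (sq' t / b t - b' t * (a t)\<^sup>2 / (b t)\<^sup>2) *\<^sub>R grad t x"
proof -
  have a: "0 < a t" and b: "0 < b t" using a_pos[of t] b_pos[of t] t by auto
  have s: "x - b t *\<^sub>R mean t x = ((a t)\<^sup>2 / b t) *\<^sub>R grad t x" using b t by (intro stein) auto
  have "mean t x = (1 / b t) *\<^sub>R (x - (x - b t *\<^sub>R mean t x))" using b by simp
  then have m: "mean t x = (1 / b t) *\<^sub>R (x - ((a t)\<^sup>2 / b t) *\<^sub>R grad t x)" unfolding s .
  have q: "sq' t = a t * a' t" using t by (intro sq'_eq) auto
  have "(a' t / a t) *\<^sub>R (((a t)\<^sup>2 / b t) *\<^sub>R grad t x) = (sq' t / b t) *\<^sub>R grad t x"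
    using a by (simp add: q power2_eq_square)
  moreover have "b' t *\<^sub>R ((1 / b t) *\<^sub>R (x - ((a t)\<^sup>2 / b t) *\<^sub>R grad t x)) = (b' t / b t) *\<^sub>R x - (b' t * (a t)\<^sup>2 / (b t)\<^sup>2) *\<^sub>R grad t x"
    by (simp add: scaleR_diff_right power2_eq_square)
  moreover have "cond_velocity (a t) (b t) (a' t) (b' t) x = (a' t / a t) *\<^sub>R (((a t)\<^sup>2 / b t) *\<^sub>R grad t x) + b' t *\<^sub>R mean t x"
    by (simp only: cond_velocity_def mean_def[symmetric] s)
  ultimately have "cond_velocity (a t) (b t) (a' t) (b' t) x = (sq' t / b t) *\<^sub>R grad t x + ((b' t / b t) *\<^sub>R x - (b' t * (a t)\<^sup>2 / (b t)\<^sup>2) *\<^sub>R grad t x)"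
    by (simp only: m)
  then show ?thesis by (simp add: scaleR_diff_left)
qed

lemma bounded_on_interval:
  fixes f :: "real \<Rightarrow> real"
  assumes "continuous_on {s..u} f" obtains A where "0 \<le> A" "\<And>t. t \<in> {s..u} \<Longrightarrow> \<bar>f t\<bar> \<le> A"
proof -
  have "bounded (f ` {s..u})" by (intro compact_imp_bounded compact_continuous_image assms) simp
  then obtain A where A: "\<And>t. t \<in> {s..u} \<Longrightarrow> \<bar>f t\<bar> \<le> A" unfolding bounded_iff real_norm_def by blast
  show thesis by (rule that[of "max A 0"]) (use A in force)+
qed

lemma velocity_lip:
  obtains L where "0 < L" "\<And>t x y. t \<in> {0..<1} \<Longrightarrow>
     norm (cond_velocity (a t) (b t) (a' t) (b' t) x - cond_velocity (a t) (b t) (a' t) (b' t) y) \<le> L * norm (x - y)"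
proof -
  let ?v = "\<lambda>t. cond_velocity (a t) (b t) (a' t) (b' t)"
  have comb: "norm ((p *\<^sub>R x + q *\<^sub>R u) - (p *\<^sub>R y + q *\<^sub>R w)) \<le> (A + B * c) * norm (x - y)"
    if "\<bar>p\<bar> \<le> A" "\<bar>q\<bar> \<le> B" "norm (u - w) \<le> c * norm (x - y)" "0 \<le> B" for p q A B c and x y u w :: "real ^ 'n"
  proof -
    have "(p *\<^sub>R x + q *\<^sub>R u) - (p *\<^sub>R y + q *\<^sub>R w) = p *\<^sub>R (x - y) + q *\<^sub>R (u - w)" by (simp add: algebra_simps)
    also have "norm \<dots> \<le> \<bar>p\<bar> * norm (x - y) + \<bar>q\<bar> * norm (u - w)" by (rule norm_triangle_le) simp
    also have "\<dots> \<le> A * norm (x - y) + B * (c * norm (x - y))" using that by (intro add_mono mult_mono) auto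
    finally show ?thesis by (simp add: algebra_simps)
  qed
  have half: "{0..1/2} \<subseteq> {0..<1::real}" "{0..1/2} \<subseteq> {0..1::real}" "{1/2..1} \<subseteq> {0..1::real}" by auto
  have e: "continuous_on {0..1/2} a" "continuous_on {0..1/2} b" "continuous_on {0..1/2} a'" "continuous_on {0..1/2} b'"
    by (rule continuous_on_subset[OF a_continuous half(2)] continuous_on_subset[OF b_continuous half(2)]
        continuous_on_subset[OF a'_continuous half(1)] continuous_on_subset[OF b'_continuous half(2)])+
  have l: "continuous_on {1/2..1} a" "continuous_on {1/2..1} b" "continuous_on {1/2..1} sq'" "continuous_on {1/2..1} b'"
    by (rule continuous_on_subset[OF a_continuous half(3)] continuous_on_subset[OF b_continuous half(3)]
        continuous_on_subset[OF sq'_continuous half(3)] continuous_on_subset[OF b'_continuous half(3)])+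
  have nz: "\<forall>t\<in>{0..1/2}. a t \<noteq> 0" using a_pos half(1) by (metis less_irrefl subsetD)
  have nz': "\<forall>t\<in>{1/2..1}. b t \<noteq> 0" "\<forall>t\<in>{1/2..1}. (b t)\<^sup>2 \<noteq> 0"
  proof -
    show "\<forall>t\<in>{1/2..1}. b t \<noteq> 0"
    proof
      fix t :: real assume "t \<in> {1/2..1}"
      then have "0 < b t" by (intro b_pos) auto
      then show "b t \<noteq> 0" by simp
    qed
    then show "\<forall>t\<in>{1/2..1}. (b t)\<^sup>2 \<noteq> 0" by simp
  qed
  have early: "continuous_on {0..1/2} (\<lambda>t. a' t / a t)" "continuous_on {0..1/2} (\<lambda>t. b' t - a' t / a t * b t)"
    by (intro continuous_on_divide continuous_on_diff continuous_on_mult e nz)+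
  have late: "continuous_on {1/2..1} (\<lambda>t. b' t / b t)" "continuous_on {1/2..1} (\<lambda>t. sq' t / b t - b' t * (a t)\<^sup>2 / (b t)\<^sup>2)"
    by (intro continuous_on_divide continuous_on_diff continuous_on_mult continuous_on_power l nz')+
  obtain A1 where A1: "0 \<le> A1" "\<And>t. t \<in> {0..1/2} \<Longrightarrow> \<bar>a' t / a t\<bar> \<le> A1" using bounded_on_interval[OF early(1)] by blast
  obtain A2 where A2: "0 \<le> A2" "\<And>t. t \<in> {0..1/2} \<Longrightarrow> \<bar>b' t - a' t / a t * b t\<bar> \<le> A2" using bounded_on_interval[OF early(2)] by blast
  obtain A3 where A3: "0 \<le> A3" "\<And>t. t \<in> {1/2..1} \<Longrightarrow> \<bar>b' t / b t\<bar> \<le> A3" using bounded_on_interval[OF late(1)] by blast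
  obtain A4 where A4: "0 \<le> A4" "\<And>t. t \<in> {1/2..1} \<Longrightarrow> \<bar>sq' t / b t - b' t * (a t)\<^sup>2 / (b t)\<^sup>2\<bar> \<le> A4" using bounded_on_interval[OF late(2)] by blast
  define L1 where "L1 = A1 + A2 * (4 * S\<^sup>2)"
  define L2 where "L2 = A3 + A4 * (4 * K * S\<^sup>2)"
  have L: "0 \<le> L1" "0 \<le> L2" using A1 A2 A3 A4 K by (auto simp: L1_def L2_def)
  show thesis
  proof (rule that[of "L1 + L2 + 1"])
    show "0 < L1 + L2 + 1" using L by simp
    fix t x y assume t: "t \<in> {0..<1::real}"
    show "norm (?v t x - ?v t y) \<le> (L1 + L2 + 1) * norm (x - y)"
    proof (cases "t \<le> 1/2")
      case True
      have e: "?v t x = (a' t / a t) *\<^sub>R x + (b' t - a' t / a t * b t) *\<^sub>R mean t x" for x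
        by (simp add: cond_velocity_def mean_def algebra_simps)
      have "norm (?v t x - ?v t y) \<le> L1 * norm (x - y)"
        unfolding e L1_def using True t by (intro comb A1(2) A2 mean_lip) auto
      also have "\<dots> \<le> (L1 + L2 + 1) * norm (x - y)" using L by (intro mult_right_mono) auto
      finally show ?thesis .
    next
      case False
      then have t': "t \<in> {0<..<1}" "t \<in> {1/2..1}" using t by auto
      have "norm (?v t x - ?v t y) \<le> L2 * norm (x - y)"
        unfolding velocity_via_grad[OF t'(1)] L2_def using t t' by (intro comb A3(2) A4 grad_lip) auto
      also have "\<dots> \<le> (L1 + L2 + 1) * norm (x - y)" using L by (intro mult_right_mono) auto
      finally show ?thesis .
    qed
  qed
qed

lemma grad_near_mean:
  assumes t: "t \<in> {0..<1}"
  shows "norm (grad t x - G (mean t x)) \<le> 2 * K * S * a t"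
proof -
  have a: "0 < a t" by (rule a_pos[OF t])
  obtain y0 where y0: "integrable \<nu> (\<lambda>y. kern (a t) (b t) x y * tilt_weight ((y - y0) /\<^sub>R a t))"
    "(\<integral>y. kern (a t) (b t) x y * tilt_weight ((y - y0) /\<^sub>R a t) \<partial>\<nu>) \<le> S * (\<integral>y. kern (a t) (b t) x y \<partial>\<nu>)"
    using kern_moment[OF t] by blast
  have 1: "norm (grad t x - G y0) \<le> K * a t * S"
    unfolding grad_def
    by (rule kern_avg_near[OF sets_nu G_measurable G_lipschitz less_imp_le[OF K] a integrable_kern integral_kern_pos y0])
  have 2: "norm (mean t x - y0) \<le> 1 * a t * S"
    unfolding mean_def kern_mean_eq_avg
    by (rule kern_avg_near[OF sets_nu _ _ _ a integrable_kern integral_kern_pos y0]) auto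
  have "norm (G y0 - G (mean t x)) \<le> K * norm (y0 - mean t x)" by (rule G_lipschitz)
  also have "\<dots> \<le> K * (1 * a t * S)" using 2 K by (intro mult_left_mono) (auto simp: norm_minus_commute)
  finally have 3: "norm (G y0 - G (mean t x)) \<le> K * a t * S" by simp
  have "norm (grad t x - G (mean t x)) \<le> norm (grad t x - G y0) + norm (G y0 - G (mean t x))"
    by (metis diff_add_cancel diff_add_eq_diff_diff_swap add_diff_eq norm_triangle_ineq)
  then show ?thesis using 1 3 by (simp add: algebra_simps)
qed

lemma grad_limit: "((\<lambda>t. grad t x) \<longlongrightarrow> G x) (at_left 1)"
proof -
  have la: "(a \<longlongrightarrow> 0) (at_left 1)" using tendsto_at_left_1[OF a_continuous] by (simp add: a_1)
  have lb: "(b \<longlongrightarrow> 1) (at_left 1)" using tendsto_at_left_1[OF b_continuous] by (simp add: b_1)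
  have lab: "((\<lambda>t. (a t)\<^sup>2 / (b t)\<^sup>2) \<longlongrightarrow> 0\<^sup>2 / 1\<^sup>2) (at_left 1)" by (intro tendsto_intros la lb) simp
  define bd where "bd t = \<bar>1 / b t - 1\<bar> * norm x + (a t)\<^sup>2 / (b t)\<^sup>2 * (norm (G x) + 2 * K * S * a t)" for t
  have "(bd \<longlongrightarrow> \<bar>1 / 1 - 1\<bar> * norm x + 0\<^sup>2 / 1\<^sup>2 * (norm (G x) + 2 * K * S * 0)) (at_left 1)"
    unfolding bd_def[abs_def] by (intro tendsto_intros lab la lb) simp
  then have lbd: "((\<lambda>t. 2 * bd t) \<longlongrightarrow> 0) (at_left 1)" using tendsto_mult_right_zero by fastforce
  have ev: "\<forall>\<^sub>F t in at_left 1. t \<in> {0<..<1::real}"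
    using eventually_at_left_real[of 0 "1::real"] by simp
  have ev2: "\<forall>\<^sub>F t in at_left 1. (a t)\<^sup>2 / (b t)\<^sup>2 < 1 / (2 * K)"
    by (rule order_tendstoD(2)[OF lab]) (use K in simp)
  have "\<forall>\<^sub>F t in at_left 1. norm (mean t x - x) \<le> 2 * bd t"
    using ev ev2
  proof eventually_elim
    case (elim t)
    then have t: "t \<in> {0..<1}" and a: "0 < a t" and b: "0 < b t" using a_pos[of t] b_pos[of t] by auto
    have s: "x - b t *\<^sub>R mean t x = ((a t)\<^sup>2 / b t) *\<^sub>R grad t x" using b t by (intro stein) auto
    have "mean t x = (1 / b t) *\<^sub>R (x - (x - b t *\<^sub>R mean t x))" using b by simp
    then have "mean t x = (1 / b t) *\<^sub>R (x - ((a t)\<^sup>2 / b t) *\<^sub>R grad t x)" unfolding s .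
    then have "mean t x - x = (1 / b t - 1) *\<^sub>R x - ((a t)\<^sup>2 / (b t)\<^sup>2) *\<^sub>R grad t x"
      by (simp add: scaleR_diff_right scaleR_diff_left power2_eq_square)
    then have 1: "norm (mean t x - x) \<le> \<bar>1 / b t - 1\<bar> * norm x + (a t)\<^sup>2 / (b t)\<^sup>2 * norm (grad t x)"
      using norm_triangle_ineq4[of "(1 / b t - 1) *\<^sub>R x" "((a t)\<^sup>2 / (b t)\<^sup>2) *\<^sub>R grad t x"] by simp
    have "norm (grad t x) \<le> norm (grad t x - G (mean t x)) + norm (G (mean t x) - G x) + norm (G x)"
      using norm_triangle_ineq[of "grad t x - G (mean t x)" "G (mean t x) - G x"] norm_triangle_ineq[of "grad t x - G x" "G x"] by simp
    then have "norm (grad t x) \<le> (norm (G x) + 2 * K * S * a t) + K * norm (mean t x - x)"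
      using grad_near_mean[OF t, of x] G_lipschitz[of "mean t x" x] by linarith
    then have "(a t)\<^sup>2 / (b t)\<^sup>2 * norm (grad t x) \<le> (a t)\<^sup>2 / (b t)\<^sup>2 * ((norm (G x) + 2 * K * S * a t) + K * norm (mean t x - x))"
      by (intro mult_left_mono) auto
    moreover have "(a t)\<^sup>2 / (b t)\<^sup>2 * (K * norm (mean t x - x)) \<le> 1 / (2 * K) * (K * norm (mean t x - x))"
      using elim(2) K by (intro mult_right_mono) auto
    moreover have "1 / (2 * K) * (K * norm (mean t x - x)) = norm (mean t x - x) / 2" using K by simp
    moreover note distrib_left[of "(a t)\<^sup>2 / (b t)\<^sup>2" "norm (G x) + 2 * K * S * a t" "K * norm (mean t x - x)"]
    ultimately have "norm (mean t x - x) \<le> bd t + norm (mean t x - x) / 2"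
      using 1 unfolding bd_def by linarith
    then show ?case by simp
  qed
  then have "((\<lambda>t. mean t x - x) \<longlongrightarrow> 0) (at_left 1)" by (rule Lim_null_comparison[OF _ lbd])
  then have lm: "((\<lambda>t. mean t x) \<longlongrightarrow> x) (at_left 1)" by (simp add: LIM_zero_iff)
  have "isCont G x" using G_continuous by (simp add: continuous_on_eq_continuous_at)
  then have lG: "((\<lambda>t. G (mean t x)) \<longlongrightarrow> G x) (at_left 1)" by (rule isCont_tendsto_compose[OF _ lm])
  have "((\<lambda>t. grad t x - G (mean t x)) \<longlongrightarrow> 0) (at_left 1)"
  proof (rule Lim_null_comparison)
    show "\<forall>\<^sub>F t in at_left 1. norm (grad t x - G (mean t x)) \<le> 2 * K * S * a t"
      using ev by eventually_elim (auto intro!: grad_near_mean)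
    show "((\<lambda>t. 2 * K * S * a t) \<longlongrightarrow> 0) (at_left 1)" using tendsto_mult_left[OF la, of "2 * K * S"] by simp
  qed
  from tendsto_add[OF this lG] show ?thesis by simp
qed

lemma velocity_lim:
  "((\<lambda>t. cond_velocity (a t) (b t) (a' t) (b' t) x) \<longlongrightarrow> b' 1 *\<^sub>R x + sq' 1 *\<^sub>R G x) (at_left 1)"
proof -
  note l = tendsto_at_left_1[OF a_continuous] tendsto_at_left_1[OF b_continuous] tendsto_at_left_1[OF b'_continuous] tendsto_at_left_1[OF sq'_continuous]
  have "((\<lambda>t. (b' t / b t) *\<^sub>R x + (sq' t / b t - b' t * (a t)\<^sup>2 / (b t)\<^sup>2) *\<^sub>R grad t x)
      \<longlongrightarrow> (b' 1 / b 1) *\<^sub>R x + (sq' 1 / b 1 - b' 1 * (a 1)\<^sup>2 / (b 1)\<^sup>2) *\<^sub>R G x) (at_left 1)"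
    by (intro tendsto_intros l grad_limit) (simp_all add: b_1)
  moreover have "\<forall>\<^sub>F t in at_left 1. (b' t / b t) *\<^sub>R x + (sq' t / b t - b' t * (a t)\<^sup>2 / (b t)\<^sup>2) *\<^sub>R grad t x = cond_velocity (a t) (b t) (a' t) (b' t) x"
    using eventually_at_left_real[of 0 "1::real"] by (auto elim!: eventually_mono simp: velocity_via_grad)
  ultimately have "((\<lambda>t. cond_velocity (a t) (b t) (a' t) (b' t) x)
      \<longlongrightarrow> (b' 1 / b 1) *\<^sub>R x + (sq' 1 / b 1 - b' 1 * (a 1)\<^sup>2 / (b 1)\<^sup>2) *\<^sub>R G x) (at_left 1)"
    by (rule Lim_transform_eventually)
  then show ?thesis by (simp add: a_1 b_1)
qed

lemma regular: "\<exists>L v1. regular_interpolation a b M Z X1 \<nu> L v1"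
proof -
  obtain L where L: "0 < L" "\<And>t x y. t \<in> {0..<1} \<Longrightarrow>
     norm (cond_velocity (a t) (b t) (a' t) (b' t) x - cond_velocity (a t) (b t) (a' t) (b' t) y) \<le> L * norm (x - y)"
    using velocity_lip by blast
  have "regular_interpolation a b M Z X1 \<nu> L (\<lambda>x. b' 1 *\<^sub>R x + sq' 1 *\<^sub>R G x)"
  proof unfold_locales
    show "\<exists>L. L-lipschitz_on UNIV (kern_mean \<nu> (a t) (b t))" if "t \<in> {0..<1}" for t
      by (rule exI[of _ "4 * S\<^sup>2"], rule lipschitz_onI)
        (use mean_lip[OF that] in \<open>auto simp: mean_def dist_norm\<close>)
  qed (use L velocity_lim in auto)
  then show ?thesis by blast
qed

end

lemma has_derivative_along_line:
  assumes "(f has_derivative f') (at (y + s *\<^sub>R h))"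
  shows "((\<lambda>s. f (y + s *\<^sub>R h)) has_derivative (\<lambda>ds. f' (ds *\<^sub>R h))) (at s)"
proof -
  have "((\<lambda>s. y + s *\<^sub>R h) has_derivative (\<lambda>ds. ds *\<^sub>R h)) (at s)" by (auto intro!: derivative_eq_intros)
  from has_derivative_compose[OF this assms] show ?thesis .
qed

lemma taylor_lower:
  fixes U :: "real ^ 'n \<Rightarrow> real"
  assumes U: "\<And>x. (U has_derivative (\<lambda>h. G x \<bullet> h)) (at x)" and G: "\<And>x. (G has_derivative (\<lambda>h. H x *v h)) (at x)"
    and H: "\<And>x h. \<kappa> * (h \<bullet> h) \<le> h \<bullet> (H x *v h)"
  shows "\<kappa> / 2 * (norm h)\<^sup>2 \<le> U (y + h) - U y - G y \<bullet> h"
proof -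
  define \<phi> where "\<phi> s = U (y + s *\<^sub>R h) - s * (G y \<bullet> h) - \<kappa> / 2 * s\<^sup>2 * (h \<bullet> h)" for s
  define \<psi> where "\<psi> s = G (y + s *\<^sub>R h) \<bullet> h - \<kappa> * s * (h \<bullet> h)" for s
  have d\<psi>: "(\<psi> has_real_derivative (H (y + s *\<^sub>R h) *v h) \<bullet> h - \<kappa> * (h \<bullet> h)) (at s)" for s
  proof -
    have "((\<lambda>s. G (y + s *\<^sub>R h) \<bullet> h) has_derivative (\<lambda>ds. (H (y + s *\<^sub>R h) *v (ds *\<^sub>R h)) \<bullet> h)) (at s)"
      by (rule has_derivative_inner_left[OF has_derivative_along_line[OF G]])
    then have "((\<lambda>s. G (y + s *\<^sub>R h) \<bullet> h) has_real_derivative (H (y + s *\<^sub>R h) *v h) \<bullet> h) (at s)"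
      unfolding has_field_derivative_def
      by (rule has_derivative_eq_rhs) (simp add: fun_eq_iff matrix_vector_mult_scaleR)
    then show ?thesis unfolding \<psi>_def[abs_def] by (auto intro!: derivative_eq_intros)
  qed
  have \<psi>: "\<psi> 0 \<le> \<psi> s" if "0 \<le> s" for s
  proof (rule DERIV_nonneg_imp_nondecreasing[where f=\<psi>, OF that])
    fix r
    have "0 \<le> (H (y + r *\<^sub>R h) *v h) \<bullet> h - \<kappa> * (h \<bullet> h)" using H[of h "y + r *\<^sub>R h"] by (simp add: inner_commute)
    then show "\<exists>D. (\<psi> has_real_derivative D) (at r) \<and> 0 \<le> D" using d\<psi> by blast
  qed
  have d\<phi>: "(\<phi> has_real_derivative \<psi> s - G y \<bullet> h) (at s)" for s
  proof -
    have "((\<lambda>s. U (y + s *\<^sub>R h)) has_real_derivative G (y + s *\<^sub>R h) \<bullet> h) (at s)"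
      unfolding has_field_derivative_def
      by (rule has_derivative_eq_rhs[OF has_derivative_along_line[OF U]]) (simp add: fun_eq_iff)
    then show ?thesis unfolding \<phi>_def[abs_def] \<psi>_def by (auto intro!: derivative_eq_intros)
  qed
  have "\<phi> 0 \<le> \<phi> 1"
  proof (rule DERIV_nonneg_imp_nondecreasing[where f=\<phi>])
    fix r :: real assume "0 \<le> r"
    then have "0 \<le> \<psi> r - G y \<bullet> h" using \<psi>[of r] by (simp add: \<psi>_def)
    then show "\<exists>D. (\<phi> has_real_derivative D) (at r) \<and> 0 \<le> D" using d\<phi> by blast
  qed simp
  then show ?thesis by (simp add: \<phi>_def power2_norm_eq_inner)
qed

lemma taylor_upper:
  fixes U :: "real ^ 'n \<Rightarrow> real"
  assumes U: "\<And>x. (U has_derivative (\<lambda>h. G x \<bullet> h)) (at x)" and G: "\<And>x. (G has_derivative (\<lambda>h. H x *v h)) (at x)"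
    and H: "\<And>x h. h \<bullet> (H x *v h) \<le> \<beta> * (h \<bullet> h)"
  shows "U (y + h) - U y - G y \<bullet> h \<le> \<beta> / 2 * (norm h)\<^sup>2"
proof -
  have "- \<beta> / 2 * (norm h)\<^sup>2 \<le> - U (y + h) - - U y - - G y \<bullet> h"
  proof (rule taylor_lower[where U="\<lambda>x. - U x" and G="\<lambda>x. - G x" and H="\<lambda>x. - H x"])
    show "((\<lambda>x. - U x) has_derivative (\<lambda>h. - G x \<bullet> h)) (at x)" for x
      using has_derivative_minus[OF U[of x]] by simp
    have neg: "- A *v h = - (A *v h)" for A :: "real ^ 'n ^ 'n" and h
      by (simp add: matrix_vector_mult_def vec_eq_iff sum_negf)
    show "((\<lambda>x. - G x) has_derivative (\<lambda>h. - H x *v h)) (at x)" for x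
      using has_derivative_minus[OF G[of x]] by (simp add: neg)
    show "- \<beta> * (h \<bullet> h) \<le> h \<bullet> (- H x *v h)" for x h using H[of h x] by (simp add: neg)
  qed
  then show ?thesis by simp
qed

lemma lborel_AE_continuous_eq:
  fixes f g :: "'a::euclidean_space \<Rightarrow> real"
  assumes "AE x in lborel. f x = g x" "continuous_on UNIV f" "continuous_on UNIV g"
  shows "f = g"
proof -
  have o: "open {x. f x \<noteq> g x}" by (intro open_Collect_neq assms)
  have "emeasure lborel {x. f x \<noteq> g x} = 0"
    using assms(1) o by (subst (asm) AE_iff_measurable[of "{x. f x \<noteq> g x}"]) auto
  then have "negligible {x. f x \<noteq> g x}" using o by (simp add: negligible_iff_emeasure0)
  then have "{x. f x \<noteq> g x} = {}" using open_not_negligible[OF o] by blast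
  then show ?thesis by auto
qed

lemma density_exp_unique:
  fixes U V :: "'a::euclidean_space \<Rightarrow> real"
  assumes "continuous_on UNIV U" "continuous_on UNIV V"
    and eq: "density lborel (\<lambda>x. ennreal (exp (- U x))) = density lborel (\<lambda>x. ennreal (exp (- V x)))"
  shows "U = V"
proof -
  have [measurable]: "U \<in> borel_measurable borel" "V \<in> borel_measurable borel"
    using assms borel_measurable_continuous_onI by blast+
  have "AE x in lborel. ennreal (exp (- U x)) = ennreal (exp (- V x))"
    by (rule sigma_finite_measure.density_unique[OF lborel.sigma_finite_measure_axioms _ _ eq]) measurable
  then have "AE x in lborel. U x = V x" by eventually_elim simp
  then show ?thesis by (rule lborel_AE_continuous_eq) fact+
qed

lemma semi_log_potential:
  fixes \<nu> :: "(real ^ 'n) measure"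
  assumes convex: "semi_log_convex \<beta> \<nu>" and concave: "semi_log_concave \<kappa> \<nu>" and supp: "measure_support \<nu> = UNIV"
  obtains U G where "\<nu> = density lborel (\<lambda>x. ennreal (exp (- U x)))" "continuous_on UNIV U"
    "\<And>y h. \<kappa> / 2 * (norm h)\<^sup>2 \<le> U (y + h) - U y - G y \<bullet> h" "\<And>y h. U (y + h) - U y - G y \<bullet> h \<le> \<beta> / 2 * (norm h)\<^sup>2"
proof -
  obtain U H where U: "has_potential \<nu> U" "C2_with_hessian UNIV U H" "\<And>x. loewner_le (H x) (\<beta> *\<^sub>R mat 1)"
    using convex unfolding semi_log_convex_def supp by blast
  obtain V H' where V: "has_potential \<nu> V" "C2_with_hessian UNIV V H'" "\<And>x. loewner_le (\<kappa> *\<^sub>R mat 1) (H' x)"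
    using concave unfolding semi_log_concave_def supp by blast
  obtain G where G: "\<And>x. (U has_derivative (\<lambda>h. G x \<bullet> h)) (at x)" "\<And>x. (G has_derivative (\<lambda>h. H x *v h)) (at x)"
    using U(2) unfolding C2_with_hessian_def by auto
  obtain G' where G': "\<And>x. (V has_derivative (\<lambda>h. G' x \<bullet> h)) (at x)" "\<And>x. (G' has_derivative (\<lambda>h. H' x *v h)) (at x)"
    using V(2) unfolding C2_with_hessian_def by auto
  have cont: "continuous_on UNIV U" "continuous_on UNIV V"
    using G(1) G'(1) by (auto intro!: has_derivative_continuous_on simp: has_derivative_at_withinI)
  have dU: "\<nu> = density lborel (\<lambda>x. ennreal (exp (- U x)))" and dV: "\<nu> = density lborel (\<lambda>x. ennreal (exp (- V x)))"
    using U(1) V(1) unfolding has_potential_def supp by simp_all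
  have UV: "U = V" by (rule density_exp_unique[OF cont]) (use dU dV in simp)
  have GG: "G x = G' x" for x
  proof -
    have "(\<lambda>h. G x \<bullet> h) = (\<lambda>h. G' x \<bullet> h)" using has_derivative_unique[OF G(1) G'(1)[folded UV]] .
    then have "(G x - G' x) \<bullet> h = 0" for h by (simp add: inner_diff_left fun_eq_iff)
    from this[of "G x - G' x"] show ?thesis by simp
  qed
  have mat: "(c *\<^sub>R mat 1 :: real ^ 'n ^ 'n) *v h = c *\<^sub>R h" for c h
    by (simp add: scaleR_matrix_vector_assoc[symmetric])
  have up: "U (y + h) - U y - G y \<bullet> h \<le> \<beta> / 2 * (norm h)\<^sup>2" for y h
    by (rule taylor_upper[OF G]) (use U(3) in \<open>simp add: loewner_le_def mat\<close>)
  have "\<kappa> / 2 * (norm h)\<^sup>2 \<le> V (y + h) - V y - G' y \<bullet> h" for y h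
    by (rule taylor_lower[OF G']) (use V(3) in \<open>simp add: loewner_le_def mat\<close>)
  then have lo: "\<kappa> / 2 * (norm h)\<^sup>2 \<le> U (y + h) - U y - G y \<bullet> h" for y h unfolding UV GG .
  show thesis by (rule that[OF dU cont(1) lo up])
qed

text \<open>Two-sided Taylor bounds make the gradient Lipschitz without symmetry of the Hessian: this is
  cocoercivity for the convex function \<open>U + C / 2 |x|\<^sup>2\<close>.\<close>

lemma gradient_lipschitz:
  fixes U :: "'a::euclidean_space \<Rightarrow> real"
  assumes C: "0 < C" and lo: "\<And>y h. - C / 2 * (norm h)\<^sup>2 \<le> U (y + h) - U y - G y \<bullet> h"
    and up: "\<And>y h. U (y + h) - U y - G y \<bullet> h \<le> C / 2 * (norm h)\<^sup>2"
  shows "norm (G y - G x) \<le> 3 * C * norm (y - x)"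
proof -
  define f where "f z = U z + C / 2 * (z \<bullet> z)" for z
  define g where "g z = G z + C *\<^sub>R z" for z
  have fg: "f (z + h) - f z - g z \<bullet> h = (U (z + h) - U z - G z \<bullet> h) + C / 2 * (norm h)\<^sup>2" for z h
    by (simp add: f_def g_def power2_norm_eq_inner inner_add inner_commute algebra_simps)
  have flo: "0 \<le> f (z + h) - f z - g z \<bullet> h" for z h using lo[of h z] unfolding fg by simp
  have fup: "f (z + h) - f z - g z \<bullet> h \<le> C * (norm h)\<^sup>2" for z h using up[of z h] unfolding fg by simp
  define d where "d = g y - g x"
  define w where "w = y - (1 / (2 * C)) *\<^sub>R d"
  have 1: "0 \<le> f w - f x - g x \<bullet> (y - x) + (1 / (2 * C)) * (g x \<bullet> d)"
    using flo[of x "w - x"] by (simp add: w_def inner_diff_right)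
  have 2: "f w - f y + (1 / (2 * C)) * (g y \<bullet> d) \<le> (1 / (4 * C)) * (d \<bullet> d)"
  proof -
    have wy: "w - y = (- (1 / (2 * C))) *\<^sub>R d" by (simp add: w_def)
    have "C * (norm (w - y))\<^sup>2 = (1 / (4 * C)) * (d \<bullet> d)"
      unfolding wy power2_norm_eq_inner inner_scaleR_left inner_scaleR_right using C by (simp add: field_simps)
    moreover have "g y \<bullet> (w - y) = - ((1 / (2 * C)) * (g y \<bullet> d))"
      unfolding wy inner_scaleR_right by simp
    ultimately show ?thesis using fup[of y "w - y"] by simp
  qed
  have 3: "f y - f x - g x \<bullet> (y - x) \<le> C * (norm (y - x))\<^sup>2"
    using fup[of x "y - x"] by simp
  have "g y \<bullet> d - g x \<bullet> d = d \<bullet> d" by (simp add: d_def inner_diff_left)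
  then have "(1 / (2 * C)) * (g y \<bullet> d) - (1 / (2 * C)) * (g x \<bullet> d) = 2 * ((1 / (4 * C)) * (d \<bullet> d))"
    by (simp add: diff_divide_distrib[symmetric])
  then have "(1 / (4 * C)) * (d \<bullet> d) \<le> C * (norm (y - x))\<^sup>2" using 1 2 3 by linarith
  then have "d \<bullet> d \<le> (2 * C * norm (y - x))\<^sup>2"
    using C by (simp add: field_simps power2_eq_square)
  then have "(norm d)\<^sup>2 \<le> (2 * C * norm (y - x))\<^sup>2" by (simp only: power2_norm_eq_inner)
  then have nd: "norm d \<le> 2 * C * norm (y - x)" by (rule power2_le_imp_le) (use C in simp)
  have "G y - G x = d - C *\<^sub>R (y - x)" by (simp add: d_def g_def algebra_simps)
  then have "norm (G y - G x) \<le> norm d + C * norm (y - x)"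
    using norm_triangle_ineq4[of d "C *\<^sub>R (y - x)"] C by simp
  then show ?thesis using nd by (simp add: algebra_simps)
qed

context potential_target begin

lemma post_diff:
  assumes "a \<noteq> 0"
  shows "post a b x (y + h) - post a b x y = (U (y + h) - U y) - (b / a\<^sup>2) * ((x - b *\<^sub>R y) \<bullet> h) + (b\<^sup>2 / a\<^sup>2) / 2 * (norm h)\<^sup>2"
proof -
  have "x - b *\<^sub>R (y + h) = (x - b *\<^sub>R y) - b *\<^sub>R h" by (simp add: algebra_simps)
  then have "(norm (x - b *\<^sub>R (y + h)))\<^sup>2 = ((x - b *\<^sub>R y) - b *\<^sub>R h) \<bullet> ((x - b *\<^sub>R y) - b *\<^sub>R h)"
    by (simp only: power2_norm_eq_inner)
  also have "\<dots> = (norm (x - b *\<^sub>R y))\<^sup>2 - 2 * b * ((x - b *\<^sub>R y) \<bullet> h) + b\<^sup>2 * (norm h)\<^sup>2"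
    unfolding inner_diff_left[of "x - b *\<^sub>R y" "b *\<^sub>R h"] inner_diff_right[of _ "x - b *\<^sub>R y" "b *\<^sub>R h"] power2_norm_eq_inner
    by (simp only: inner_scaleR_left inner_scaleR_right inner_commute[of h "x - b *\<^sub>R y"] power2_eq_square)
  finally have n: "(norm (x - b *\<^sub>R (y + h)))\<^sup>2 = (norm (x - b *\<^sub>R y))\<^sup>2 - 2 * b * ((x - b *\<^sub>R y) \<bullet> h) + b\<^sup>2 * (norm h)\<^sup>2" .
  show ?thesis unfolding post_def n using assms by (simp add: field_simps)
qed

lemma continuous_post:
  assumes "continuous_on UNIV U" "a \<noteq> 0" shows "continuous_on UNIV (post a b x)"
  unfolding post_def[abs_def] using assms by (intro continuous_intros) auto

lemma post_minimizer:
  assumes a: "0 < a" and Uc: "continuous_on UNIV U" and l: "0 < a\<^sup>2 * \<kappa> + b\<^sup>2" and \<kappa>: "\<kappa> \<le> \<beta>"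
    and lo: "\<And>y h. \<kappa> / 2 * (norm h)\<^sup>2 \<le> U (y + h) - U y - G y \<bullet> h" and up: "\<And>y h. U (y + h) - U y - G y \<bullet> h \<le> \<beta> / 2 * (norm h)\<^sup>2"
  obtains y0 where "\<And>u. (a\<^sup>2 * \<kappa> + b\<^sup>2) / 2 * (norm u)\<^sup>2 \<le> post a b x (y0 + a *\<^sub>R u) - post a b x y0"
    "\<And>u. post a b x (y0 + a *\<^sub>R u) - post a b x y0 \<le> (a\<^sup>2 * \<beta> + b\<^sup>2) / 2 * (norm u)\<^sup>2"
proof -
  let ?V = "post a b x"
  define g where "g y = G y - (b / a\<^sup>2) *\<^sub>R (x - b *\<^sub>R y)" for y
  define p where "p = a\<^sup>2 * \<kappa> + b\<^sup>2"
  define q where "q = a\<^sup>2 * \<beta> + b\<^sup>2"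
  have pq: "0 < p" "p \<le> q" using l \<kappa> by (auto simp: p_def q_def mult_left_mono)
  have scaled: "?V (y + a *\<^sub>R u) - ?V y - a * (g y \<bullet> u) = (U (y + a *\<^sub>R u) - U y - G y \<bullet> (a *\<^sub>R u)) + b\<^sup>2 / 2 * (norm u)\<^sup>2" for y u
  proof -
    have "?V (y + a *\<^sub>R u) - ?V y = (U (y + a *\<^sub>R u) - U y) - (b / a\<^sup>2) * ((x - b *\<^sub>R y) \<bullet> (a *\<^sub>R u)) + (b\<^sup>2 / a\<^sup>2) / 2 * (norm (a *\<^sub>R u))\<^sup>2"
      using a by (intro post_diff) simp
    moreover have "(b\<^sup>2 / a\<^sup>2) / 2 * (norm (a *\<^sub>R u))\<^sup>2 = b\<^sup>2 / 2 * (norm u)\<^sup>2"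
      using a by (simp add: power_mult_distrib)
    moreover have "a * (g y \<bullet> u) = G y \<bullet> (a *\<^sub>R u) - (b / a\<^sup>2) * ((x - b *\<^sub>R y) \<bullet> (a *\<^sub>R u))"
      by (simp only: g_def inner_diff_left[of "G y"] inner_scaleR_left inner_scaleR_right) algebra
    ultimately show ?thesis by linarith
  qed
  have na: "(norm (a *\<^sub>R u))\<^sup>2 = a\<^sup>2 * (norm u)\<^sup>2" for u :: "real ^ 'n" by (simp add: power_mult_distrib)
  have Vlo: "p / 2 * (norm u)\<^sup>2 \<le> ?V (y + a *\<^sub>R u) - ?V y - a * (g y \<bullet> u)" for y u
  proof -
    have "p / 2 * (norm u)\<^sup>2 = \<kappa> / 2 * (a\<^sup>2 * (norm u)\<^sup>2) + b\<^sup>2 / 2 * (norm u)\<^sup>2" by (simp add: p_def field_simps)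
    then show ?thesis using lo[of "a *\<^sub>R u" y] unfolding scaled na by linarith
  qed
  have Vup: "?V (y + a *\<^sub>R u) - ?V y - a * (g y \<bullet> u) \<le> q / 2 * (norm u)\<^sup>2" for y u
  proof -
    have "q / 2 * (norm u)\<^sup>2 = \<beta> / 2 * (a\<^sup>2 * (norm u)\<^sup>2) + b\<^sup>2 / 2 * (norm u)\<^sup>2" by (simp add: q_def field_simps)
    then show ?thesis using up[of y "a *\<^sub>R u"] unfolding scaled na by linarith
  qed
  define r where "r = 2 * a * norm (g 0) / p"
  have r: "0 \<le> r" using a pq by (simp add: r_def)
  have "\<exists>u\<in>cball 0 r. \<forall>u'\<in>cball 0 r. ?V (a *\<^sub>R u) \<le> ?V (a *\<^sub>R u')"
  proof (rule continuous_attains_inf)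
    show "cball 0 r \<noteq> ({} :: (real ^ 'n) set)" using r by simp
    show "continuous_on (cball 0 r) (\<lambda>u. ?V (a *\<^sub>R u))"
      using a by (intro continuous_on_compose2[OF continuous_post[OF Uc]] continuous_intros) auto
  qed simp
  then obtain u0 where "\<forall>u'\<in>cball 0 r. ?V (a *\<^sub>R u0) \<le> ?V (a *\<^sub>R u')" by blast
  then have u0: "?V (a *\<^sub>R u0) \<le> ?V (a *\<^sub>R u)" if "norm u \<le> r" for u using that by simp
  have min: "?V (a *\<^sub>R u0) \<le> ?V (a *\<^sub>R u)" for u
  proof (cases "norm u \<le> r")
    case False
    have "\<bar>g 0 \<bullet> u\<bar> \<le> norm (g 0) * norm u" by (rule Cauchy_Schwarz_ineq2)
    then have "a * - (g 0 \<bullet> u) \<le> a * (norm (g 0) * norm u)" using a by (intro mult_left_mono) auto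
    moreover have "a * (norm (g 0) * norm u) \<le> p / 2 * (norm u)\<^sup>2"
    proof -
      have "a * norm (g 0) \<le> p / 2 * norm u" using False pq by (simp add: r_def field_simps)
      then have "a * norm (g 0) * norm u \<le> p / 2 * norm u * norm u" by (rule mult_right_mono) simp
      then show ?thesis by (simp add: power2_eq_square mult.assoc)
    qed
    ultimately have "?V 0 \<le> ?V (a *\<^sub>R u)" using Vlo[of u 0] by simp
    moreover have "?V (a *\<^sub>R u0) \<le> ?V (a *\<^sub>R 0)" using r by (intro u0) simp
    ultimately show ?thesis by simp
  qed (rule u0)
  define y0 where "y0 = a *\<^sub>R u0"
  have y0: "?V y0 \<le> ?V y" for y
    using min[of "(1 / a) *\<^sub>R y"] a by (simp add: y0_def)
  have "g y0 = 0"
  proof -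
    have q: "0 < q" using pq by simp
    have "?V (y0 + a *\<^sub>R (- (a / q) *\<^sub>R g y0)) - ?V y0 - a * (g y0 \<bullet> (- (a / q) *\<^sub>R g y0)) \<le> q / 2 * (norm (- (a / q) *\<^sub>R g y0))\<^sup>2"
      by (rule Vup)
    then have "a * (g y0 \<bullet> ((a / q) *\<^sub>R g y0)) \<le> q / 2 * (norm ((a / q) *\<^sub>R g y0))\<^sup>2"
      using y0[of "y0 + a *\<^sub>R (- (a / q) *\<^sub>R g y0)"] by simp
    then have "a\<^sup>2 / q * (g y0 \<bullet> g y0) \<le> a\<^sup>2 / q / 2 * (g y0 \<bullet> g y0)"
      using q by (simp add: power_mult_distrib power2_norm_eq_inner power2_eq_square[of a] power2_eq_square[of q] power_divide)
    then have "g y0 \<bullet> g y0 \<le> 0" using q a by (simp add: field_simps mult_le_0_iff)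
    then show ?thesis using inner_gt_zero_iff[of "g y0"] by linarith
  qed
  then show thesis using Vlo[of _ y0] Vup[of y0] by (intro that[of y0]) (simp_all add: p_def q_def)
qed

end

locale schedule_pair = schedule a b + gaussian_pair M Z X1 \<nu>
  for a b :: "real \<Rightarrow> real" and M :: "'w measure" and Z X1 :: "'w \<Rightarrow> real ^ 'n" and \<nu> :: "(real ^ 'n) measure"
begin

lemma uniform_lower_bound:
  fixes f :: "real \<Rightarrow> real"
  assumes "continuous_on {0..1} f" "\<And>t. t \<in> {0..1} \<Longrightarrow> 0 < f t"
  obtains l where "0 < l" "\<And>t. t \<in> {0..1} \<Longrightarrow> l \<le> f t"
proof -
  have "\<exists>s\<in>{0..1}. \<forall>t\<in>{0..1}. f s \<le> f t" by (intro continuous_attains_inf assms) auto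
  then obtain s where "s \<in> {0..1}" "\<forall>t\<in>{0..1}. f s \<le> f t" by blast
  then show thesis using that[of "f s"] assms(2) by blast
qed

lemma variance_pos:
  assumes c: "0 < c" and d: "0 < d" and t: "t \<in> {0..1}"
  shows "0 < (a t)\<^sup>2 * c + (b t)\<^sup>2 * d"
proof (cases "t = 1")
  case True
  then show ?thesis using d by (simp add: a_1 b_1)
next
  case False
  then have "0 < (a t)\<^sup>2 * c" using a_pos[of t] t c by simp
  then show ?thesis using d by (intro add_pos_nonneg) auto
qed

lemma variance_continuous: "continuous_on {0..1} (\<lambda>t. (a t)\<^sup>2 * c + (b t)\<^sup>2 * d)"
  by (intro continuous_intros a_continuous b_continuous)

lemma variance_upper:
  assumes c: "0 \<le> c" and t: "t \<in> {0..<1}"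
  shows "(a t)\<^sup>2 * c + (b t)\<^sup>2 \<le> (a 0)\<^sup>2 * c + 1"
proof -
  have "(a t)\<^sup>2 \<le> (a 0)\<^sup>2" using a_le[OF t] a_pos[OF t] by (intro power_mono) auto
  moreover have "(b t)\<^sup>2 \<le> 1" using b_le[of t] b_nonneg[of t] t by (intro power_le_one) auto
  ultimately show ?thesis using c by (intro add_mono mult_right_mono) auto
qed

lemma regular_of_envelope:
  assumes target: "potential_target M Z X1 \<nu> U G K"
    and l: "0 < l" "0 < l'" "0 \<le> L"
    and env: "\<And>t x. t \<in> {0..<1} \<Longrightarrow> \<exists>y0. \<forall>u.
       l / 2 * (norm u)\<^sup>2 - L * norm u \<le> potential_target.post U (a t) (b t) x (y0 + a t *\<^sub>R u) - potential_target.post U (a t) (b t) x y0 \<and>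
       potential_target.post U (a t) (b t) x (y0 + a t *\<^sub>R u) - potential_target.post U (a t) (b t) x y0 \<le> l' / 2 * (norm u)\<^sup>2 + L * norm u"
  shows "\<exists>L v1. regular_interpolation a b M Z X1 \<nu> L v1"
proof -
  interpret potential_target M Z X1 \<nu> U G K by (rule target)
  obtain S where S: "0 < S"
    "\<And>(V :: real ^ 'n \<Rightarrow> real) y0 a. \<lbrakk>V \<in> borel_measurable borel; 0 < a;
       \<And>u. l / 2 * (norm u)\<^sup>2 - L * norm u \<le> V (y0 + a *\<^sub>R u) - V y0;
       \<And>u. V (y0 + a *\<^sub>R u) - V y0 \<le> l' / 2 * (norm u)\<^sup>2 + L * norm u\<rbrakk> \<Longrightarrow>
      integrable lborel (\<lambda>y. exp (- V y) * tilt_weight ((y - y0) /\<^sub>R a)) \<and>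
      (\<integral>y. exp (- V y) * tilt_weight ((y - y0) /\<^sub>R a) \<partial>lborel) \<le> S * (\<integral>y. exp (- V y) \<partial>lborel)"
    by (rule envelope_moment[OF l]) blast
  interpret potential_interpolation a b M Z X1 \<nu> U G K S
  proof unfold_locales
    show "0 < S" by (rule S)
    fix t x assume t: "t \<in> {0..<1::real}"
    obtain y0 where "\<forall>u. l / 2 * (norm u)\<^sup>2 - L * norm u \<le> post (a t) (b t) x (y0 + a t *\<^sub>R u) - post (a t) (b t) x y0 \<and>
       post (a t) (b t) x (y0 + a t *\<^sub>R u) - post (a t) (b t) x y0 \<le> l' / 2 * (norm u)\<^sup>2 + L * norm u"
      using env[OF t] by blast
    then have "integrable lborel (\<lambda>y. exp (- post (a t) (b t) x y) * tilt_weight ((y - y0) /\<^sub>R a t)) \<and>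
       (\<integral>y. exp (- post (a t) (b t) x y) * tilt_weight ((y - y0) /\<^sub>R a t) \<partial>lborel) \<le> S * (\<integral>y. exp (- post (a t) (b t) x y) \<partial>lborel)"
      by (intro S(2) a_pos t post_measurable) auto
    then show "\<exists>y0. integrable lborel (\<lambda>y. exp (- post (a t) (b t) x y) * tilt_weight ((y - y0) /\<^sub>R a t)) \<and>
       (\<integral>y. exp (- post (a t) (b t) x y) * tilt_weight ((y - y0) /\<^sub>R a t) \<partial>lborel) \<le> S * (\<integral>y. exp (- post (a t) (b t) x y) \<partial>lborel)"
      by blast
  qed
  show ?thesis by (rule regular)
qed

lemma potential_target_of_taylor:
  assumes nu: "\<nu> = density lborel (\<lambda>x. ennreal (exp (- U x)))" and Uc: "continuous_on UNIV U" and \<beta>: "0 < \<beta>"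
    and lo: "\<And>y h. \<kappa> / 2 * (norm h)\<^sup>2 \<le> U (y + h) - U y - G y \<bullet> h" and up: "\<And>y h. U (y + h) - U y - G y \<bullet> h \<le> \<beta> / 2 * (norm h)\<^sup>2"
  shows "potential_target M Z X1 \<nu> U G (3 * (\<bar>\<kappa>\<bar> + \<beta>))"
proof unfold_locales
  show "\<nu> = density lborel (\<lambda>x. ennreal (exp (- U x)))" by (rule nu)
  show "U \<in> borel_measurable borel" by (rule borel_measurable_continuous_onI[OF Uc])
  show "0 < 3 * (\<bar>\<kappa>\<bar> + \<beta>)" using \<beta> by simp
  show "norm (G x - G y) \<le> 3 * (\<bar>\<kappa>\<bar> + \<beta>) * norm (x - y)" for x y
  proof (rule gradient_lipschitz[where U=U])
    show "0 < \<bar>\<kappa>\<bar> + \<beta>" using \<beta> by simp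
    show "- (\<bar>\<kappa>\<bar> + \<beta>) / 2 * (norm h)\<^sup>2 \<le> U (y + h) - U y - G y \<bullet> h" for y h
      by (rule order_trans[OF mult_right_mono lo]) (use \<beta> in auto)
    show "U (y + h) - U y - G y \<bullet> h \<le> (\<bar>\<kappa>\<bar> + \<beta>) / 2 * (norm h)\<^sup>2" for y h
      by (rule order_trans[OF up mult_right_mono]) auto
  qed
  show "U (y + h) \<le> U y + G y \<bullet> h + 3 * (\<bar>\<kappa>\<bar> + \<beta>) / 2 * (norm h)\<^sup>2" for y h
  proof -
    have "\<beta> / 2 * (norm h)\<^sup>2 \<le> 3 * (\<bar>\<kappa>\<bar> + \<beta>) / 2 * (norm h)\<^sup>2" using \<beta> by (intro mult_right_mono) auto
    then show ?thesis using up[of y h] by linarith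
  qed
qed

lemma regular_strongly_log_concave:
  assumes \<beta>: "0 < \<beta>" and \<kappa>: "0 < \<kappa>"
    and convex: "semi_log_convex \<beta> \<nu>" and concave: "semi_log_concave \<kappa> \<nu>" and supp: "measure_support \<nu> = UNIV"
  shows "\<exists>L v1. regular_interpolation a b M Z X1 \<nu> L v1"
proof -
  obtain U G where UG: "\<nu> = density lborel (\<lambda>x. ennreal (exp (- U x)))" "continuous_on UNIV U"
    "\<And>y h. \<kappa> / 2 * (norm h)\<^sup>2 \<le> U (y + h) - U y - G y \<bullet> h" "\<And>y h. U (y + h) - U y - G y \<bullet> h \<le> \<beta> / 2 * (norm h)\<^sup>2"
    using semi_log_potential[OF convex concave supp] by blast
  have target: "potential_target M Z X1 \<nu> U G (3 * (\<bar>\<kappa>\<bar> + \<beta>))" by (rule potential_target_of_taylor[OF UG(1,2) \<beta> UG(3,4)])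
  interpret potential_target M Z X1 \<nu> U G "3 * (\<bar>\<kappa>\<bar> + \<beta>)" by (rule target)
  have \<kappa>\<beta>: "\<kappa> \<le> \<beta>"
    using order_trans[OF UG(3)[of "axis undefined 1" 0] UG(4)[of 0 "axis undefined 1"]] by simp
  obtain l where l: "0 < l" "\<And>t. t \<in> {0..1} \<Longrightarrow> l \<le> (a t)\<^sup>2 * \<kappa> + (b t)\<^sup>2 * 1"
    using uniform_lower_bound[OF variance_continuous variance_pos[OF \<kappa> zero_less_one]] by blast
  define l' where "l' = (a 0)\<^sup>2 * \<beta> + 1"
  have l': "0 < l'" using \<beta> by (simp add: l'_def add_nonneg_pos)
  show ?thesis
  proof (rule regular_of_envelope[OF target l(1) l' order_refl])
    fix t x assume t: "t \<in> {0..<1::real}"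
    have pos: "0 < (a t)\<^sup>2 * \<kappa> + (b t)\<^sup>2" using variance_pos[OF \<kappa> zero_less_one, of t] t by simp
    obtain y0 where y0: "\<And>u. ((a t)\<^sup>2 * \<kappa> + (b t)\<^sup>2) / 2 * (norm u)\<^sup>2 \<le> post (a t) (b t) x (y0 + a t *\<^sub>R u) - post (a t) (b t) x y0"
      "\<And>u. post (a t) (b t) x (y0 + a t *\<^sub>R u) - post (a t) (b t) x y0 \<le> ((a t)\<^sup>2 * \<beta> + (b t)\<^sup>2) / 2 * (norm u)\<^sup>2"
      using post_minimizer[OF a_pos[OF t] UG(2) pos \<kappa>\<beta> UG(3,4), of x] by blast
    have lo: "l / 2 * (norm u)\<^sup>2 \<le> ((a t)\<^sup>2 * \<kappa> + (b t)\<^sup>2) / 2 * (norm u)\<^sup>2" for u :: "real ^ 'n"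
      using l(2)[of t] t by (intro mult_right_mono) auto
    have up: "((a t)\<^sup>2 * \<beta> + (b t)\<^sup>2) / 2 * (norm u)\<^sup>2 \<le> l' / 2 * (norm u)\<^sup>2" for u :: "real ^ 'n"
      using variance_upper[of \<beta> t] \<beta> t unfolding l'_def by (intro mult_right_mono) auto
    show "\<exists>y0. \<forall>u. l / 2 * (norm u)\<^sup>2 - 0 * norm u \<le> post (a t) (b t) x (y0 + a t *\<^sub>R u) - post (a t) (b t) x y0 \<and>
       post (a t) (b t) x (y0 + a t *\<^sub>R u) - post (a t) (b t) x y0 \<le> l' / 2 * (norm u)\<^sup>2 + 0 * norm u"
    proof (intro exI[of _ y0] allI)
      fix u
      show "l / 2 * (norm u)\<^sup>2 - 0 * norm u \<le> post (a t) (b t) x (y0 + a t *\<^sub>R u) - post (a t) (b t) x y0 \<and>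
       post (a t) (b t) x (y0 + a t *\<^sub>R u) - post (a t) (b t) x y0 \<le> l' / 2 * (norm u)\<^sup>2 + 0 * norm u"
        using lo[of u] up[of u] y0[of u] by linarith
    qed
  qed
qed

lemma potential_of_log_lipschitz:
  assumes nu: "\<nu> = density lborel (\<lambda>x. ennreal (exp (- U x)))" and Uc: "continuous_on UNIV U"
    and f: "AE x in gaussian 1. RN_deriv (gaussian 1) \<nu> x = ennreal (f x)" "log_lipschitz L f"
  obtains c where "\<And>x. U x = (norm x)\<^sup>2 / 2 + c - ln (f x)"
proof -
  define C where "C = (1 / sqrt (2 * pi)) ^ CARD('n)"
  have C: "0 < C" by (simp add: C_def)
  have g: "(gaussian 1 :: (real ^ 'n) measure) = density lborel (\<lambda>x. ennreal (C * exp (- (norm x)\<^sup>2 / 2)))"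
    using gaussian_density[of 1, where 'n='n] by (simp add: C_def)
  interpret G: prob_space "gaussian 1 :: (real ^ 'n) measure" by (rule prob_space_gaussian_1)
  have fp: "0 < f x" for x using f(2) by (simp add: log_lipschitz_def)
  have lf: "continuous_on UNIV (\<lambda>x. ln (f x))"
    using f(2) lipschitz_on_continuous_on unfolding log_lipschitz_def by blast
  have "continuous_on UNIV (\<lambda>x. exp (ln (f x)))" by (intro continuous_intros lf)
  then have fc: "continuous_on UNIV f" using fp by simp
  then have [measurable]: "f \<in> borel_measurable borel" by (rule borel_measurable_continuous_onI)
  have [measurable]: "U \<in> borel_measurable borel" by (rule borel_measurable_continuous_onI[OF Uc])
  have sG [measurable_cong]: "sets (gaussian 1 :: (real ^ 'n) measure) = sets borel" by (simp add: g)
  have ac: "absolutely_continuous (gaussian 1) \<nu>"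
    unfolding absolutely_continuous_def
  proof
    fix A :: "(real ^ 'n) set" assume A: "A \<in> null_sets (gaussian 1)"
    then have [measurable]: "A \<in> sets borel" using sG by auto
    have "AE x in lborel. x \<in> A \<longrightarrow> ennreal (C * exp (- (norm x)\<^sup>2 / 2)) = 0"
      using A unfolding g by (simp add: null_sets_density_iff)
    moreover have "ennreal (C * exp (- (norm x)\<^sup>2 / 2)) \<noteq> 0" for x :: "real ^ 'n"
      using C by (simp add: ennreal_eq_0_iff mult_le_0_iff)
    ultimately have "AE x in lborel. x \<notin> A" by simp
    then show "A \<in> null_sets \<nu>"
      unfolding nu by (subst null_sets_density_iff) (auto elim!: eventually_mono)
  qed
  have "\<nu> = density (gaussian 1) (RN_deriv (gaussian 1) \<nu>)"
    using G.density_RN_deriv[OF ac] by (simp add: sG)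
  also have "\<dots> = density (gaussian 1) (\<lambda>x. ennreal (f x))"
    by (rule density_cong) (use f(1) in auto)
  also have "\<dots> = density lborel (\<lambda>x. ennreal (C * exp (- (norm x)\<^sup>2 / 2)) * ennreal (f x))"
    unfolding g by (rule density_density_eq) auto
  also have "\<dots> = density lborel (\<lambda>x. ennreal (exp (- ((norm x)\<^sup>2 / 2 + - ln C - ln (f x)))))"
  proof -
    have "C * exp (- (norm x)\<^sup>2 / 2) * f x = exp (- ((norm x)\<^sup>2 / 2 + - ln C - ln (f x)))" for x
    proof -
      have "- ((norm x)\<^sup>2 / 2 + - ln C - ln (f x)) = ln C + - (norm x)\<^sup>2 / 2 + ln (f x)" by simp
      then show ?thesis using C fp[of x] by (simp only: exp_add) simp
    qed
    then show ?thesis using C fp by (simp add: ennreal_mult[symmetric] less_imp_le)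
  qed
  finally have "density lborel (\<lambda>x. ennreal (exp (- U x))) = density lborel (\<lambda>x. ennreal (exp (- ((norm x)\<^sup>2 / 2 + - ln C - ln (f x)))))"
    using nu by simp
  then have "U = (\<lambda>x. (norm x)\<^sup>2 / 2 + - ln C - ln (f x))"
    by (intro density_exp_unique Uc continuous_intros lf) auto
  then show thesis by (intro that[of "- ln C"]) (simp add: fun_eq_iff)
qed

lemma regular_log_lipschitz:
  assumes \<beta>: "0 < \<beta>"
    and convex: "semi_log_convex \<beta> \<nu>" and concave: "semi_log_concave \<kappa> \<nu>" and supp: "measure_support \<nu> = UNIV"
    and f: "AE x in gaussian 1. RN_deriv (gaussian 1) \<nu> x = ennreal (f x)" "log_lipschitz L f"
  shows "\<exists>L v1. regular_interpolation a b M Z X1 \<nu> L v1"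
proof -
  obtain U G where UG: "\<nu> = density lborel (\<lambda>x. ennreal (exp (- U x)))" "continuous_on UNIV U"
    "\<And>y h. \<kappa> / 2 * (norm h)\<^sup>2 \<le> U (y + h) - U y - G y \<bullet> h" "\<And>y h. U (y + h) - U y - G y \<bullet> h \<le> \<beta> / 2 * (norm h)\<^sup>2"
    using semi_log_potential[OF convex concave supp] by blast
  have target: "potential_target M Z X1 \<nu> U G (3 * (\<bar>\<kappa>\<bar> + \<beta>))" by (rule potential_target_of_taylor[OF UG(1,2) \<beta> UG(3,4)])
  interpret potential_target M Z X1 \<nu> U G "3 * (\<bar>\<kappa>\<bar> + \<beta>)" by (rule target)
  obtain c where U: "\<And>x. U x = (norm x)\<^sup>2 / 2 + c - ln (f x)" using potential_of_log_lipschitz[OF UG(1,2) f] by blast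
  have L: "0 \<le> L" "\<And>x y. \<bar>ln (f x) - ln (f y)\<bar> \<le> L * norm (x - y)"
    using f(2) lipschitz_on_nonneg lipschitz_on_normD unfolding log_lipschitz_def real_norm_def[symmetric] by blast+
  obtain l where l: "0 < l" "\<And>t. t \<in> {0..1} \<Longrightarrow> l \<le> (a t)\<^sup>2 * 1 + (b t)\<^sup>2 * 1"
    using uniform_lower_bound[OF variance_continuous variance_pos[OF zero_less_one zero_less_one]] by blast
  define l' where "l' = (a 0)\<^sup>2 * 1 + 1"
  have l': "0 < l'" by (simp add: l'_def add_nonneg_pos)
  have La: "0 \<le> L * a 0" using L a_pos[of 0] by simp
  show ?thesis
  proof (rule regular_of_envelope[OF target l(1) l' La])
    fix t :: real and x :: "real ^ 'n" assume t: "t \<in> {0..<1::real}"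
    have a: "0 < a t" by (rule a_pos[OF t])
    define y0 where "y0 = (b t / ((a t)\<^sup>2 + (b t)\<^sup>2)) *\<^sub>R x"
    have ab: "0 < (a t)\<^sup>2 + (b t)\<^sup>2" using a by (intro add_pos_nonneg) auto
    have "(b t / (a t)\<^sup>2) *\<^sub>R (x - b t *\<^sub>R y0) = ((b t / (a t)\<^sup>2) * (1 - b t * (b t / ((a t)\<^sup>2 + (b t)\<^sup>2)))) *\<^sub>R x"
      by (simp add: y0_def algebra_simps)
    also have "(b t / (a t)\<^sup>2) * (1 - b t * (b t / ((a t)\<^sup>2 + (b t)\<^sup>2))) = b t / ((a t)\<^sup>2 + (b t)\<^sup>2)"
      using a ab by (simp add: field_simps power2_eq_square)
    finally have crit: "(b t / (a t)\<^sup>2) *\<^sub>R (x - b t *\<^sub>R y0) = y0" by (simp add: y0_def)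
    have diff: "post (a t) (b t) x (y0 + a t *\<^sub>R u) - post (a t) (b t) x y0 =
       ((a t)\<^sup>2 * 1 + (b t)\<^sup>2 * 1) / 2 * (norm u)\<^sup>2 - (ln (f (y0 + a t *\<^sub>R u)) - ln (f y0))" for u
    proof -
      have "(norm (y0 + a t *\<^sub>R u))\<^sup>2 = (norm y0)\<^sup>2 + 2 * (y0 \<bullet> (a t *\<^sub>R u)) + (a t)\<^sup>2 * (norm u)\<^sup>2"
        by (simp add: power2_norm_eq_inner inner_add inner_commute power2_eq_square[of "a t"])
      moreover have "post (a t) (b t) x (y0 + a t *\<^sub>R u) - post (a t) (b t) x y0 = (U (y0 + a t *\<^sub>R u) - U y0)
          - (b t / (a t)\<^sup>2) * ((x - b t *\<^sub>R y0) \<bullet> (a t *\<^sub>R u)) + ((b t)\<^sup>2 / (a t)\<^sup>2) / 2 * (norm (a t *\<^sub>R u))\<^sup>2"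
        using a by (intro post_diff) simp
      moreover have "(b t / (a t)\<^sup>2) * ((x - b t *\<^sub>R y0) \<bullet> (a t *\<^sub>R u)) = y0 \<bullet> (a t *\<^sub>R u)"
        by (subst (2) crit[symmetric]) (simp only: inner_scaleR_left)
      moreover have "((b t)\<^sup>2 / (a t)\<^sup>2) / 2 * (norm (a t *\<^sub>R u))\<^sup>2 = (b t)\<^sup>2 / 2 * (norm u)\<^sup>2"
        using a by (simp add: power_mult_distrib)
      moreover have "((a t)\<^sup>2 * 1 + (b t)\<^sup>2 * 1) / 2 * (norm u)\<^sup>2 = ((a t)\<^sup>2 * (norm u)\<^sup>2) / 2 + (b t)\<^sup>2 / 2 * (norm u)\<^sup>2"
        by (simp add: field_simps)
      ultimately show ?thesis unfolding U by linarith
    qed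
    have lb: "\<bar>ln (f (y0 + a t *\<^sub>R u)) - ln (f y0)\<bar> \<le> L * a 0 * norm u" for u
    proof -
      have "\<bar>ln (f (y0 + a t *\<^sub>R u)) - ln (f y0)\<bar> \<le> L * (a t * norm u)"
        using L(2)[of "y0 + a t *\<^sub>R u" y0] a by simp
      also have "\<dots> \<le> L * (a 0 * norm u)" using a_le[OF t] L(1) by (intro mult_left_mono mult_right_mono) auto
      finally show ?thesis by (simp only: mult.assoc)
    qed
    have lo: "l / 2 * (norm u)\<^sup>2 \<le> ((a t)\<^sup>2 * 1 + (b t)\<^sup>2 * 1) / 2 * (norm u)\<^sup>2" for u :: "real ^ 'n"
      using l(2)[of t] t by (intro mult_right_mono) auto
    have up: "((a t)\<^sup>2 * 1 + (b t)\<^sup>2 * 1) / 2 * (norm u)\<^sup>2 \<le> l' / 2 * (norm u)\<^sup>2" for u :: "real ^ 'n"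
      using variance_upper[of 1 t] t unfolding l'_def by (intro mult_right_mono) auto
    show "\<exists>y0. \<forall>u. l / 2 * (norm u)\<^sup>2 - L * a 0 * norm u \<le> post (a t) (b t) x (y0 + a t *\<^sub>R u) - post (a t) (b t) x y0 \<and>
       post (a t) (b t) x (y0 + a t *\<^sub>R u) - post (a t) (b t) x y0 \<le> l' / 2 * (norm u)\<^sup>2 + L * a 0 * norm u"
    proof (intro exI[of _ y0] allI)
      fix u
      show "l / 2 * (norm u)\<^sup>2 - L * a 0 * norm u \<le> post (a t) (b t) x (y0 + a t *\<^sub>R u) - post (a t) (b t) x y0 \<and>
       post (a t) (b t) x (y0 + a t *\<^sub>R u) - post (a t) (b t) x y0 \<le> l' / 2 * (norm u)\<^sup>2 + L * a 0 * norm u"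
        using lb[of u] lo[of u] up[of u] unfolding diff by linarith
    qed
  qed
qed

end

section \<open>Gaussian mixtures\<close>

text \<open>For \<open>X1 = \<sigma> Z' + Y\<close> the Gaussian part of \<open>X1\<close> is integrated out: what remains is the
  conditional mean of the bounded variable \<open>Y\<close> under a kernel of variance \<open>s\<^sup>2 = a\<^sup>2 + b\<^sup>2 \<sigma>\<^sup>2\<close>, which
  does not degenerate at the final time.\<close>

lemma kern_complete_square:
  fixes x y z :: "'a::real_inner"
  assumes a: "0 < a" and \<sigma>: "0 < \<sigma>" and s: "s\<^sup>2 = a\<^sup>2 + b\<^sup>2 * \<sigma>\<^sup>2"
  shows "exp (- (norm z)\<^sup>2 / (2 * \<sigma>\<^sup>2)) * kern a b x (z + y) =
     kern s b x y * exp (- (s\<^sup>2 / (2 * a\<^sup>2 * \<sigma>\<^sup>2)) * (norm (z - (b * \<sigma>\<^sup>2 / s\<^sup>2) *\<^sub>R (x - b *\<^sub>R y)))\<^sup>2)"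
proof -
  define w where "w = x - b *\<^sub>R y"
  define p where "p = w \<bullet> w"
  define q where "q = w \<bullet> z"
  define r where "r = z \<bullet> z"
  have s0: "0 < s\<^sup>2" unfolding s using a by (intro add_pos_nonneg) auto
  have 1: "(norm (x - b *\<^sub>R (z + y)))\<^sup>2 = p - 2 * b * q + b\<^sup>2 * r"
  proof -
    have "x - b *\<^sub>R (z + y) = w - b *\<^sub>R z" by (simp add: w_def algebra_simps)
    then show ?thesis
      by (simp add: power2_norm_eq_inner inner_diff inner_commute[of z w] p_def q_def r_def power2_eq_square[of b] algebra_simps)
  qed
  have 2: "(norm (z - (b * \<sigma>\<^sup>2 / s\<^sup>2) *\<^sub>R w))\<^sup>2 = r - 2 * (b * \<sigma>\<^sup>2 / s\<^sup>2) * q + (b * \<sigma>\<^sup>2 / s\<^sup>2)\<^sup>2 * p"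
    by (simp add: power2_norm_eq_inner inner_diff inner_commute[of z w] p_def q_def r_def power2_eq_square[of "b * \<sigma>\<^sup>2 / s\<^sup>2"] algebra_simps)
  have "- r / (2 * \<sigma>\<^sup>2) + - (p - 2 * b * q + b\<^sup>2 * r) / (2 * a\<^sup>2) =
    - p / (2 * s\<^sup>2) + - (s\<^sup>2 / (2 * a\<^sup>2 * \<sigma>\<^sup>2)) * (r - 2 * (b * \<sigma>\<^sup>2 / s\<^sup>2) * q + (b * \<sigma>\<^sup>2 / s\<^sup>2)\<^sup>2 * p)"
  proof -
    have A: "a\<^sup>2 \<noteq> 0" and B: "\<sigma>\<^sup>2 \<noteq> 0" and S: "s\<^sup>2 \<noteq> 0" using a \<sigma> s0 by auto
    have r: "r / (2 * \<sigma>\<^sup>2) + b\<^sup>2 * r / (2 * a\<^sup>2) = s\<^sup>2 / (2 * a\<^sup>2 * \<sigma>\<^sup>2) * r"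
      unfolding s using A B by (simp add: field_simps)
    have q: "2 * b * q / (2 * a\<^sup>2) = s\<^sup>2 / (2 * a\<^sup>2 * \<sigma>\<^sup>2) * (2 * (b * \<sigma>\<^sup>2 / s\<^sup>2) * q)"
      using A B S by simp
    have "s\<^sup>2 / (2 * a\<^sup>2 * \<sigma>\<^sup>2) * ((b * \<sigma>\<^sup>2 / s\<^sup>2)\<^sup>2 * p) = b\<^sup>2 * \<sigma>\<^sup>2 * p / (2 * a\<^sup>2 * s\<^sup>2)"
      using A B S by (simp add: power2_eq_square)
    moreover have "p / (2 * a\<^sup>2) = p / (2 * s\<^sup>2) + b\<^sup>2 * \<sigma>\<^sup>2 * p / (2 * a\<^sup>2 * s\<^sup>2)"
    proof -
      have "p / (2 * s\<^sup>2) + b\<^sup>2 * \<sigma>\<^sup>2 * p / (2 * a\<^sup>2 * s\<^sup>2) = (a\<^sup>2 + b\<^sup>2 * \<sigma>\<^sup>2) * p / (2 * a\<^sup>2 * s\<^sup>2)"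
        using A S by (simp add: add_divide_distrib distrib_right)
      also have "\<dots> = p / (2 * a\<^sup>2)" unfolding s[symmetric] using A S by simp
      finally show ?thesis by simp
    qed
    ultimately show ?thesis using r q
      by (simp only: right_diff_distrib distrib_left minus_divide_left[symmetric] diff_divide_distrib add_divide_distrib mult_minus_left)
  qed
  then have "exp (- r / (2 * \<sigma>\<^sup>2)) * exp (- (p - 2 * b * q + b\<^sup>2 * r) / (2 * a\<^sup>2)) =
    exp (- p / (2 * s\<^sup>2)) * exp (- (s\<^sup>2 / (2 * a\<^sup>2 * \<sigma>\<^sup>2)) * (r - 2 * (b * \<sigma>\<^sup>2 / s\<^sup>2) * q + (b * \<sigma>\<^sup>2 / s\<^sup>2)\<^sup>2 * p))"
    by (simp only: exp_add[symmetric])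
  then show ?thesis
    unfolding kern_def 1 w_def[symmetric] 2 by (simp only: power2_norm_eq_inner p_def r_def)
qed

context schedule_pair begin

lemma gaussian_moments:
  assumes c: "0 < c"
  defines "A \<equiv> (\<integral>u. exp (- c * (norm u)\<^sup>2) \<partial>(lborel :: (real ^ 'n) measure))"
  shows "0 < A"
    "integrable lborel (\<lambda>z :: real ^ 'n. exp (- c * (norm (z - z0))\<^sup>2))"
    "(\<integral>z. exp (- c * (norm (z - z0))\<^sup>2) \<partial>lborel) = A"
    "integrable lborel (\<lambda>z :: real ^ 'n. exp (- c * (norm (z - z0))\<^sup>2) *\<^sub>R z)"
    "(\<integral>z. exp (- c * (norm (z - z0))\<^sup>2) *\<^sub>R z \<partial>lborel) = A *\<^sub>R z0"
proof -
  define e where "e u = exp (- c * (norm u)\<^sup>2)" for u :: "real ^ 'n"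
  have em[measurable]: "e \<in> borel_measurable borel" unfolding e_def[abs_def] by measurable
  have ie: "integrable lborel e" unfolding e_def[abs_def] by (rule integrable_exp_neg_square[OF c])
  have ieu: "integrable lborel (\<lambda>u. e u *\<^sub>R u)"
  proof (rule Bochner_Integration.integrable_bound[OF integrable_tilt_envelope[of "2 * c" 0]])
    show "AE u in lborel. norm (e u *\<^sub>R u) \<le> norm (exp (- (2 * c / 2 * (norm u)\<^sup>2 - 0 * norm u)) * tilt_weight u)"
    proof (rule AE_I2)
      fix u :: "real ^ 'n"
      have "norm u \<le> \<bar>tilt_weight u\<bar>" using tilt_weight_bounds(2)[of u] by linarith
      then show "norm (e u *\<^sub>R u) \<le> norm (exp (- (2 * c / 2 * (norm u)\<^sup>2 - 0 * norm u)) * tilt_weight u)"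
        by (simp add: e_def abs_mult)
    qed
  qed (use c in auto)
  have A: "A = (\<integral>u. e u \<partial>lborel)" by (simp add: A_def e_def)
  show "0 < A" unfolding A by (rule integral_pos[OF ie]) (simp_all add: e_def)
  have odd: "(\<integral>u. e u *\<^sub>R u \<partial>lborel) = 0"
  proof -
    define I where "I = (\<integral>u. e u *\<^sub>R u \<partial>lborel)"
    have m: "(\<lambda>u. e u *\<^sub>R u) \<in> borel_measurable borel" by measurable
    have l: "(lborel :: (real ^ 'n) measure) = distr lborel borel uminus"
      using lborel_affine[of "-1" "0 :: real ^ 'n"] by (simp add: density_1)
    have "I = (\<integral>u. e u *\<^sub>R u \<partial>(distr lborel borel uminus))" unfolding I_def by (subst l) simp
    also have "\<dots> = (\<integral>u. e (- u) *\<^sub>R (- u) \<partial>lborel)" by (rule integral_distr) auto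
    also have "\<dots> = (\<integral>u. - (e u *\<^sub>R u) \<partial>lborel)" by (simp add: e_def)
    also have "\<dots> = - I" by (simp add: I_def)
    finally have "2 *\<^sub>R I = 0" by (simp add: scaleR_2)
    then show ?thesis by (simp add: I_def)
  qed
  have m1: "(\<lambda>z. e (z - z0)) \<in> borel_measurable borel" and m2: "(\<lambda>z. e (z - z0) *\<^sub>R z) \<in> borel_measurable borel"
    by measurable
  have sh1: "(\<lambda>u. e (z0 + 1 *\<^sub>R u - z0)) = e" and sh2: "(\<lambda>u. e (z0 + 1 *\<^sub>R u - z0) *\<^sub>R (z0 + 1 *\<^sub>R u)) = (\<lambda>u. e u *\<^sub>R z0 + e u *\<^sub>R u)"
    by (simp_all add: fun_eq_iff scaleR_add_right)
  have "integrable lborel (\<lambda>z. e (z - z0))"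
    unfolding lborel_integral_affine(1)[OF m1 zero_less_one, of z0] sh1 by (rule ie)
  then show "integrable lborel (\<lambda>z :: real ^ 'n. exp (- c * (norm (z - z0))\<^sup>2))" by (simp add: e_def)
  have "(\<integral>z. e (z - z0) \<partial>lborel) = A"
    unfolding lborel_integral_affine(2)[OF m1 zero_less_one, of z0] sh1 A by simp
  then show "(\<integral>z. exp (- c * (norm (z - z0))\<^sup>2) \<partial>lborel) = A" by (simp add: e_def)
  have "integrable lborel (\<lambda>z. e (z - z0) *\<^sub>R z)"
    unfolding lborel_integral_affine(1)[OF m2 zero_less_one, of z0] sh2 using ie ieu by simp
  then show "integrable lborel (\<lambda>z :: real ^ 'n. exp (- c * (norm (z - z0))\<^sup>2) *\<^sub>R z)" by (simp add: e_def)
  have "(\<integral>z. e (z - z0) *\<^sub>R z \<partial>lborel) = A *\<^sub>R z0"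
    unfolding lborel_integral_affine(2)[OF m2 zero_less_one, of z0] sh2 using ie ieu odd by (simp add: A)
  then show "(\<integral>z. exp (- c * (norm (z - z0))\<^sup>2) *\<^sub>R z \<partial>lborel) = A *\<^sub>R z0" by (simp add: e_def)
qed

lemma kern_mean_convolution:
  assumes "prob_space \<rho>" and sets_rho: "sets \<rho> = sets borel" and bdd: "AE y in \<rho>. norm y \<le> B"
    and nu: "\<nu> = convolution (gaussian \<sigma>) \<rho>" and \<sigma>: "0 < \<sigma>" and p: "0 < p" and s: "s\<^sup>2 = p\<^sup>2 + q\<^sup>2 * \<sigma>\<^sup>2"
  shows "kern_mean \<nu> p q x = (q * \<sigma>\<^sup>2 / s\<^sup>2) *\<^sub>R x + (p\<^sup>2 / s\<^sup>2) *\<^sub>R kern_mean \<rho> s q x"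
proof -
  interpret rho: prob_space \<rho> by fact
  note [measurable_cong] = sets_rho
  define Cs where "Cs = (1 / sqrt (2 * pi * \<sigma>\<^sup>2)) ^ CARD('n)"
  have Cs: "0 < Cs" using \<sigma> by (simp add: Cs_def)
  define c where "c = s\<^sup>2 / (2 * p\<^sup>2 * \<sigma>\<^sup>2)"
  have s0: "0 < s\<^sup>2" unfolding s using p by (intro add_pos_nonneg) auto
  have c: "0 < c" using s0 p \<sigma> by (simp add: c_def)
  define A where "A = (\<integral>u. exp (- c * (norm u)\<^sup>2) \<partial>(lborel :: (real ^ 'n) measure))"
  note gm = gaussian_moments[OF c, folded A_def]
  have g: "(gaussian \<sigma> :: (real ^ 'n) measure) = density lborel (\<lambda>z. ennreal (Cs * exp (- (norm z)\<^sup>2 / (2 * \<sigma>\<^sup>2))))"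
    using gaussian_density[OF \<sigma>, where 'n='n] by (simp add: Cs_def)
  have sg [measurable_cong]: "sets (gaussian \<sigma> :: (real ^ 'n) measure) = sets borel" by (simp add: g)
  interpret G: finite_measure "gaussian \<sigma> :: (real ^ 'n) measure"
  proof
    have "integrable lborel (\<lambda>z :: real ^ 'n. Cs * exp (- (1 / (2 * \<sigma>\<^sup>2)) * (norm z)\<^sup>2))"
      using \<sigma> by (intro integrable_mult_right integrable_exp_neg_square) simp
    then have "(\<integral>\<^sup>+z. ennreal (Cs * exp (- (norm z)\<^sup>2 / (2 * \<sigma>\<^sup>2))) \<partial>(lborel :: (real ^ 'n) measure)) < \<infinity>"
      using Cs unfolding integrable_iff_bounded by (simp add: abs_mult)
    then show "emeasure (gaussian \<sigma> :: (real ^ 'n) measure) (space (gaussian \<sigma>)) \<noteq> \<infinity>"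
      by (simp add: g emeasure_density)
  qed
  interpret P: pair_sigma_finite "gaussian \<sigma> :: (real ^ 'n) measure" \<rho> ..
  have conv: "(\<integral>y. h y \<partial>\<nu>) = (\<integral>y. (\<integral>z. (Cs * exp (- (norm z)\<^sup>2 / (2 * \<sigma>\<^sup>2))) *\<^sub>R h (z + y) \<partial>lborel) \<partial>\<rho>)"
    if i: "integrable \<nu> h" and [measurable]: "h \<in> borel_measurable borel" for h :: "real ^ 'n \<Rightarrow> 'b::euclidean_space"
  proof -
    have i': "integrable (gaussian \<sigma> \<Otimes>\<^sub>M \<rho>) (\<lambda>(z, y). h (z + y))"
      using i unfolding nu convolution_def by (subst (asm) integrable_distr_eq) (auto simp: case_prod_unfold)
    have "(\<integral>y. h y \<partial>\<nu>) = (\<integral>w. (case w of (z, y) \<Rightarrow> h (z + y)) \<partial>(gaussian \<sigma> \<Otimes>\<^sub>M \<rho>))"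
      unfolding nu convolution_def by (subst integral_distr) (auto simp: case_prod_unfold)
    also have "\<dots> = (\<integral>y. (\<integral>z. h (z + y) \<partial>gaussian \<sigma>) \<partial>\<rho>)"
      using P.integral_snd[OF i'] by simp
    also have "\<dots> = (\<integral>y. (\<integral>z. (Cs * exp (- (norm z)\<^sup>2 / (2 * \<sigma>\<^sup>2))) *\<^sub>R h (z + y) \<partial>lborel) \<partial>\<rho>)"
      using Cs by (intro Bochner_Integration.integral_cong[OF refl]) (simp add: g integral_density)
    finally show ?thesis .
  qed
  define z0 where "z0 y = (q * \<sigma>\<^sup>2 / s\<^sup>2) *\<^sub>R (x - q *\<^sub>R y)" for y
  have sq: "(Cs * exp (- (norm z)\<^sup>2 / (2 * \<sigma>\<^sup>2))) * kern p q x (z + y) = (Cs * kern s q x y) * exp (- c * (norm (z - z0 y))\<^sup>2)" for z y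
    using kern_complete_square[OF p \<sigma> s, of z x y] by (simp add: c_def z0_def mult.assoc)
  have ik: "integrable \<rho> (\<lambda>y. kern s q x y)"
    by (rule rho.integrable_const_bound[where B=1]) (auto simp: kern_le_1 less_imp_le[OF kern_pos])
  have iky: "integrable \<rho> (\<lambda>y. kern s q x y *\<^sub>R y)"
  proof (rule rho.integrable_const_bound[where B=B])
    show "AE y in \<rho>. norm (kern s q x y *\<^sub>R y) \<le> B"
      using bdd
    proof eventually_elim
      case (elim y)
      have "kern s q x y * norm y \<le> 1 * norm y" by (intro mult_right_mono kern_le_1) simp
      then show ?case using elim kern_pos[of s q x y] by simp
    qed
  qed simp
  have 1: "(\<integral>y. kern p q x y \<partial>\<nu>) = (Cs * A) * (\<integral>y. kern s q x y \<partial>\<rho>)"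
  proof -
    have "(\<integral>y. kern p q x y \<partial>\<nu>) = (\<integral>y. (\<integral>z. (Cs * exp (- (norm z)\<^sup>2 / (2 * \<sigma>\<^sup>2))) *\<^sub>R kern p q x (z + y) \<partial>lborel) \<partial>\<rho>)"
      by (rule conv[OF integrable_kern]) measurable
    also have "\<dots> = (\<integral>y. (\<integral>z. (Cs * kern s q x y) * exp (- c * (norm (z - z0 y))\<^sup>2) \<partial>lborel) \<partial>\<rho>)"
      by (simp only: real_scaleR_def sq)
    also have "\<dots> = (\<integral>y. (Cs * A) * kern s q x y \<partial>\<rho>)"
      by (simp only: integral_mult_right_zero gm(3)) (simp add: mult_ac)
    finally show ?thesis by simp
  qed
  have comp: "1 - q * \<sigma>\<^sup>2 / s\<^sup>2 * q = p\<^sup>2 / s\<^sup>2"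
  proof -
    have "1 - q * \<sigma>\<^sup>2 / s\<^sup>2 * q = (s\<^sup>2 - q\<^sup>2 * \<sigma>\<^sup>2) / s\<^sup>2"
      using s0 by (simp add: diff_divide_distrib power2_eq_square[of q])
    then show ?thesis by (simp add: s)
  qed
  have zy: "z0 y + y = (q * \<sigma>\<^sup>2 / s\<^sup>2) *\<^sub>R x + (p\<^sup>2 / s\<^sup>2) *\<^sub>R y" for y
    unfolding z0_def comp[symmetric] by (simp add: algebra_simps)
  have 2: "(\<integral>y. kern p q x y *\<^sub>R y \<partial>\<nu>) = (Cs * A) *\<^sub>R ((q * \<sigma>\<^sup>2 / s\<^sup>2) *\<^sub>R ((\<integral>y. kern s q x y \<partial>\<rho>) *\<^sub>R x) + (p\<^sup>2 / s\<^sup>2) *\<^sub>R (\<integral>y. kern s q x y *\<^sub>R y \<partial>\<rho>))"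
  proof -
    have "(\<integral>y. kern p q x y *\<^sub>R y \<partial>\<nu>) = (\<integral>y. (\<integral>z. (Cs * exp (- (norm z)\<^sup>2 / (2 * \<sigma>\<^sup>2))) *\<^sub>R (kern p q x (z + y) *\<^sub>R (z + y)) \<partial>lborel) \<partial>\<rho>)"
      by (rule conv[OF integrable_kern_id]) measurable
    also have "\<dots> = (\<integral>y. (\<integral>z. (Cs * kern s q x y) *\<^sub>R (exp (- c * (norm (z - z0 y))\<^sup>2) *\<^sub>R z + exp (- c * (norm (z - z0 y))\<^sup>2) *\<^sub>R y) \<partial>lborel) \<partial>\<rho>)"
      by (simp only: scaleR_scaleR sq scaleR_add_right[symmetric] )
    also have "\<dots> = (\<integral>y. (Cs * kern s q x y) *\<^sub>R (A *\<^sub>R (z0 y + y)) \<partial>\<rho>)"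
    proof -
      have i: "integrable lborel (\<lambda>z. exp (- c * (norm (z - z0 y))\<^sup>2) *\<^sub>R y)" for y
        by (rule integrable_scaleR_left) (rule gm(2))
      have "(\<integral>z. exp (- c * (norm (z - z0 y))\<^sup>2) *\<^sub>R y \<partial>lborel) = A *\<^sub>R y" for y
        using integral_scaleR_left[of y lborel "\<lambda>z. exp (- c * (norm (z - z0 y))\<^sup>2)"] gm(2)[of "z0 y"] gm(3)[of "z0 y"] by simp
      then have "(\<integral>z. exp (- c * (norm (z - z0 y))\<^sup>2) *\<^sub>R z + exp (- c * (norm (z - z0 y))\<^sup>2) *\<^sub>R y \<partial>lborel) = A *\<^sub>R (z0 y + y)" for y
        by (subst Bochner_Integration.integral_add[OF gm(4) i]) (simp only: gm(5) scaleR_add_right)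
      then show ?thesis by (simp only: integral_scaleR_right)
    qed
    also have "\<dots> = (\<integral>y. (Cs * A) *\<^sub>R ((q * \<sigma>\<^sup>2 / s\<^sup>2) *\<^sub>R (kern s q x y *\<^sub>R x) + (p\<^sup>2 / s\<^sup>2) *\<^sub>R (kern s q x y *\<^sub>R y)) \<partial>\<rho>)"
      unfolding zy by (intro Bochner_Integration.integral_cong refl) (simp add: scaleR_add_right mult_ac)
    also have "\<dots> = (Cs * A) *\<^sub>R ((q * \<sigma>\<^sup>2 / s\<^sup>2) *\<^sub>R ((\<integral>y. kern s q x y \<partial>\<rho>) *\<^sub>R x) + (p\<^sup>2 / s\<^sup>2) *\<^sub>R (\<integral>y. kern s q x y *\<^sub>R y \<partial>\<rho>))"
      using ik iky by (simp del: scaleR_scaleR)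
    finally show ?thesis .
  qed
  have N: "0 < (\<integral>y. kern s q x y \<partial>\<rho>)"
  proof -
    have "0 < (Cs * A) * (\<integral>y. kern s q x y \<partial>\<rho>)" using integral_kern_pos[of p q x] unfolding 1 .
    moreover have "0 < Cs * A" using Cs gm(1) by simp
    ultimately show ?thesis by (rule zero_less_mult_pos)
  qed
  have *: "(D *\<^sub>R (c1 *\<^sub>R (n *\<^sub>R x) + c2 *\<^sub>R w)) /\<^sub>R (D * n) = c1 *\<^sub>R x + c2 *\<^sub>R (w /\<^sub>R n)"
    if "0 < D" "0 < n" for D n c1 c2 and w :: "real ^ 'n"
  proof -
    have "(D *\<^sub>R (c1 *\<^sub>R (n *\<^sub>R x) + c2 *\<^sub>R w)) /\<^sub>R (D * n) = (c1 *\<^sub>R (n *\<^sub>R x) + c2 *\<^sub>R w) /\<^sub>R n"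
      using that(1) by simp
    also have "\<dots> = c1 *\<^sub>R x + c2 *\<^sub>R (w /\<^sub>R n)"
      using that(2) by (simp add: scaleR_add_right mult.commute)
    finally show ?thesis .
  qed
  have "0 < Cs * A" using Cs gm(1) by simp
  then show ?thesis unfolding kern_mean_def 1 2 using N by (rule *)
qed

end

context schedule_pair begin

lemma regular_gaussian_mixture:
  assumes rho: "prob_space \<rho>" and sets_rho: "sets \<rho> = sets borel" and bdd: "AE y in \<rho>. y \<in> cball y0 R"
    and nu: "\<nu> = convolution (gaussian \<sigma>) \<rho>" and \<sigma>: "0 < \<sigma>"
  shows "\<exists>L v1. regular_interpolation a b M Z X1 \<nu> L v1"
proof -
  interpret rho: prob_space \<rho> by (rule rho)
  note [measurable_cong] = sets_rho
  define s where "s t = sqrt ((a t)\<^sup>2 * 1 + (b t)\<^sup>2 * \<sigma>\<^sup>2)" for t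
  have vp: "0 < (a t)\<^sup>2 * 1 + (b t)\<^sup>2 * \<sigma>\<^sup>2" if "t \<in> {0..1}" for t
    using \<sigma> that by (intro variance_pos) auto
  have s: "(s t)\<^sup>2 = (a t)\<^sup>2 + (b t)\<^sup>2 * \<sigma>\<^sup>2" "0 < s t" if "t \<in> {0..1}" for t
    using vp[OF that] by (simp_all add: s_def)
  have sc: "continuous_on {0..1} s" unfolding s_def[abs_def] by (intro continuous_intros a_continuous b_continuous)
  obtain l where l: "0 < l" "\<And>t. t \<in> {0..1} \<Longrightarrow> l \<le> (a t)\<^sup>2 * 1 + (b t)\<^sup>2 * \<sigma>\<^sup>2"
    using uniform_lower_bound[OF variance_continuous vp] by blast
  have bn: "AE y in \<rho>. norm y \<le> norm y0 + R"
    using bdd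
  proof eventually_elim
    case (elim y)
    then show ?case using norm_triangle_ineq2[of y y0] by (simp add: dist_norm norm_minus_commute)
  qed
  have ik: "integrable \<rho> (\<lambda>y. kern p q x y)" for p q x
    by (rule rho.integrable_const_bound[where B=1]) (auto simp: kern_le_1 less_imp_le[OF kern_pos])
  have kp: "0 < (\<integral>y. kern p q x y \<partial>\<rho>)" for p q x
    by (rule integral_pos[OF ik kern_pos]) (use rho.emeasure_space_1 in simp)
  define S where "S = (1 + \<bar>R\<bar>)\<^sup>2 * exp \<bar>R\<bar>"
  have S: "0 < S" unfolding S_def by (intro mult_pos_pos zero_less_power) auto
  have tw: "AE y in \<rho>. tilt_weight ((y - y0) /\<^sub>R 1) \<le> S"
    using bdd
  proof eventually_elim
    case (elim y)
    then have "norm (y - y0) \<le> \<bar>R\<bar>" by (simp add: dist_norm norm_minus_commute)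
    then show ?case unfolding tilt_weight_def S_def by (intro mult_mono power_mono) auto
  qed
  have mom: "integrable \<rho> (\<lambda>y. kern p q x y * tilt_weight ((y - y0) /\<^sub>R 1)) \<and>
       (\<integral>y. kern p q x y * tilt_weight ((y - y0) /\<^sub>R 1) \<partial>\<rho>) \<le> S * (\<integral>y. kern p q x y \<partial>\<rho>)" for p q x
  proof -
    have t0: "0 \<le> tilt_weight u" for u :: "real ^ 'n" using tilt_weight_bounds(1)[of u] by linarith
    have le: "AE y in \<rho>. kern p q x y * tilt_weight ((y - y0) /\<^sub>R 1) \<le> S * kern p q x y"
      using tw
    proof eventually_elim
      case (elim y)
      then show ?case using mult_right_mono[OF elim less_imp_le[OF kern_pos[of p q x y]]] by (simp add: mult.commute)
    qed
    have i: "integrable \<rho> (\<lambda>y. kern p q x y * tilt_weight ((y - y0) /\<^sub>R 1))"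
    proof (rule Bochner_Integration.integrable_bound[OF integrable_mult_right[OF ik, of S]])
      show "AE y in \<rho>. norm (kern p q x y * tilt_weight ((y - y0) /\<^sub>R 1)) \<le> norm (S * kern p q x y)"
        using le
      proof eventually_elim
        case (elim y)
        then show ?case
          using t0[of "(y - y0) /\<^sub>R 1"] S kern_pos[of p q x y] by (simp add: abs_mult)
      qed
    qed measurable
    have "(\<integral>y. kern p q x y * tilt_weight ((y - y0) /\<^sub>R 1) \<partial>\<rho>) \<le> (\<integral>y. S * kern p q x y \<partial>\<rho>)"
      by (rule integral_mono_AE[OF i _ le]) (use ik in simp)
    then show ?thesis using i by simp
  qed
  define m where "m t x = kern_mean \<rho> (s t) (b t) x" for t x
  define Lm where "Lm = 4 * S\<^sup>2 * (1 / l)"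
  have Lm: "0 \<le> Lm" using l by (simp add: Lm_def)
  have m_lip: "norm (m t x - m t y) \<le> Lm * norm (x - y)" if t: "t \<in> {0..1}" for t x y
  proof -
    have "norm (m t x - m t y) \<le> (4 * 1 * S\<^sup>2 * 1\<^sup>2 * (\<bar>b t\<bar> / (s t)\<^sup>2)) * norm (x - y)"
      unfolding m_def kern_mean_eq_avg
      by (rule kern_avg_lipschitz[OF sets_rho _ _ _ zero_less_one S ik kp]) (use mom in auto)
    also have "\<dots> \<le> Lm * norm (x - y)"
    proof (rule mult_right_mono)
      have "\<bar>b t\<bar> / (s t)\<^sup>2 \<le> 1 / l"
        using b_nonneg[OF t] b_le[OF t] l(1) l(2)[OF t] s[OF t] by (intro frac_le) auto
      then show "4 * 1 * S\<^sup>2 * 1\<^sup>2 * (\<bar>b t\<bar> / (s t)\<^sup>2) \<le> Lm" 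
        using mult_left_mono[of "\<bar>b t\<bar> / (s t)\<^sup>2" "1 / l" "4 * S\<^sup>2"] by (simp add: Lm_def)
    qed simp
    finally show ?thesis .
  qed
  have m_cont: "continuous_on {0..1} (\<lambda>t. m t x)" for x
    unfolding m_def
  proof (rule kern_mean_continuous_on[OF rho sets_rho _ sc b_continuous])
    show "integrable \<rho> norm" by (rule rho.integrable_const_bound[where B="norm y0 + R"]) (use bn in auto)
    show "s t \<noteq> 0" if "t \<in> {0..1}" for t using s(2)[OF that] by simp
    show "(\<integral>y. kern (s t) (b t) x y \<partial>\<rho>) \<noteq> 0" for t using kp[of "s t" "b t" x] by simp
  qed
  have mean: "kern_mean \<nu> (a t) (b t) x = (b t * \<sigma>\<^sup>2 / (s t)\<^sup>2) *\<^sub>R x + ((a t)\<^sup>2 / (s t)\<^sup>2) *\<^sub>R m t x" if t: "t \<in> {0..<1}" for t x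
    unfolding m_def by (rule kern_mean_convolution[OF rho sets_rho bn nu \<sigma> a_pos[OF t]]) (use s t in auto)
  define \<alpha> where "\<alpha> t = (sq' t + b' t * (b t * \<sigma>\<^sup>2)) / (s t)\<^sup>2" for t
  define \<beta> where "\<beta> t = (b' t * (a t)\<^sup>2 - sq' t * b t) / (s t)\<^sup>2" for t
  have vel: "cond_velocity (a t) (b t) (a' t) (b' t) x = \<alpha> t *\<^sub>R x + \<beta> t *\<^sub>R m t x" if t: "t \<in> {0..<1}" for t x
  proof -
    have a: "0 < a t" by (rule a_pos[OF t])
    have t1: "t \<in> {0..1}" using t by auto
    have sn: "(s t)\<^sup>2 \<noteq> 0" using s(2)[OF t1] by simp
    have comp: "1 - b t * (b t * \<sigma>\<^sup>2 / (s t)\<^sup>2) = (a t)\<^sup>2 / (s t)\<^sup>2"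
    proof -
      have "1 - b t * (b t * \<sigma>\<^sup>2 / (s t)\<^sup>2) = ((s t)\<^sup>2 - (b t)\<^sup>2 * \<sigma>\<^sup>2) / (s t)\<^sup>2" using sn by (simp add: diff_divide_distrib power2_eq_square)
      then show ?thesis by (simp add: s(1)[OF t1])
    qed
    have "x - b t *\<^sub>R kern_mean \<nu> (a t) (b t) x = (1 - b t * (b t * \<sigma>\<^sup>2 / (s t)\<^sup>2)) *\<^sub>R x - (b t * ((a t)\<^sup>2 / (s t)\<^sup>2)) *\<^sub>R m t x"
      unfolding mean[OF t] by (simp add: scaleR_add_right scaleR_diff_left)
    then have 1: "x - b t *\<^sub>R kern_mean \<nu> (a t) (b t) x = ((a t)\<^sup>2 / (s t)\<^sup>2) *\<^sub>R x - (b t * ((a t)\<^sup>2 / (s t)\<^sup>2)) *\<^sub>R m t x"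
      unfolding comp .
    have q: "a' t / a t * ((a t)\<^sup>2 / (s t)\<^sup>2) = sq' t / (s t)\<^sup>2" using a sq'_eq[OF t] by (simp add: power2_eq_square)
    have "cond_velocity (a t) (b t) (a' t) (b' t) x =
        (a' t / a t * ((a t)\<^sup>2 / (s t)\<^sup>2)) *\<^sub>R x - (b t * (a' t / a t * ((a t)\<^sup>2 / (s t)\<^sup>2))) *\<^sub>R m t x
        + ((b' t * (b t * \<sigma>\<^sup>2 / (s t)\<^sup>2)) *\<^sub>R x + (b' t * ((a t)\<^sup>2 / (s t)\<^sup>2)) *\<^sub>R m t x)"
      unfolding cond_velocity_def 1 unfolding mean[OF t]
      by (simp only: scaleR_diff_right scaleR_add_right scaleR_scaleR mult_ac)
    then show ?thesis
      unfolding q by (simp add: \<alpha>_def \<beta>_def add_divide_distrib diff_divide_distrib scaleR_add_left scaleR_diff_left mult.commute)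
  qed
  have sn: "\<forall>t\<in>{0..1}. (s t)\<^sup>2 \<noteq> 0" using s(2) by force
  have \<alpha>c: "continuous_on {0..1} \<alpha>" unfolding \<alpha>_def[abs_def]
    by (intro continuous_on_divide continuous_on_add continuous_on_mult continuous_on_power continuous_on_const sq'_continuous b'_continuous b_continuous sc sn)
  have \<beta>c: "continuous_on {0..1} \<beta>" unfolding \<beta>_def[abs_def]
    by (intro continuous_on_divide continuous_on_diff continuous_on_mult continuous_on_power continuous_on_const sq'_continuous b'_continuous a_continuous b_continuous sc sn)
  have "bounded (\<alpha> ` {0..1})" "bounded (\<beta> ` {0..1})"
    by (intro compact_imp_bounded compact_continuous_image \<alpha>c \<beta>c; simp)+
  then obtain A B where AB: "\<And>t. t \<in> {0..1} \<Longrightarrow> \<bar>\<alpha> t\<bar> \<le> A" "\<And>t. t \<in> {0..1} \<Longrightarrow> \<bar>\<beta> t\<bar> \<le> B"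
    unfolding bounded_iff real_norm_def by blast
  have AB0: "0 \<le> A" "0 \<le> B" using AB[of 0] by auto
  have "regular_interpolation a b M Z X1 \<nu> (A + B * Lm + 1) (\<lambda>x. \<alpha> 1 *\<^sub>R x + \<beta> 1 *\<^sub>R m 1 x)"
  proof unfold_locales
    show "0 < A + B * Lm + 1" using AB0 Lm by (simp add: add_nonneg_pos)
    fix t assume t: "t \<in> {0..<1::real}"
    then have t1: "t \<in> {0..1}" by auto
    show "\<exists>L. L-lipschitz_on UNIV (kern_mean \<nu> (a t) (b t))"
    proof (intro exI lipschitz_onI)
      let ?L = "\<bar>b t * \<sigma>\<^sup>2 / (s t)\<^sup>2\<bar> + \<bar>(a t)\<^sup>2 / (s t)\<^sup>2\<bar> * Lm"
      show "0 \<le> ?L" using Lm by simp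
      fix x y
      have "kern_mean \<nu> (a t) (b t) x - kern_mean \<nu> (a t) (b t) y = (b t * \<sigma>\<^sup>2 / (s t)\<^sup>2) *\<^sub>R (x - y) + ((a t)\<^sup>2 / (s t)\<^sup>2) *\<^sub>R (m t x - m t y)"
        unfolding mean[OF t] by (simp add: algebra_simps)
      also have "norm \<dots> \<le> \<bar>b t * \<sigma>\<^sup>2 / (s t)\<^sup>2\<bar> * norm (x - y) + \<bar>(a t)\<^sup>2 / (s t)\<^sup>2\<bar> * norm (m t x - m t y)"
        by (rule norm_triangle_le) simp
      also have "\<dots> \<le> \<bar>b t * \<sigma>\<^sup>2 / (s t)\<^sup>2\<bar> * norm (x - y) + \<bar>(a t)\<^sup>2 / (s t)\<^sup>2\<bar> * (Lm * norm (x - y))"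
        by (intro add_mono mult_left_mono m_lip[OF t1]) auto
      finally show "dist (kern_mean \<nu> (a t) (b t) x) (kern_mean \<nu> (a t) (b t) y) \<le> ?L * dist x y"
        by (simp add: dist_norm distrib_right mult.assoc)
    qed
    fix x y
    have "cond_velocity (a t) (b t) (a' t) (b' t) x - cond_velocity (a t) (b t) (a' t) (b' t) y = \<alpha> t *\<^sub>R (x - y) + \<beta> t *\<^sub>R (m t x - m t y)"
      unfolding vel[OF t] by (simp add: algebra_simps)
    also have "norm \<dots> \<le> \<bar>\<alpha> t\<bar> * norm (x - y) + \<bar>\<beta> t\<bar> * norm (m t x - m t y)" by (rule norm_triangle_le) simp
    also have "\<dots> \<le> A * norm (x - y) + B * (Lm * norm (x - y))"
      using AB0 by (intro add_mono mult_mono AB t1 m_lip) auto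
    also have "\<dots> \<le> (A + B * Lm + 1) * norm (x - y)" by (simp add: algebra_simps)
    finally show "norm (cond_velocity (a t) (b t) (a' t) (b' t) x - cond_velocity (a t) (b t) (a' t) (b' t) y) \<le> (A + B * Lm + 1) * norm (x - y)" .
  next
    fix x
    have "((\<lambda>t. \<alpha> t *\<^sub>R x + \<beta> t *\<^sub>R m t x) \<longlongrightarrow> \<alpha> 1 *\<^sub>R x + \<beta> 1 *\<^sub>R m 1 x) (at_left 1)"
      by (intro tendsto_intros tendsto_at_left_1 \<alpha>c \<beta>c m_cont)
    moreover have "\<forall>\<^sub>F t in at_left 1. \<alpha> t *\<^sub>R x + \<beta> t *\<^sub>R m t x = cond_velocity (a t) (b t) (a' t) (b' t) x"
      using eventually_at_left_real[of 0 "1::real"] by (auto elim!: eventually_mono simp: vel)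
    ultimately show "((\<lambda>t. cond_velocity (a t) (b t) (a' t) (b' t) x) \<longlongrightarrow> \<alpha> 1 *\<^sub>R x + \<beta> 1 *\<^sub>R m 1 x) (at_left 1)"
      by (rule Lim_transform_eventually)
  qed
  then show ?thesis by blast
qed

end

theorem theorem25:
  fixes M :: "'w measure"
    and Z X1 :: "'w \<Rightarrow> real ^ 'n"
    and \<nu> :: "(real ^ 'n) measure"
    and a b :: "real \<Rightarrow> real"
  assumes "interpolation_schedule a b"
    and "prob_space M"
    and "prob_space.indep_var M borel Z borel X1"
    and "distr M borel Z = gaussian 1"
    and "distr M borel X1 = \<nu>"
    and "prob_space \<nu>"
    and "sets \<nu> = sets borel"
    and "absolutely_continuous lborel \<nu>"
    and "integrable \<nu> (\<lambda>x. (norm x)\<^sup>2)"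
    and "(\<exists>\<beta> \<kappa>. \<beta> > 0 \<and> \<kappa> > 0 \<and> semi_log_convex \<beta> \<nu> \<and> semi_log_concave \<kappa> \<nu> \<and>
            measure_support \<nu> = UNIV)
       \<or> (\<exists>\<sigma> R c. \<exists>\<rho> :: (real ^ 'n) measure. \<sigma> > 0 \<and> R > 0 \<and>
            prob_space \<rho> \<and> sets \<rho> = sets borel \<and> (AE x in \<rho>. x \<in> cball c R) \<and>
            \<nu> = convolution (gaussian \<sigma>) \<rho>)
       \<or> (\<exists>\<beta> \<kappa> L. \<beta> > 0 \<and> \<kappa> \<le> 0 \<and> L \<ge> 0 \<and> semi_log_convex \<beta> \<nu> \<and> semi_log_concave \<kappa> \<nu> \<and>
            (\<exists>f. (AE x in gaussian 1. RN_deriv (gaussian 1) \<nu> x = ennreal (f x)) \<and> log_lipschitz L f) \<and>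
            measure_support \<nu> = UNIV)"
  defines "v \<equiv> velocity M a b Z X1"
    and "\<mu> \<equiv> distr M borel (interpolant a b Z X1 0)"
  shows "\<exists>X :: real \<Rightarrow> real ^ 'n \<Rightarrow> real ^ 'n.
           (\<forall>x. ivp_solution v x (\<lambda>t. X t x) \<and>
                (\<forall>y. ivp_solution v x y \<longrightarrow> (\<forall>t\<in>{0..1}. y t = X t x))) \<and>
           (\<forall>t\<in>{0..1}. X t \<in> borel_measurable borel \<and>
                distr \<mu> borel (X t) = distr M borel (interpolant a b Z X1 t))"
proof -
  interpret prob_space M by fact
  interpret schedule_pair a b M Z X1 \<nu>
    by unfold_locales fact+
  have "\<exists>L v1. regular_interpolation a b M Z X1 \<nu> L v1"
    using assms(10) regular_strongly_log_concave regular_gaussian_mixture regular_log_lipschitz by blast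
  then obtain L v1 where "regular_interpolation a b M Z X1 \<nu> L v1" by blast
  then interpret regular_interpolation a b M Z X1 \<nu> L v1 .
  show ?thesis unfolding v_def \<mu>_def by (rule unique_flow_and_law)
qed

end
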